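(* Let $G$ be a connected reductive linear algebraic group over $\mathbb{C}$, let $H\subset G$ be a closed subgroup, and let $\mathcal{X}:G/H\to\mathbb{C}^*$ be a non-constant morphism of algebraic varieties with $\mathcal{X}(eH)=1$. Let $S$ be the kernel of the associated character $\mathcal{X}':G\to\mathbb{C}^*$ (so $H\subset S$), and consider the fibration of homogeneous spaces $$S/H\to G/H\xrightarrow{\mathcal{X}}\mathbb{C}^*.$$ If $S$ is connected, then this fibration is (rationally) cohomologically trivial.
   Context: All algebraic groups and varieties are over $\mathbb{C}$, with their classical (complex analytic) topology. The associated character of $\mathcal{X}$ is the composite $\mathcal{X}'=\mathcal{X}\circ\pi:G\to\mathbb{C}^*$, with $\pi:G\to G/H$ the quotient map; it is a morphism of varieties to $\mathbb{C}^*$ sending the identity to $1$ and is therefore a homomorphism of algebraic groups (Rosenlicht). The fibre of $\mathcal{X}$ over $1$ is $S/H$. A fibration $F\hookrightarrow E\to B$ is called (rationally) cohomologically trivial if for each $k$ there is an isomorphism of $\mathbb{Q}$-vector spaces $H^k(E;\mathbb{Q})\cong\bigoplus_{p+q=k}H^p(F;\mathbb{Q})\otimes H^q(B;\mathbb{Q})$, where $H^*(-;\mathbb{Q})$ is singular cohomology. *)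

theory Defs
  imports "HOL-Homology.Homology" "HOL-Algebra.Module" "HOL-Algebra.Left_Coset"
begin

section \<open>Complex varieties as spaces with functions\<close>

text \<open>
  The algebra of polynomial functions in the coordinate functions \<open>C\<close>; here \<open>C\<close> is the set
  of matrix entries on affine space of matrices, or the identity on the affine line.
\<close>

inductive_set poly_funs :: "('a \<Rightarrow> complex) set \<Rightarrow> ('a \<Rightarrow> complex) set"
  for C :: "('a \<Rightarrow> complex) set" where
  const: "(\<lambda>_. c) \<in> poly_funs C"
| coord: "x \<in> C \<Longrightarrow> x \<in> poly_funs C"
| add: "p \<in> poly_funs C \<Longrightarrow> q \<in> poly_funs C \<Longrightarrow> (\<lambda>x. p x + q x) \<in> poly_funs C"
| mult: "p \<in> poly_funs C \<Longrightarrow> q \<in> poly_funs C \<Longrightarrow> (\<lambda>x. p x * q x) \<in> poly_funs C"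

definition zariski_topology :: "('a \<Rightarrow> complex) set \<Rightarrow> 'a set \<Rightarrow> 'a topology" where
  "zariski_topology C X = topology_generated_by ((\<lambda>p. {x \<in> X. p x \<noteq> 0}) ` poly_funs C)"

text \<open>
  A space with functions: a topology together with a set of regular functions for each open
  set \<open>U\<close>. Functions are total, and only the values on \<open>U\<close> matter for membership in
  \<open>regular V U\<close>.
\<close>

record 'a variety =
  zariski :: "'a topology"
  regular :: "'a set \<Rightarrow> ('a \<Rightarrow> complex) set"

text \<open>A locally closed subset \<open>X\<close> of affine space: regular functions are locally quotients of
  polynomials.\<close>

definition quasi_affine :: "('a \<Rightarrow> complex) set \<Rightarrow> 'a set \<Rightarrow> 'a variety" where
  "quasi_affine C X =
    \<lparr>zariski = zariski_topology C X,
     regular = (\<lambda>U. {f. \<forall>x\<in>U. \<exists>V. openin (zariski_topology C X) V \<and> x \<in> V \<and> V \<subseteq> U \<and>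
       (\<exists>p \<in> poly_funs C. \<exists>q \<in> poly_funs C. \<forall>y\<in>V. q y \<noteq> 0 \<and> f y = p y / q y)})\<rparr>"

definition morphism :: "'a variety \<Rightarrow> 'b variety \<Rightarrow> ('a \<Rightarrow> 'b) \<Rightarrow> bool" where
  "morphism V W \<phi> \<longleftrightarrow>
    continuous_map (zariski V) (zariski W) \<phi> \<and>
    (\<forall>U f. openin (zariski W) U \<longrightarrow> f \<in> regular W U \<longrightarrow>
       f \<circ> \<phi> \<in> regular V {x \<in> topspace (zariski V). \<phi> x \<in> U})"

definition quotient_topology :: "'a topology \<Rightarrow> ('a \<Rightarrow> 'b) \<Rightarrow> 'b topology" where
  "quotient_topology T \<pi> =
    topology (\<lambda>U. U \<subseteq> \<pi> ` topspace T \<and> openin T {x \<in> topspace T. \<pi> x \<in> U})"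

lemma openin_quotient_topology:
  "openin (quotient_topology T \<pi>) U \<longleftrightarrow>
    U \<subseteq> \<pi> ` topspace T \<and> openin T {x \<in> topspace T. \<pi> x \<in> U}"
proof -
  have "istopology (\<lambda>U. U \<subseteq> \<pi> ` topspace T \<and> openin T {x \<in> topspace T. \<pi> x \<in> U})"
    unfolding istopology_def
  proof (intro conjI allI impI; (elim conjE)?)
    fix A B
    assume "openin T {x \<in> topspace T. \<pi> x \<in> A}" "openin T {x \<in> topspace T. \<pi> x \<in> B}"
    moreover have "{x \<in> topspace T. \<pi> x \<in> A \<inter> B} =
        {x \<in> topspace T. \<pi> x \<in> A} \<inter> {x \<in> topspace T. \<pi> x \<in> B}" by auto
    ultimately show "openin T {x \<in> topspace T. \<pi> x \<in> A \<inter> B}"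
      by (simp only: openin_Int)
  next
    fix K
    assume "\<forall>A\<in>K. A \<subseteq> \<pi> ` topspace T \<and> openin T {x \<in> topspace T. \<pi> x \<in> A}"
    then have "openin T (\<Union>A\<in>K. {x \<in> topspace T. \<pi> x \<in> A})" by blast
    moreover have "{x \<in> topspace T. \<pi> x \<in> \<Union>K} = (\<Union>A\<in>K. {x \<in> topspace T. \<pi> x \<in> A})" by auto
    ultimately show "openin T {x \<in> topspace T. \<pi> x \<in> \<Union>K}"
      by (simp only:)
  qed blast+
  then show ?thesis by (simp add: quotient_topology_def)
qed

lemma topspace_quotient_topology [simp]:
  "topspace (quotient_topology T \<pi>) = \<pi> ` topspace T"
proof -
  have "{x \<in> topspace T. \<pi> x \<in> \<pi> ` topspace T} = topspace T" by auto
  then have "openin (quotient_topology T \<pi>) (\<pi> ` topspace T)"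
    by (simp add: openin_quotient_topology)
  then show ?thesis
    using openin_subset openin_topspace openin_quotient_topology by (metis subset_antisym)
qed

lemma quotient_map_quotient_topology: "quotient_map T (quotient_topology T \<pi>) \<pi>"
  by (auto simp: quotient_map_def openin_quotient_topology)

text \<open>A function on the quotient is regular iff its pullback along \<open>\<pi>\<close> is; for an algebraic group
  and the projection to cosets of a closed subgroup this is the structure sheaf of \<open>G/H\<close>.\<close>

definition quotient_variety :: "'a variety \<Rightarrow> ('a \<Rightarrow> 'b) \<Rightarrow> 'b variety" where
  "quotient_variety V \<pi> =
    \<lparr>zariski = quotient_topology (zariski V) \<pi>,
     regular = (\<lambda>U. {f. f \<circ> \<pi> \<in> regular V {x \<in> topspace (zariski V). \<pi> x \<in> U}})\<rparr>"

section \<open>Linear algebraic groups\<close>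

definition GL :: "(complex^'n^'n) monoid" where
  "GL = \<lparr>carrier = {A. invertible A}, mult = (**), one = mat 1\<rparr>"

abbreviation matrix_group :: "(complex^'n^'n) set \<Rightarrow> (complex^'n^'n) monoid" where
  "matrix_group G \<equiv> GL\<lparr>carrier := G\<rparr>"

definition entries :: "(complex^'n^'n \<Rightarrow> complex) set" where
  "entries = {(\<lambda>A. A $ i $ j) | i j. True}"

definition linear_algebraic_group :: "(complex^'n^'n) set \<Rightarrow> bool" where
  "linear_algebraic_group G \<longleftrightarrow>
    subgroup G GL \<and> closedin (zariski_topology entries (carrier GL)) G"

definition closed_subgroup :: "(complex^'n^'n) set \<Rightarrow> (complex^'n^'n) set \<Rightarrow> bool" where
  "closed_subgroup H G \<longleftrightarrow>
    subgroup H (matrix_group G) \<and> closedin (zariski_topology entries G) H"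

definition unipotent :: "complex^'n^'n \<Rightarrow> bool" where
  "unipotent u \<longleftrightarrow> (\<exists>k. (((**) (u - mat 1)) ^^ k) (mat 1) = 0)"

text \<open>
  Trivial unipotent radical. Connectedness refers to the classical topology here and below;
  for algebraic groups over the complex numbers it agrees with Zariski connectedness.
\<close>

definition reductive :: "(complex^'n^'n) set \<Rightarrow> bool" where
  "reductive G \<longleftrightarrow>
    (\<forall>U. closed_subgroup U G \<and> U \<lhd> matrix_group G \<and> connected U \<and> (\<forall>u\<in>U. unipotent u)
       \<longrightarrow> U = {mat 1})"

definition coset_proj :: "(complex^'n^'n) set \<Rightarrow> complex^'n^'n \<Rightarrow> (complex^'n^'n) set" where
  "coset_proj H g = g <#\<^bsub>GL\<^esub> H"

definition homogeneous_variety ::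
    "(complex^'n^'n) set \<Rightarrow> (complex^'n^'n) set \<Rightarrow> (complex^'n^'n) set variety" where
  "homogeneous_variety G H = quotient_variety (quasi_affine entries G) (coset_proj H)"

text \<open>The homogeneous space \<open>G/H\<close> with its classical topology, the quotient of the classical
  topology of \<open>G\<close>.\<close>

definition homogeneous_space ::
    "(complex^'n^'n) set \<Rightarrow> (complex^'n^'n) set \<Rightarrow> (complex^'n^'n) set topology" where
  "homogeneous_space G H = quotient_topology (top_of_set G) (coset_proj H)"

lemma topspace_homogeneous_space:
  "topspace (homogeneous_space G H) = lcosets\<^bsub>matrix_group G\<^esub> H"
  by (auto simp: homogeneous_space_def coset_proj_def LCOSETS_def l_coset_def GL_def)

definition Cstar_variety :: "complex variety" where
  "Cstar_variety = quasi_affine {\<lambda>z. z} (UNIV - {0})"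

definition Cstar_group :: "complex monoid" where
  "Cstar_group = \<lparr>carrier = UNIV - {0}, mult = (*), one = 1\<rparr>"

definition Cstar_space :: "complex topology" where
  "Cstar_space = top_of_set (UNIV - {0})"

section \<open>Modules\<close>

text \<open>
  The record \<open>module\<close> extends \<open>ring\<close>; the fields \<open>mult\<close> and \<open>one\<close> play no role
  for modules and are left unspecified throughout.
\<close>

definition quotient_module ::
    "('r, 'a, 'm) module_scheme \<Rightarrow> 'a set \<Rightarrow> ('r, 'a set) module" where
  "quotient_module M N =
    \<lparr>carrier = a_rcosets\<^bsub>M\<^esub> N, mult = undefined, one = undefined,
     zero = N, add = (\<lambda>A B. A <+>\<^bsub>M\<^esub> B),
     smult = (\<lambda>r A. \<Union>a\<in>A. N +>\<^bsub>M\<^esub> (r \<odot>\<^bsub>M\<^esub> a))\<rparr>"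

definition free_module :: "('r, 'k) ring_scheme \<Rightarrow> 'i set \<Rightarrow> ('r, 'i \<Rightarrow> 'r) module" where
  "free_module R I =
    \<lparr>carrier = {f. range f \<subseteq> carrier R \<and> finite {i. f i \<noteq> \<zero>\<^bsub>R\<^esub>} \<and> {i. f i \<noteq> \<zero>\<^bsub>R\<^esub>} \<subseteq> I},
     mult = undefined, one = undefined,
     zero = (\<lambda>i. \<zero>\<^bsub>R\<^esub>), add = (\<lambda>f g i. f i \<oplus>\<^bsub>R\<^esub> g i),
     smult = (\<lambda>r f i. r \<otimes>\<^bsub>R\<^esub> f i)\<rparr>"

definition free_gen :: "('r, 'k) ring_scheme \<Rightarrow> 'i \<Rightarrow> 'i \<Rightarrow> 'r" where
  "free_gen R i = (\<lambda>j. if j = i then \<one>\<^bsub>R\<^esub> else \<zero>\<^bsub>R\<^esub>)"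

definition generated_submodule ::
    "('r, 'k) ring_scheme \<Rightarrow> ('r, 'a, 'm) module_scheme \<Rightarrow> 'a set \<Rightarrow> 'a set" where
  "generated_submodule R M A = \<Inter>{K. submodule K R M \<and> A \<subseteq> K}"

definition bilinear_relations ::
    "('r, 'k) ring_scheme \<Rightarrow> ('r, 'a, 'm) module_scheme \<Rightarrow> ('r, 'b, 'n) module_scheme
      \<Rightarrow> ('a \<times> 'b \<Rightarrow> 'r) set" where
  "bilinear_relations R M N =
    (let F = free_module R (carrier M \<times> carrier N); e = free_gen R in
      {e (x \<oplus>\<^bsub>M\<^esub> x', y) \<ominus>\<^bsub>F\<^esub> (e (x, y) \<oplus>\<^bsub>F\<^esub> e (x', y)) | x x' y.
         x \<in> carrier M \<and> x' \<in> carrier M \<and> y \<in> carrier N} \<union>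
      {e (x, y \<oplus>\<^bsub>N\<^esub> y') \<ominus>\<^bsub>F\<^esub> (e (x, y) \<oplus>\<^bsub>F\<^esub> e (x, y')) | x y y'.
         x \<in> carrier M \<and> y \<in> carrier N \<and> y' \<in> carrier N} \<union>
      {e (r \<odot>\<^bsub>M\<^esub> x, y) \<ominus>\<^bsub>F\<^esub> r \<odot>\<^bsub>F\<^esub> e (x, y) | r x y.
         r \<in> carrier R \<and> x \<in> carrier M \<and> y \<in> carrier N} \<union>
      {e (x, r \<odot>\<^bsub>N\<^esub> y) \<ominus>\<^bsub>F\<^esub> r \<odot>\<^bsub>F\<^esub> e (x, y) | r x y.
         r \<in> carrier R \<and> x \<in> carrier M \<and> y \<in> carrier N})"

definition tensor_product ::
    "('r, 'k) ring_scheme \<Rightarrow> ('r, 'a, 'm) module_scheme \<Rightarrow> ('r, 'b, 'n) module_scheme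
      \<Rightarrow> ('r, ('a \<times> 'b \<Rightarrow> 'r) set) module" where
  "tensor_product R M N =
    (let F = free_module R (carrier M \<times> carrier N) in
      quotient_module F (generated_submodule R F (bilinear_relations R M N)))"

text \<open>The direct sum over a finite index set \<open>I\<close>.\<close>

definition finite_direct_sum ::
    "'i set \<Rightarrow> ('i \<Rightarrow> ('r, 'a) module) \<Rightarrow> ('r, 'i \<Rightarrow> 'a) module" where
  "finite_direct_sum I M =
    \<lparr>carrier = (\<Pi>\<^sub>E i\<in>I. carrier (M i)), mult = undefined, one = undefined,
     zero = (\<lambda>i\<in>I. \<zero>\<^bsub>M i\<^esub>), add = (\<lambda>f g. \<lambda>i\<in>I. f i \<oplus>\<^bsub>M i\<^esub> g i),
     smult = (\<lambda>r f. \<lambda>i\<in>I. r \<odot>\<^bsub>M i\<^esub> f i)\<rparr>"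

definition module_isomorphic ::
    "('r, 'k) ring_scheme \<Rightarrow> ('r, 'a, 'm) module_scheme \<Rightarrow> ('r, 'b, 'n) module_scheme \<Rightarrow> bool" where
  "module_isomorphic R M N \<longleftrightarrow>
    (\<exists>f. bij_betw f (carrier M) (carrier N) \<and>
       (\<forall>x\<in>carrier M. \<forall>y\<in>carrier M. f (x \<oplus>\<^bsub>M\<^esub> y) = f x \<oplus>\<^bsub>N\<^esub> f y) \<and>
       (\<forall>r\<in>carrier R. \<forall>x\<in>carrier M. f (r \<odot>\<^bsub>M\<^esub> x) = r \<odot>\<^bsub>N\<^esub> f x))"

section \<open>Rational singular cohomology\<close>

definition rat_field :: "rat ring" where
  "rat_field = \<lparr>carrier = UNIV, mult = (*), one = 1, zero = 0, add = (+)\<rparr>"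

text \<open>The group \<open>Hom(C\<^sub>p(X), \<rat>)\<close> dual to the integral singular chain group.\<close>

definition cochain_module :: "nat \<Rightarrow> 'a topology \<Rightarrow> (rat, 'a chain \<Rightarrow> rat) module" where
  "cochain_module p X =
    \<lparr>carrier = hom (chain_group p X) (add_monoid rat_field) \<inter> extensional (singular_chain_set p X),
     mult = undefined, one = undefined,
     zero = (\<lambda>c\<in>singular_chain_set p X. 0),
     add = (\<lambda>\<phi> \<psi>. \<lambda>c\<in>singular_chain_set p X. \<phi> c + \<psi> c),
     smult = (\<lambda>r \<phi>. \<lambda>c\<in>singular_chain_set p X. r * \<phi> c)\<rparr>"

definition coboundary :: "nat \<Rightarrow> 'a topology \<Rightarrow> ('a chain \<Rightarrow> rat) \<Rightarrow> 'a chain \<Rightarrow> rat" where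
  "coboundary p X \<phi> = (\<lambda>c\<in>singular_chain_set (Suc p) X. \<phi> (chain_boundary (Suc p) c))"

definition cocycles :: "nat \<Rightarrow> 'a topology \<Rightarrow> ('a chain \<Rightarrow> rat) set" where
  "cocycles p X =
    {\<phi> \<in> carrier (cochain_module p X). coboundary p X \<phi> = \<zero>\<^bsub>cochain_module (Suc p) X\<^esub>}"

definition coboundaries :: "nat \<Rightarrow> 'a topology \<Rightarrow> ('a chain \<Rightarrow> rat) set" where
  "coboundaries p X =
    (case p of 0 \<Rightarrow> {\<zero>\<^bsub>cochain_module 0 X\<^esub>}
     | Suc q \<Rightarrow> coboundary q X ` carrier (cochain_module q X))"

definition cohomology :: "nat \<Rightarrow> 'a topology \<Rightarrow> (rat, ('a chain \<Rightarrow> rat) set) module" where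
  "cohomology p X =
    quotient_module (cochain_module p X\<lparr>carrier := cocycles p X\<rparr>) (coboundaries p X)"

text \<open>For a fibration with fibre \<open>F\<close>, total space \<open>E\<close> and base \<open>B\<close>.\<close>

definition cohomologically_trivial :: "'f topology \<Rightarrow> 'e topology \<Rightarrow> 'b topology \<Rightarrow> bool" where
  "cohomologically_trivial F E B \<longleftrightarrow>
    (\<forall>k. module_isomorphic rat_field (cohomology k E)
       (finite_direct_sum {..k}
         (\<lambda>p. tensor_product rat_field (cohomology p F) (cohomology (k - p) B))))"

end

theory Submission
  imports Defs "HOL-Complex_Analysis.Complex_Analysis" "HOL-Library.Function_Algebras"
    "HOL-Computational_Algebra.Fundamental_Theorem_Algebra"
begin

text \<open>
  The character \<open>f\<close> associated with \<open>\<X>\<close> has a continuous section over \<open>\<complex>\<^sup>*\<close>. Its differential is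
  nonzero, so some complex one-parameter subgroup satisfies \<open>f (e t) = exp t\<close>; then \<open>e (2 \<pi> \<i>)\<close> lies in
  \<open>S\<close>, and since a connected linear group is generated by its one-parameter subgroups a path in \<open>S\<close>
  corrects \<open>e\<close> to a section that is single-valued on \<open>\<complex>\<^sup>*\<close>. Translating by the section gives a
  homeomorphism of \<open>G/H\<close> with \<open>S/H \<times> \<complex>\<^sup>*\<close>. Finally \<open>H\<^sub>k (X \<times> \<complex>\<^sup>*)\<close> is \<open>H\<^sub>k X \<oplus> H\<^sub>k\<^sub>-\<^sub>1 X\<close>, rational
  cohomology is the dual of integral homology, and tensoring with a line changes nothing.
\<close>

text \<open>The character is given only as a nowhere vanishing regular function, locally a quotient
  of polynomials. Showing that it is multiplicative takes a growth bound along every one-parameter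
  group whose exponent is independent of the base point, and a local description gives no such
  bound. Hence the detour through the Nullstellensatz: a regular function on \<open>G\<close> is one
  global polynomial in the entries and \<open>1 / det A\<close>, so it has exponential type, and an
  entire function of exponential type without zeros is an exponential. Connectedness of
  \<open>S\<close> removes the only obstruction to a section. Squaring on the punctured plane shows
  what it excludes: the fibre has two points, the total space is connected, and already degree 0
  fails. The isomorphisms asked for are abstract, one in each degree, so integral homology groups up
  to isomorphism carry all the information; no Ext term appears because the rationals are
  divisible.\<close>

unbundle no fps_syntax

section \<open>The matrix exponential\<close>

text \<open>The vector type of matrices carries neither ring multiplication nor a submultiplicative norm;
  a copy of it with the operator norm makes the library exponential available.\<close>

typedef 'n matop = "UNIV :: (complex^'n^'n) set"
  morphisms mat_of Matop by auto

setup_lifting type_definition_matop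

instantiation matop :: (finite) ring_1
begin
lift_definition zero_matop :: "'a matop" is "0" .
lift_definition one_matop :: "'a matop" is "mat 1" .
lift_definition plus_matop :: "'a matop \<Rightarrow> 'a matop \<Rightarrow> 'a matop" is "(+)" .
lift_definition minus_matop :: "'a matop \<Rightarrow> 'a matop \<Rightarrow> 'a matop" is "(-)" .
lift_definition uminus_matop :: "'a matop \<Rightarrow> 'a matop" is "uminus" .
lift_definition times_matop :: "'a matop \<Rightarrow> 'a matop \<Rightarrow> 'a matop" is "(**)" .
instance
proof
  show "(0::'a matop) \<noteq> 1"
    by transfer (auto simp: vec_eq_iff mat_def)
next
  fix a b c :: "'a matop"
  show "(a + b) * c = a * c + b * c"
    by transfer (simp add: matrix_matrix_mult_def vec_eq_iff sum.distrib algebra_simps)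
qed (transfer; simp add: matrix_mul_assoc matrix_add_ldistrib add.assoc)+
end

lemma matrix_scaleR_mult:
  fixes A B :: "'a::real_algebra_1^'n^'n"
  shows "(a *\<^sub>R A) ** B = a *\<^sub>R (A ** B)" "A ** (a *\<^sub>R B) = a *\<^sub>R (A ** B)"
  by (auto simp: matrix_matrix_mult_def vec_eq_iff scaleR_sum_right)

instantiation matop :: (finite) real_algebra_1
begin
lift_definition scaleR_matop :: "real \<Rightarrow> 'a matop \<Rightarrow> 'a matop" is "(*\<^sub>R)" .
instance
  by standard (transfer; simp add: scaleR_add_right scaleR_add_left matrix_scaleR_mult)+
end

instantiation matop :: (finite) real_normed_algebra_1
begin
lift_definition norm_matop :: "'a matop \<Rightarrow> real" is "\<lambda>A. onorm ((*v) A)" .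
definition dist_matop :: "'a matop \<Rightarrow> 'a matop \<Rightarrow> real" where "dist_matop x y = norm (x - y)"
definition uniformity_matop :: "('a matop \<times> 'a matop) filter" where
  "uniformity_matop = (INF e\<in>{0 <..}. principal {(x, y). dist x y < e})"
definition open_matop :: "'a matop set \<Rightarrow> bool" where
  "open_matop U = (\<forall>x\<in>U. eventually (\<lambda>(x', y). x' = x \<longrightarrow> y \<in> U) uniformity)"
definition sgn_matop :: "'a matop \<Rightarrow> 'a matop" where "sgn_matop x = x /\<^sub>R norm x"
instance
proof
  fix x y :: "'a matop" and a :: real
  show "norm x = 0 \<longleftrightarrow> x = 0"
    by transfer (metis matrix_eq matrix_vector_mul_bounded_linear matrix_vector_mult_0 onorm_eq_0)
  show "norm (x + y) \<le> norm x + norm y"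
  proof transfer
    fix x y :: "complex^'a^'a"
    have "(*v) (x + y) = (\<lambda>v. x *v v + y *v v)"
      by (auto simp: matrix_vector_mult_add_rdistrib)
    then show "onorm ((*v) (x + y)) \<le> onorm ((*v) x) + onorm ((*v) y)"
      using onorm_triangle[OF matrix_vector_mul_bounded_linear matrix_vector_mul_bounded_linear, of x y]
      by simp
  qed
  show "norm (a *\<^sub>R x) = \<bar>a\<bar> * norm x"
  proof transfer
    fix a :: real and x :: "complex^'a^'a"
    have "(\<lambda>v. (a *\<^sub>R x) *v v) = (\<lambda>v. a *\<^sub>R (x *v v))"
      by (auto simp: matrix_vector_mult_def vec_eq_iff scaleR_sum_right)
    then show "onorm ((*v) (a *\<^sub>R x)) = \<bar>a\<bar> * onorm ((*v) x)"
      using onorm_scaleR[OF matrix_vector_mul_bounded_linear[of x], of a] by metis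
  qed
  show "norm (x * y) \<le> norm x * norm y"
    by transfer (use onorm_compose[OF matrix_vector_mul_bounded_linear matrix_vector_mul_bounded_linear]
        in \<open>simp add: o_def matrix_vector_mul_assoc\<close>)
  show "norm (1::'a matop) = 1"
  proof transfer
    have "((*v) (mat 1)) = (\<lambda>x::complex^'a. x)" by auto
    then show "onorm ((*v) (mat 1) :: complex^'a \<Rightarrow> _) = 1" by (metis onorm_id)
  qed
qed (rule dist_matop_def uniformity_matop_def open_matop_def sgn_matop_def)+
end

lemma norm_entry_le_onorm:
  fixes A :: "complex^'n^'n"
  shows "norm (A $ i $ j) \<le> onorm ((*v) A)"
proof -
  have "A $ i $ j = (A *v axis j 1) $ i"
    by (simp add: matrix_vector_mult_def axis_def if_distrib cong: if_cong)
  then have "norm (A $ i $ j) \<le> norm (A *v axis j 1)"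
    by (simp add: Finite_Cartesian_Product.norm_nth_le)
  also have "\<dots> \<le> onorm ((*v) A) * norm (axis j 1 :: complex^'n)"
    by (rule onorm) simp
  finally show ?thesis by simp
qed

text \<open>Crude entrywise estimates in both directions suffice: they make the operator norm
  equivalent to the Euclidean one, which carries limits and completeness over to the copy.\<close>

lemma norm_matrix_le_onorm:
  fixes A :: "complex^'n^'n"
  shows "norm A \<le> real CARD('n) * (real CARD('n) * onorm ((*v) A))"
proof -
  have "norm A \<le> (\<Sum>i\<in>UNIV. norm (A $ i))"
    unfolding norm_vec_def by (rule L2_set_le_sum) simp
  also have "\<dots> \<le> (\<Sum>i\<in>(UNIV::'n set). \<Sum>j\<in>UNIV. norm (A $ i $ j))"
    by (rule sum_mono) (unfold norm_vec_def, rule L2_set_le_sum, simp)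
  also have "\<dots> \<le> (\<Sum>i\<in>(UNIV::'n set). \<Sum>j\<in>(UNIV::'n set). onorm ((*v) A))"
    by (intro sum_mono norm_entry_le_onorm)
  finally show ?thesis by simp
qed

lemma onorm_le_norm_matrix:
  fixes A :: "complex^'n^'n"
  shows "onorm ((*v) A) \<le> real CARD('n) * (real CARD('n) * norm A)"
proof (rule onorm_bound)
  fix x :: "complex^'n"
  have "norm (A *v x) \<le> (\<Sum>i\<in>UNIV. norm ((A *v x) $ i))"
    unfolding norm_vec_def by (rule L2_set_le_sum) simp
  also have "\<dots> \<le> (\<Sum>i\<in>(UNIV::'n set). \<Sum>j\<in>(UNIV::'n set). norm A * norm x)"
  proof (rule sum_mono)
    fix i
    have "norm ((A *v x) $ i) \<le> (\<Sum>j\<in>UNIV. norm (A $ i $ j * x $ j))"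
      by (simp add: matrix_vector_mult_def norm_sum)
    also have "\<dots> \<le> (\<Sum>j\<in>(UNIV::'n set). norm A * norm x)"
    proof (rule sum_mono)
      fix j
      have "norm (A $ i $ j) \<le> norm A"
        by (meson Finite_Cartesian_Product.norm_nth_le order_trans)
      then show "norm (A $ i $ j * x $ j) \<le> norm A * norm x"
        by (simp add: norm_mult Finite_Cartesian_Product.norm_nth_le mult_mono)
    qed
    finally show "norm ((A *v x) $ i) \<le> (\<Sum>j\<in>(UNIV::'n set). norm A * norm x)" .
  qed
  finally show "norm (A *v x) \<le> real CARD('n) * (real CARD('n) * norm A) * norm x" by simp
qed simp

lemma bounded_linear_mat_of: "bounded_linear (mat_of :: 'n::finite matop \<Rightarrow> _)"
proof (rule bounded_linear_intro[where K = "real CARD('n) * real CARD('n)"])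
  fix x :: "'n matop"
  show "norm (mat_of x) \<le> norm x * (real CARD('n) * real CARD('n))"
    using norm_matrix_le_onorm[of "mat_of x"] by (simp add: norm_matop.rep_eq algebra_simps)
qed (simp_all add: plus_matop.rep_eq scaleR_matop.rep_eq)

lemma bounded_linear_Matop: "bounded_linear (Matop :: _ \<Rightarrow> 'n::finite matop)"
proof (rule bounded_linear_intro[where K = "real CARD('n) * real CARD('n)"])
  fix x :: "complex^'n^'n"
  show "norm (Matop x) \<le> norm x * (real CARD('n) * real CARD('n))"
    using onorm_le_norm_matrix[of x] by (simp add: norm_matop.abs_eq algebra_simps)
qed (simp_all add: plus_matop.abs_eq scaleR_matop.abs_eq)

instance matop :: (finite) banach
proof
  fix X :: "nat \<Rightarrow> 'a matop"
  assume "Cauchy X"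
  then have "convergent (\<lambda>n. mat_of (X n))"
    by (intro Cauchy_convergent bounded_linear.Cauchy[OF bounded_linear_mat_of])
  then obtain L where "(\<lambda>n. mat_of (X n)) \<longlonglongrightarrow> L" by (auto simp: convergent_def)
  then have "(\<lambda>n. Matop (mat_of (X n))) \<longlonglongrightarrow> Matop L"
    by (rule bounded_linear.tendsto[OF bounded_linear_Matop])
  then show "convergent X" by (auto simp: convergent_def mat_of_inverse)
qed

definition mexp :: "complex^'n^'n \<Rightarrow> complex^'n^'n" where
  "mexp A = mat_of (exp (Matop A))"

text \<open>Scaling by complex numbers, extending the real \<open>*\<^sub>R\<close>: with complex
  time a one-parameter group becomes an entire curve, to which Liouville-type theorems
  apply.\<close>

definition csc :: "complex \<Rightarrow> complex^'n^'n \<Rightarrow> complex^'n^'n" where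
  "csc t A = (\<chi> i j. t * A $ i $ j)"

lemma csc_add: "csc (s + t) A = csc s A + csc t A"
  and csc_of_real: "csc (complex_of_real r) A = r *\<^sub>R A"
  and csc_csc: "csc s (csc t A) = csc (s * t) A"
  and csc_mult_left: "csc t A ** B = csc t (A ** B)"
  and csc_mult_right: "A ** csc t B = csc t (A ** B)"
  and csc_0 [simp]: "csc 0 A = 0"
  and csc_1 [simp]: "csc 1 A = A"
  by (auto simp: csc_def vec_eq_iff algebra_simps matrix_matrix_mult_def sum_distrib_left
        scaleR_conv_of_real[where 'a = complex])

lemma mexp_0 [simp]: "mexp 0 = mat 1"
  by (simp add: mexp_def zero_matop.abs_eq[symmetric] one_matop.rep_eq)

lemma mexp_add_commuting:
  assumes "A ** B = B ** A"
  shows "mexp (A + B) = mexp A ** mexp B"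
proof -
  have "Matop A * Matop B = Matop B * Matop A"
    by (simp add: times_matop.abs_eq assms)
  then show ?thesis
    using exp_add_commuting[of "Matop A" "Matop B"]
    by (simp add: mexp_def plus_matop.abs_eq[symmetric] times_matop.rep_eq)
qed

lemma mexp_csc_add: "mexp (csc (s + t) A) = mexp (csc s A) ** mexp (csc t A)"
  by (subst csc_add, rule mexp_add_commuting)
     (simp add: csc_mult_left csc_mult_right csc_csc mult.commute)

lemma mexp_scaleR_add: "mexp ((s + t) *\<^sub>R A) = mexp (s *\<^sub>R A) ** mexp (t *\<^sub>R A)"
  using mexp_csc_add[of "of_real s" "of_real t" A] by (simp only: csc_of_real flip: of_real_add)

lemma mexp_minus: "mexp A ** mexp (- A) = mat 1" "mexp (- A) ** mexp A = mat 1"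
  using mexp_scaleR_add[of 1 "-1" A] mexp_scaleR_add[of "-1" 1 A] by auto

lemma invertible_mexp [simp]: "invertible (mexp A)"
  using mexp_minus invertible_def by blast

lemma Matop_power_entry: "mat_of (Matop (csc t A) ^ k) = csc (t ^ k) (mat_of (Matop A ^ k))"
proof (induction k)
  case 0
  show ?case by (simp add: one_matop.rep_eq)
next
  case (Suc k)
  then show ?case
    by (simp add: times_matop.rep_eq csc_mult_left csc_mult_right csc_csc Matop_inverse mult.commute)
qed

text \<open>A power series in \<open>t\<close> converging for every \<open>t\<close>; holomorphy of
  the entries is read off from it.\<close>

lemma mexp_csc_sums:
  "(\<lambda>k. (mat_of (Matop A ^ k) $ i $ j / fact k) * t ^ k) sums (mexp (csc t A) $ i $ j)"
proof -
  have bl: "bounded_linear (\<lambda>M. mat_of M $ i $ j)"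
    using bounded_linear_compose[OF bounded_linear_vec_nth
        bounded_linear_compose[OF bounded_linear_vec_nth bounded_linear_mat_of]] .
  have "(\<lambda>k. Matop (csc t A) ^ k /\<^sub>R fact k) sums exp (Matop (csc t A))"
    by (rule exp_converges)
  from bounded_linear.sums[OF bl this]
  have "(\<lambda>k. (mat_of (Matop (csc t A) ^ k) $ i $ j) /\<^sub>R fact k) sums (mexp (csc t A) $ i $ j)"
    by (simp add: mexp_def scaleR_matop.rep_eq)
  moreover have "(mat_of (Matop (csc t A) ^ k) $ i $ j) /\<^sub>R fact k
      = (mat_of (Matop A ^ k) $ i $ j / fact k) * t ^ k" for k
    unfolding Matop_power_entry by (simp add: csc_def scaleR_conv_of_real field_simps)
  ultimately show ?thesis by simp
qed

lemma holomorphic_mexp_csc: "(\<lambda>t. mexp (csc t A) $ i $ j) holomorphic_on UNIV"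
proof -
  have "(\<lambda>t. mexp (csc t A) $ i $ j) holomorphic_on ball 0 r" for r
    by (rule power_series_holomorphic[of 0 r "\<lambda>k. mat_of (Matop A ^ k) $ i $ j / fact k"])
       (use mexp_csc_sums in simp)
  then have "\<forall>t. (\<lambda>t. mexp (csc t A) $ i $ j) field_differentiable (at t)"
    by (metis holomorphic_on_imp_differentiable_at open_ball centre_in_ball dist_0_norm
        less_add_one mem_ball)
  then show ?thesis by (simp add: holomorphic_on_def field_differentiable_at_within)
qed

lemma continuous_on_mexp_csc [continuous_intros]:
  assumes "continuous_on S f"
  shows "continuous_on S (\<lambda>x. mexp (csc (f x) A))"
proof -
  have "continuous_on UNIV (\<lambda>t. \<chi> i j. mexp (csc t A) $ i $ j)"
    by (intro continuous_on_vec_lambda holomorphic_on_imp_continuous_on holomorphic_mexp_csc)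
  then have "continuous_on UNIV (\<lambda>t. mexp (csc t A))" by simp
  from continuous_on_compose2[OF this assms] show ?thesis by simp
qed

lemma continuous_on_mexp_scaleR [continuous_intros]:
  assumes "continuous_on S f"
  shows "continuous_on S (\<lambda>x. mexp (f x *\<^sub>R A))"
  unfolding csc_of_real[symmetric] by (intro continuous_intros assms)

lemma onorm_csc: "onorm ((*v) (csc t A)) \<le> norm t * onorm ((*v) A)"
proof (rule onorm_bound)
  fix x
  have "csc t A *v x = t *s (A *v x)"
    by (simp add: csc_def matrix_vector_mult_def vec_eq_iff sum_distrib_left algebra_simps)
  moreover have "norm (t *s v) = norm t * norm v" for v :: "complex^'a"
    by (simp add: norm_vec_def norm_mult L2_set_right_distrib)
  ultimately show "norm (csc t A *v x) \<le> norm t * onorm ((*v) A) * norm x"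
    using onorm[of "(*v) A" x] by (simp add: mult_left_mono mult.assoc)
qed (simp add: onorm_pos_le)

text \<open>The exponent is linear in \<open>norm t\<close>, so the entries have order at most one;
  all growth bounds for characters descend from this.\<close>

lemma norm_mexp_csc_entry_le:
  "norm (mexp (csc t A) $ i $ j) \<le> exp (norm t * onorm ((*v) A))"
proof -
  have "norm (mexp (csc t A) $ i $ j) \<le> norm (exp (Matop (csc t A)))"
    using norm_entry_le_onorm by (simp add: mexp_def norm_matop.rep_eq)
  also have "\<dots> \<le> exp (norm (Matop (csc t A)))" by (rule norm_exp)
  also have "\<dots> \<le> exp (norm t * onorm ((*v) A))"
    using onorm_csc by (simp add: norm_matop.abs_eq)
  finally show ?thesis .
qed

section \<open>Powers of elements close to the identity\<close>

lemma norm_power_diff_le: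
  fixes x y :: "'a::real_normed_algebra_1"
  assumes "norm x \<le> m" "norm y \<le> m" "1 \<le> m"
  shows "norm (x ^ N - y ^ N) \<le> real N * m ^ N * norm (x - y)"
proof (induction N)
  case 0
  then show ?case by simp
next
  case (Suc N)
  \<comment> \<open>Telescoping that respects the order of the factors, since \<open>x\<close> and
    \<open>y\<close> need not commute.\<close>
  have "x ^ Suc N - y ^ Suc N = x * (x ^ N - y ^ N) + (x - y) * y ^ N"
    by (simp add: algebra_simps)
  then have "norm (x ^ Suc N - y ^ Suc N) \<le> norm x * norm (x ^ N - y ^ N) + norm (x - y) * norm (y ^ N)"
    by (metis add_mono norm_mult_ineq norm_triangle_le)
  also have "\<dots> \<le> m * (real N * m ^ N * norm (x - y)) + norm (x - y) * m ^ Suc N"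
  proof (intro add_mono mult_mono mult_left_mono Suc)
    have "norm (y ^ N) \<le> m ^ N"
      using norm_power_ineq[of y N] assms(2) power_mono[OF assms(2), of N] by simp
    also have "\<dots> \<le> m ^ Suc N" using assms(3) by simp
    finally show "norm (y ^ N) \<le> m ^ Suc N" .
  qed (use assms in auto)
  finally show ?case by (simp add: algebra_simps)
qed

lemma exp_scaleR_power:
  fixes x :: "'a::{real_normed_algebra_1, banach}"
  shows "exp x ^ n = exp (real n *\<^sub>R x)"
proof (induction n)
  case 0
  then show ?case by simp
next
  case (Suc n)
  have "exp (real (Suc n) *\<^sub>R x) = exp (x + real n *\<^sub>R x)" by (simp add: algebra_simps)
  also have "\<dots> = exp x * exp (real n *\<^sub>R x)" by (rule exp_add_commuting) simp
  finally show ?case by (simp add: Suc)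
qed

text \<open>\<open>1 + Y k\<close> and the exact root \<open>B k\<close> of \<open>exp Z\<close>
  differ by o(1 / \<open>N k\<close>), and the telescoping estimate multiplies this difference by
  \<open>N k\<close> and a bounded factor. The \<open>Y k\<close> need not commute with
  \<open>Z\<close>.\<close>

lemma power_tendsto_exp:
  fixes Y :: "nat \<Rightarrow> 'a::{real_normed_algebra_1, banach}"
  assumes N: "filterlim N at_top sequentially"
    and Z: "(\<lambda>k. real (N k) *\<^sub>R Y k) \<longlonglongrightarrow> Z"
  shows "(\<lambda>k. (1 + Y k) ^ N k) \<longlonglongrightarrow> exp Z"
proof -
  have rN: "filterlim (\<lambda>k. real (N k)) at_top sequentially"
    by (rule filterlim_compose[OF filterlim_real_sequentially N])
  have ev: "\<forall>\<^sub>F k in sequentially. N k > 0"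
    by (rule eventually_compose_filterlim[OF eventually_gt_at_top N])
  define B where "B k = exp (Z /\<^sub>R real (N k))" for k
  have "((\<lambda>t. exp (t *\<^sub>R Z)) has_vector_derivative Z) (at 0)"
    using exp_scaleR_has_vector_derivative_right[of Z 0 UNIV] by simp
  then have d: "((\<lambda>t. norm (exp (t *\<^sub>R Z) - 1 - t *\<^sub>R Z) / norm t) \<longlongrightarrow> 0) (at 0)"
    by (simp add: has_vector_derivative_def has_derivative_at)
  have inv0: "filterlim (\<lambda>k. inverse (real (N k))) (at 0) sequentially"
    by (rule filterlim_compose[OF _ rN])
       (rule filterlim_mono[OF filterlim_inverse_at_right_top at_le[OF subset_UNIV] order_refl])
  have "(\<lambda>k. norm (exp (inverse (real (N k)) *\<^sub>R Z) - 1 - inverse (real (N k)) *\<^sub>R Z)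
      / norm (inverse (real (N k)))) \<longlonglongrightarrow> 0"
    by (rule filterlim_compose[OF d inv0])
  moreover have "\<forall>\<^sub>F k in sequentially. norm (exp (inverse (real (N k)) *\<^sub>R Z) - 1 - inverse (real (N k)) *\<^sub>R Z)
      / norm (inverse (real (N k))) = norm (real (N k) *\<^sub>R (B k - 1) - Z)"
    using ev
  proof eventually_elim
    case (elim k)
    have "real (N k) *\<^sub>R (B k - 1) - Z = real (N k) *\<^sub>R (B k - 1 - inverse (real (N k)) *\<^sub>R Z)"
      using elim by (simp add: algebra_simps)
    then have "norm (real (N k) *\<^sub>R (B k - 1) - Z)
        = real (N k) * norm (B k - 1 - inverse (real (N k)) *\<^sub>R Z)" by simp
    then show ?case by (simp add: B_def divide_inverse mult.commute)
  qed
  ultimately have "(\<lambda>k. norm (real (N k) *\<^sub>R (B k - 1) - Z)) \<longlonglongrightarrow> 0"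
    by (rule Lim_transform_eventually)
  then have "(\<lambda>k. real (N k) *\<^sub>R (B k - 1)) \<longlonglongrightarrow> Z"
    by (metis tendsto_norm_zero_iff LIM_zero_iff)
  from tendsto_diff[OF Z this]
  have diff0: "(\<lambda>k. norm (real (N k) *\<^sub>R (1 + Y k - B k))) \<longlonglongrightarrow> 0"
    by (intro tendsto_norm_zero) (simp add: algebra_simps)
  define c where "c k = max (norm (real (N k) *\<^sub>R Y k)) (norm Z)" for k
  have "(\<lambda>k. exp (c k)) \<longlonglongrightarrow> exp (max (norm Z) (norm Z))"
    unfolding c_def by (intro tendsto_intros Z)
  with diff0 have lim0: "(\<lambda>k. exp (c k) * norm (real (N k) *\<^sub>R (1 + Y k - B k))) \<longlonglongrightarrow> exp (norm Z) * 0"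
    by (intro tendsto_mult) simp_all
  have "\<forall>\<^sub>F k in sequentially. norm ((1 + Y k) ^ N k - exp Z)
      \<le> exp (c k) * norm (real (N k) *\<^sub>R (1 + Y k - B k))"
    using ev
  proof eventually_elim
    case (elim k)
    \<comment> \<open>A common bound for both bases whose \<open>N k\<close>-th power is
      \<open>exp (c k)\<close>; as \<open>c k\<close> converges, the telescoping factor stays
      bounded.\<close>
    define m where "m = exp (c k / N k)"
    have "norm (Y k) \<le> c k / N k"
      using elim by (simp add: c_def field_simps)
    then have 1: "norm (1 + Y k) \<le> m"
      unfolding m_def using norm_triangle_ineq[of 1 "Y k"] exp_ge_add_one_self[of "c k / N k"]
      by (simp only: norm_one)
    have "norm (Z /\<^sub>R real (N k)) \<le> c k / N k"
      using elim by (simp add: c_def field_simps)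
    then have 2: "norm (B k) \<le> m"
      unfolding B_def m_def by (meson exp_le_cancel_iff norm_exp order_trans)
    have 3: "1 \<le> m" by (simp add: m_def c_def le_max_iff_disj divide_nonneg_nonneg)
    have "B k ^ N k = exp Z"
      using elim unfolding B_def by (metis divideR_right exp_scaleR_power not_gr_zero of_nat_0_eq_iff)
    moreover have "m ^ N k = exp (c k)"
      using elim by (simp add: m_def flip: exp_of_nat_mult)
    ultimately show ?case
      using norm_power_diff_le[OF 1 2 3, of "N k"] by (simp add: mult.commute mult.left_commute)
  qed
  then have "(\<lambda>k. (1 + Y k) ^ N k - exp Z) \<longlonglongrightarrow> 0"
    by (rule Lim_null_comparison) (use lim0 in simp)
  then show ?thesis by (simp add: LIM_zero_iff)
qed

section \<open>Closed linear groups are generated by one-parameter subgroups\<close>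

text \<open>Closedness is relative to the invertible matrices, since algebraic subgroups of the
  general linear group need not be closed among all matrices.\<close>

definition closed_linear_group :: "(complex^'n^'n) set \<Rightarrow> bool" where
  "closed_linear_group S \<longleftrightarrow> mat 1 \<in> S \<and> (\<forall>A\<in>S. \<forall>B\<in>S. A ** B \<in> S) \<and>
     (\<forall>A\<in>S. \<exists>B\<in>S. A ** B = mat 1 \<and> B ** A = mat 1) \<and>
     closedin (top_of_set {A. invertible A}) S"

text \<open>The Lie algebra as a bare set, with real times only. Its span is taken where linear
  structure is wanted, and complex times are recovered for algebraic groups by analytic
  continuation.\<close>

definition lie :: "(complex^'n^'n) set \<Rightarrow> (complex^'n^'n) set" where
  "lie S = {A. \<forall>t::real. mexp (t *\<^sub>R A) \<in> S}"

definition exp_word :: "(complex^'n^'n) list \<Rightarrow> complex^'n^'n" where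
  "exp_word As = foldr (\<lambda>A M. mexp A ** M) As (mat 1)"

lemma exp_word_Nil [simp]: "exp_word [] = mat 1"
  and exp_word_Cons [simp]: "exp_word (A # As) = mexp A ** exp_word As"
  by (simp_all add: exp_word_def)

lemma exp_word_append: "exp_word (As @ Bs) = exp_word As ** exp_word Bs"
  by (induction As) (simp_all add: matrix_mul_assoc)

lemma exp_word_eq_prod_list: "exp_word As = mat_of (prod_list (map (\<lambda>A. exp (Matop A)) As))"
  by (induction As) (simp_all add: one_matop.rep_eq times_matop.rep_eq mexp_def)

lemma exp_word_minus: "exp_word As ** exp_word (rev (map uminus As)) = mat 1"
proof (induction As)
  case (Cons A As)
  have "exp_word (A # As) ** exp_word (rev (map uminus (A # As)))
      = mexp A ** (exp_word As ** exp_word (rev (map uminus As))) ** mexp (- A)"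
    by (simp add: exp_word_append matrix_mul_assoc)
  then show ?case by (simp add: Cons mexp_minus)
qed simp

lemma lie_scaleR: "A \<in> lie S \<Longrightarrow> t *\<^sub>R A \<in> lie S"
  by (simp add: lie_def)

lemma lie_minus: "A \<in> lie S \<Longrightarrow> - A \<in> lie S"
  using lie_scaleR[of A S "-1"] by simp

lemma mexp_in_group: "A \<in> lie S \<Longrightarrow> mexp A \<in> S"
  unfolding lie_def by (metis (mono_tags, lifting) mem_Collect_eq scaleR_one)

lemma exp_word_in_group:
  assumes "closed_linear_group S" "set As \<subseteq> lie S"
  shows "exp_word As \<in> S"
  using assms(2)
  by (induction As) (use assms(1) in \<open>auto simp: closed_linear_group_def mexp_in_group\<close>)

lemma continuous_on_matrix_mult [continuous_intros]:
  fixes f g :: "_ \<Rightarrow> complex^'n^'n"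
  assumes "continuous_on S f" "continuous_on S g"
  shows "continuous_on S (\<lambda>x. f x ** g x)"
  unfolding matrix_matrix_mult_def by (intro continuous_intros assms)

lemma closed_linear_group_inverse:
  assumes "closed_linear_group S" "A \<in> S" "A ** B = mat 1"
  shows "B \<in> S"
  using assms unfolding closed_linear_group_def
  by (metis matrix_mul_assoc matrix_mul_lid matrix_mul_rid)

lemma closed_linear_group_power_limit:
  assumes S: "closed_linear_group S"
    and Y: "\<And>k. mat 1 + Y k \<in> S"
    and N: "filterlim N at_top sequentially"
    and Z: "(\<lambda>k. real (N k) *\<^sub>R Y k) \<longlonglongrightarrow> Z"
  shows "mexp Z \<in> S"
proof -
  have "(\<lambda>k. real (N k) *\<^sub>R Matop (Y k)) \<longlonglongrightarrow> Matop Z"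
    using bounded_linear.tendsto[OF bounded_linear_Matop Z] by (simp add: scaleR_matop.abs_eq)
  from bounded_linear.tendsto[OF bounded_linear_mat_of power_tendsto_exp[OF N this]]
  have lim: "(\<lambda>k. mat_of ((1 + Matop (Y k)) ^ N k)) \<longlonglongrightarrow> mexp Z"
    by (simp add: mexp_def)
  have inS: "mat_of ((1 + Matop (Y k)) ^ m) \<in> S" for k m
  proof (induction m)
    case 0
    show ?case using S by (simp add: one_matop.rep_eq closed_linear_group_def)
  next
    case (Suc m)
    have "mat_of (1 + Matop (Y k)) = mat 1 + Y k"
      by (simp add: plus_matop.rep_eq one_matop.rep_eq Matop_inverse)
    then show ?case
      using S Suc Y by (simp add: times_matop.rep_eq closed_linear_group_def)
  qed
  \<comment> \<open>Relative closedness needs an invertible limit, and an exponential is always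
    invertible.\<close>
  obtain C where C: "closed C" "S = {A. invertible A} \<inter> C"
    using S by (auto simp: closed_linear_group_def closedin_closed)
  have "mexp Z \<in> C"
    using C inS by (intro closed_sequentially[OF C(1) _ lim]) blast
  then show ?thesis using C by simp
qed

text \<open>Powers of \<open>mat 1 + Y k\<close> with exponent about \<open>t / norm (Y k)\<close>
  approach time \<open>t\<close> on the one-parameter group of the limit direction: rounding the
  exponent to an integer costs at most \<open>norm (Y k)\<close>, which tends to 0. Negative times
  follow by inversion.\<close>

lemma lie_limit_direction:
  assumes S: "closed_linear_group S"
    and Y: "\<And>k. mat 1 + Y k \<in> S" "\<And>k. Y k \<noteq> 0"
    and Y0: "Y \<longlonglongrightarrow> 0"
    and Z: "(\<lambda>k. Y k /\<^sub>R norm (Y k)) \<longlonglongrightarrow> Z"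
  shows "Z \<in> lie S"
proof -
  have pos: "mexp (t *\<^sub>R Z) \<in> S" if t: "t > 0" for t :: real
  proof -
    define N where "N k = nat \<lfloor>t / norm (Y k)\<rfloor>" for k
    have "filterlim (\<lambda>k. norm (Y k)) (at_right 0) sequentially"
      using Y0 Y(2) by (auto simp: filterlim_at tendsto_norm_zero)
    then have inv: "filterlim (\<lambda>k. inverse (norm (Y k))) at_top sequentially"
      by (rule filterlim_compose[OF filterlim_inverse_at_top_right])
    then have "filterlim (\<lambda>k. t / norm (Y k)) at_top sequentially"
      using filterlim_tendsto_pos_mult_at_top[OF tendsto_const t inv] by (simp add: field_simps)
    then have N: "filterlim N at_top sequentially"
      unfolding N_def
      by (intro filterlim_compose[OF filterlim_nat_sequentially]
            filterlim_compose[OF filterlim_floor_sequentially])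
    have bound: "norm (real (N k) * norm (Y k) - t) \<le> norm (Y k)" for k
    proof -
      have n0: "norm (Y k) > 0" using Y(2) by simp
      have "real (N k) = of_int \<lfloor>t / norm (Y k)\<rfloor>" using t n0 by (simp add: N_def)
      then have "real (N k) \<le> t / norm (Y k)" "t / norm (Y k) < real (N k) + 1" by linarith+
      then have "real (N k) * norm (Y k) \<le> t" "t < real (N k) * norm (Y k) + norm (Y k)"
        using n0 by (auto simp: field_simps)
      then show ?thesis by (simp add: abs_if)
    qed
    have "(\<lambda>k. real (N k) * norm (Y k) - t) \<longlonglongrightarrow> 0"
      by (rule Lim_null_comparison[OF always_eventually[OF allI[OF bound]] tendsto_norm_zero[OF Y0]])
    then have "(\<lambda>k. real (N k) * norm (Y k)) \<longlonglongrightarrow> t" by (simp add: LIM_zero_iff)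
    from tendsto_scaleR[OF this Z]
    have "(\<lambda>k. real (N k) *\<^sub>R Y k) \<longlonglongrightarrow> t *\<^sub>R Z"
      using Y(2) by (simp add: mult.assoc)
    from closed_linear_group_power_limit[OF S Y(1) N this] show ?thesis .
  qed
  have "mexp (t *\<^sub>R Z) \<in> S" for t :: real
  proof (cases t "0::real" rule: linorder_cases)
    case less
    then show ?thesis
      using closed_linear_group_inverse[OF S pos[of "-t"], of "mexp (t *\<^sub>R Z)"]
        mexp_minus(2)[of "t *\<^sub>R Z"] by simp
  next
    case equal
    then show ?thesis using S by (simp add: closed_linear_group_def)
  qed (use pos in simp)
  then show ?thesis by (simp add: lie_def)
qed

text \<open>Canonical coordinates of the second kind: all factors equal 1 at the origin, so the
  product rule leaves the plain sum of the tangent vectors.\<close>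

lemma has_derivative_prod_list_exp:
  fixes c :: "'b \<Rightarrow> 'a::real_normed_vector \<Rightarrow> real" and M :: "'b \<Rightarrow> 'm::{real_normed_algebra_1, banach}"
  assumes c: "\<And>b. b \<in> set bs \<Longrightarrow> bounded_linear (c b)"
  shows "((\<lambda>X. \<Prod>b\<leftarrow>bs. exp (c b X *\<^sub>R M b)) has_derivative (\<lambda>X. \<Sum>b\<leftarrow>bs. c b X *\<^sub>R M b)) (at 0)"
  using c
proof (induction bs)
  case (Cons b bs)
  interpret bounded_linear "c b" using Cons.prems by simp
  have "((\<lambda>t. exp (t *\<^sub>R M b)) has_derivative (\<lambda>t. t *\<^sub>R M b)) (at (c b 0))"
    using exp_scaleR_has_vector_derivative_right[of "M b" 0 UNIV]
    by (simp add: has_vector_derivative_def zero)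
  from has_derivative_compose[OF bounded_linear_imp_has_derivative[OF bounded_linear_axioms] this]
  have 1: "((\<lambda>X. exp (c b X *\<^sub>R M b)) has_derivative (\<lambda>X. c b X *\<^sub>R M b)) (at 0)" .
  have 0: "(\<Prod>b\<leftarrow>bs. exp (c b 0 *\<^sub>R M b)) = 1"
    using Cons.prems by (induction bs) (auto simp: linear_simps)
  from has_derivative_mult[OF 1 Cons.IH] Cons.prems 0 show ?case
    by (simp add: zero add.commute)
qed simp

lemma continuous_on_prod_list_exp:
  fixes c :: "'b \<Rightarrow> 'a::real_normed_vector \<Rightarrow> real" and M :: "'b \<Rightarrow> 'm::{real_normed_algebra_1, banach}"
  assumes c: "\<And>b. b \<in> set bs \<Longrightarrow> bounded_linear (c b)"
  shows "continuous_on S (\<lambda>X. \<Prod>b\<leftarrow>bs. exp (c b X *\<^sub>R M b))"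
  using c
proof (induction bs)
  case (Cons b bs)
  have "continuous_on UNIV (\<lambda>t::real. exp (t *\<^sub>R M b))"
    by (intro continuous_at_imp_continuous_on ballI has_vector_derivative_continuous)
       (rule exp_scaleR_has_vector_derivative_right)
  moreover have "continuous_on S (c b)" using Cons.prems by (simp add: linear_continuous_on)
  ultimately have "continuous_on S (\<lambda>X. exp (c b X *\<^sub>R M b))"
    by (rule continuous_on_compose2) simp
  with Cons show ?case by (simp add: continuous_on_mult)
qed simp

text \<open>Von Neumann's argument: near \<open>1\<close> every matrix is \<open>exp (c\<^sub>1 b\<^sub>1) \<cdots> exp (c\<^sub>d b\<^sub>d) (1 + Y)\<close> with
  \<open>b\<^sub>1, \<dots>, b\<^sub>d\<close> a basis of the span of \<open>lie S\<close> and \<open>Y\<close> in a complement; elements of \<open>S\<close> close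
  to \<open>1\<close> with \<open>Y \<noteq> 0\<close> would produce a limit direction of \<open>S\<close> in the complement.\<close>

lemma exp_word_near_one:
  fixes S :: "(complex^'n^'n) set"
  assumes S: "closed_linear_group S"
  shows "\<exists>d>0. \<forall>g\<in>S. dist g (mat 1) < d \<longrightarrow> (\<exists>As. set As \<subseteq> lie S \<and> g = exp_word As)"
proof -
  obtain B where B: "B \<subseteq> lie S" "independent B" "lie S \<subseteq> span B"
    by (rule maximal_independent_subset)
  obtain B' where B': "B \<subseteq> B'" "independent B'" "UNIV \<subseteq> span B'"
    by (rule maximal_independent_subset_extend[OF subset_UNIV B(2)])
  have sp: "X \<in> span B'" for X using B'(3) by blast
  have finB': "finite B'" using B'(2) independent_imp_finite by blast
  define c where "c b X = representation B' X b" for b X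
  have lin: "linear (c b)" for b
    using B'(2) sp by (intro linearI) (simp_all add: c_def representation_add representation_scale)
  then have bl: "bounded_linear (c b)" for b by (simp add: linear_conv_bounded_linear)
  have sumc: "(\<Sum>b\<in>B'. c b X *\<^sub>R b) = X" for X
    using sum_representation_eq[OF B'(2) sp finB' order_refl, of X] by (simp add: c_def)
  have c_basis: "c b b' = (if b' = b then 1 else 0)" if "b' \<in> B'" for b b'
    using representation_basis[OF B'(2) that] by (simp add: c_def)
  obtain bs where bs: "set bs = B" "distinct bs"
    using finite_distinct_list[OF finite_subset[OF B'(1) finB']] by auto
  define R where "R X = (\<Sum>b\<in>B' - B. c b X *\<^sub>R b)" for X
  have linR: "bounded_linear R"
    unfolding R_def by (intro bounded_linear_sum bounded_linear_scaleR_const bl)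
  have cR: "c b (R X) = 0" if "b \<in> B" for b X
    unfolding R_def linear_sum[OF lin] using that c_basis
    by (intro sum.neutral) (auto simp: linear_scale[OF lin])
  define P where "P X = (\<Prod>b\<leftarrow>bs. exp (c b X *\<^sub>R Matop b))" for X
  define F where "F X = mat_of (P X * (1 + Matop (R X)))" for X
  have P_word: "mat_of (P X) = exp_word (map (\<lambda>b. c b X *\<^sub>R b) bs)" for X
    unfolding exp_word_eq_prod_list P_def by (simp add: o_def scaleR_matop.abs_eq)
  have lie_word: "set (map (\<lambda>b. c b X *\<^sub>R b) bs) \<subseteq> lie S" for X
    using B(1) bs(1) lie_scaleR by fastforce
  have P0: "P 0 = 1"
    unfolding P_def by (induction bs) (auto simp: linear_0[OF lin])
  have dP: "(P has_derivative (\<lambda>X. \<Sum>b\<leftarrow>bs. c b X *\<^sub>R Matop b)) (at 0)"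
    unfolding P_def by (intro has_derivative_prod_list_exp bl)
  have blMR: "bounded_linear (\<lambda>X. Matop (R X))"
    using bounded_linear_compose[OF bounded_linear_Matop linR] .
  then have dR: "((\<lambda>X. 1 + Matop (R X)) has_derivative (\<lambda>X. Matop (R X))) (at 0)"
    using has_derivative_add[OF has_derivative_const bounded_linear_imp_has_derivative] by fastforce
  have R0: "R 0 = 0" using linR by (simp add: linear_simps)
  have "((\<lambda>X. P X * (1 + Matop (R X))) has_derivative
      (\<lambda>X. Matop (R X) + (\<Sum>b\<leftarrow>bs. c b X *\<^sub>R Matop b))) (at 0)"
    using has_derivative_mult[OF dP dR] by (simp add: P0 R0 zero_matop.abs_eq[symmetric])
  from bounded_linear.has_derivative[OF bounded_linear_mat_of this]
  have dF: "(F has_derivative (\<lambda>X. mat_of (Matop (R X) + (\<Sum>b\<leftarrow>bs. c b X *\<^sub>R Matop b)))) (at 0)"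
    by (simp add: F_def[abs_def])
  have "mat_of (Matop (R X) + (\<Sum>b\<leftarrow>bs. c b X *\<^sub>R Matop b)) = X" for X
  proof -
    have "(\<Sum>b\<leftarrow>bs. c b X *\<^sub>R Matop b) = (\<Sum>b\<in>B. c b X *\<^sub>R Matop b)"
      using bs by (simp add: sum_list_distinct_conv_sum_set)
    also have "\<dots> = Matop (\<Sum>b\<in>B. c b X *\<^sub>R b)"
      by (simp add: linear_sum[OF bounded_linear.linear[OF bounded_linear_Matop]] scaleR_matop.abs_eq)
    finally have "mat_of (Matop (R X) + (\<Sum>b\<leftarrow>bs. c b X *\<^sub>R Matop b)) = R X + (\<Sum>b\<in>B. c b X *\<^sub>R b)"
      by (simp add: plus_matop.rep_eq Matop_inverse)
    also have "\<dots> = X"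
      unfolding R_def using sum.subset_diff[OF B'(1) finB', of "\<lambda>b. c b X *\<^sub>R b"] sumc by simp
    finally show ?thesis .
  qed
  with dF have dF: "(F has_derivative id) (at 0)" by (simp add: id_def)
  have contF: "continuous_on UNIV F"
    unfolding F_def P_def
    by (intro bounded_linear.continuous_on[OF bounded_linear_mat_of] continuous_intros
        continuous_on_prod_list_exp bl linear_continuous_on[OF blMR])
  have F0: "F 0 = mat 1"
    by (simp add: F_def P0 R0 zero_matop.abs_eq[symmetric] one_matop.rep_eq)
  \<comment> \<open>The derivative of \<open>F\<close> is known at the origin only; together with
    continuity this is enough for Sussmann's open mapping theorem, whereas the inverse function
    theorem would ask for more.\<close>
  have nbhd: "mat 1 \<in> interior (F ` ball 0 e)" if "e > 0" for e
    using sussmann_open_mapping[OF open_UNIV contF UNIV_I dF bounded_linear_ident, of "ball 0 e"] that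
    by (simp add: F0 o_def id_def)
  show ?thesis
  proof (rule ccontr)
    assume neg: "\<not> ?thesis"
    have "\<exists>X. X \<in> ball 0 (inverse (real (Suc m))) \<and> F X \<in> S \<and> R X \<noteq> 0" for m
    proof -
      obtain d where d: "d > 0" "ball (mat 1) d \<subseteq> F ` ball 0 (inverse (real (Suc m)))"
        using nbhd[of "inverse (real (Suc m))"] by (auto simp: mem_interior)
      with neg obtain g where g: "g \<in> S" "dist g (mat 1) < d"
        "\<not> (\<exists>As. set As \<subseteq> lie S \<and> g = exp_word As)" by blast
      from g(2) have "g \<in> ball (mat 1) d" by (simp add: dist_commute)
      with d(2) have "g \<in> F ` ball 0 (inverse (real (Suc m)))" by (rule subsetD)
      then obtain X where X: "X \<in> ball 0 (inverse (real (Suc m)))" "g = F X" by (rule imageE)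
      have "R X \<noteq> 0"
      proof
        assume "R X = 0"
        then have "g = exp_word (map (\<lambda>b. c b X *\<^sub>R b) bs)"
          using X(2) P_word by (simp add: F_def zero_matop.abs_eq[symmetric])
        with g(3) lie_word show False by blast
      qed
      with X g show ?thesis by blast
    qed
    then obtain X where X: "\<And>m. X m \<in> ball 0 (inverse (real (Suc m)))" "\<And>m. F (X m) \<in> S"
      "\<And>m. R (X m) \<noteq> 0" by metis
    have "X \<longlonglongrightarrow> 0"
    proof (rule Lim_null_comparison)
      show "\<forall>\<^sub>F m in sequentially. norm (X m) \<le> inverse (real (Suc m))"
        using X(1) by (auto simp: less_imp_le)
    qed (rule LIMSEQ_inverse_real_of_nat)
    then have RX0: "(\<lambda>m. R (X m)) \<longlonglongrightarrow> 0"
      using bounded_linear.tendsto[OF linR] R0 by fastforce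
    \<comment> \<open>The word factor of \<open>F (X m)\<close> lies in \<open>S\<close> and can be
      divided off, leaving only the complementary part.\<close>
    have inS: "mat 1 + R (X m) \<in> S" for m
    proof -
      let ?w = "map (\<lambda>b. c b (X m) *\<^sub>R b) bs"
      have "F (X m) = exp_word ?w ** (mat 1 + R (X m))"
        by (simp add: F_def times_matop.rep_eq plus_matop.rep_eq one_matop.rep_eq Matop_inverse P_word)
      moreover obtain V where V: "V \<in> S" "V ** exp_word ?w = mat 1"
        using S exp_word_in_group[OF S lie_word] unfolding closed_linear_group_def by blast
      ultimately have "mat 1 + R (X m) = V ** F (X m)"
        by (simp add: matrix_mul_assoc)
      then show ?thesis using S V X(2) by (simp add: closed_linear_group_def)
    qed
    define u where "u m = R (X m) /\<^sub>R norm (R (X m))" for m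
    have "u m \<in> sphere 0 1" for m using X(3) by (simp add: u_def)
    then obtain Z r where Z: "Z \<in> sphere 0 1" "strict_mono r" "(u \<circ> r) \<longlonglongrightarrow> Z"
      using compact_sphere[of 0 1] unfolding compact_def by metis
    have "Z \<in> lie S"
    proof (rule lie_limit_direction[OF S, of "\<lambda>m. R (X (r m))"])
      show "(\<lambda>m. R (X (r m))) \<longlonglongrightarrow> 0"
        using LIMSEQ_subseq_LIMSEQ[OF RX0 Z(2)] by (simp add: o_def)
    qed (use inS X(3) Z(3) in \<open>auto simp: u_def o_def\<close>)
    \<comment> \<open>\<open>Z\<close> lies in the span of \<open>B\<close>, and as a limit of
      vectors in the range of \<open>R\<close> it has no coordinates in \<open>B\<close>. So it is
      0, although it is a unit vector.\<close>
    then have "Z \<in> span B" using B(3) by blast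
    then have out: "c b Z = 0" if "b \<notin> B" for b
      using that representation_extend[OF B'(2) _ B'(1), of Z] representation_ne_zero
      by (metis c_def)
    have "c b Z = 0" if b: "b \<in> B" for b
    proof -
      have "(\<lambda>m. c b ((u \<circ> r) m)) \<longlonglongrightarrow> c b Z"
        by (rule bounded_linear.tendsto[OF bl Z(3)])
      moreover have "c b ((u \<circ> r) m) = 0" for m
        by (simp add: u_def linear_scale[OF lin] cR[OF b])
      ultimately show ?thesis by (simp add: LIMSEQ_const_iff)
    qed
    with out have "c b Z = 0" for b by blast
    with sumc[of Z] have "Z = 0" by simp
    with Z(1) show False by simp
  qed
qed

text \<open>Differing by a word on the right is an equivalence relation on \<open>S\<close>. Its
  classes are open because a neighbourhood of the identity consists of words and can be translated,
  so a connected \<open>S\<close> is a single class.\<close>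

proposition connected_group_eq_exp_words:
  fixes S :: "(complex^'n^'n) set"
  assumes S: "closed_linear_group S" and con: "connected S" and g: "g \<in> S"
  shows "\<exists>As. set As \<subseteq> lie S \<and> g = exp_word As"
proof -
  define rel where "rel x y \<longleftrightarrow> (\<exists>As. set As \<subseteq> lie S \<and> y = x ** exp_word As)"
    for x y :: "complex^'n^'n"
  have one: "mat 1 \<in> S" using S by (simp add: closed_linear_group_def)
  obtain d where d: "d > 0"
    "\<And>g. g \<in> S \<Longrightarrow> dist g (mat 1) < d \<Longrightarrow> \<exists>As. set As \<subseteq> lie S \<and> g = exp_word As"
    using exp_word_near_one[OF S] by blast
  have "rel (mat 1) g"
  proof (rule connected_equivalence_relation[OF con one g])
    fix x y assume "rel x y" "x \<in> S" "y \<in> S"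
    then obtain As where As: "set As \<subseteq> lie S" "y = x ** exp_word As" by (auto simp: rel_def)
    have "x = y ** exp_word (rev (map uminus As))"
      by (simp add: As(2) exp_word_minus flip: matrix_mul_assoc)
    moreover have "set (rev (map uminus As)) \<subseteq> lie S" using As(1) lie_minus by auto
    ultimately show "rel y x" unfolding rel_def by blast
  next
    fix x y z assume "rel x y" "rel y z"
    then obtain As Bs where "set As \<subseteq> lie S" "y = x ** exp_word As"
      "set Bs \<subseteq> lie S" "z = y ** exp_word Bs"
      by (auto simp: rel_def)
    then show "rel x z"
      unfolding rel_def by (intro exI[of _ "As @ Bs"]) (auto simp: exp_word_append matrix_mul_assoc)
  next
    fix a assume a: "a \<in> S"
    obtain b where b: "b \<in> S" "a ** b = mat 1" "b ** a = mat 1"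
      using S a by (auto simp: closed_linear_group_def)
    define T where "T = S \<inter> (\<lambda>x. b ** x) -` ball (mat 1) d"
    have "openin (top_of_set S) T"
      unfolding T_def by (intro continuous_openin_preimage_gen continuous_intros) simp
    moreover have "a \<in> T" using a b d(1) by (simp add: T_def)
    moreover have "rel a x" if "x \<in> T" for x
    proof -
      have "b ** x \<in> S" "dist (b ** x) (mat 1) < d"
        using that S b by (auto simp: T_def closed_linear_group_def dist_commute)
      from d(2)[OF this] obtain As where "set As \<subseteq> lie S" "b ** x = exp_word As" by blast
      moreover from this(2) have "x = a ** exp_word As"
        by (metis b(2) matrix_mul_assoc matrix_mul_lid)
      ultimately show ?thesis unfolding rel_def by blast
    qed
    ultimately show "\<exists>T. openin (top_of_set S) T \<and> a \<in> T \<and> (\<forall>x\<in>T. rel a x)" by blast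
  qed
  then show ?thesis by (simp add: rel_def)
qed

section \<open>Regular functions on closed subgroups are globally polynomial\<close>

lemma poly_funs_uminus: "p \<in> poly_funs C \<Longrightarrow> (\<lambda>x. - p x) \<in> poly_funs C"
  using poly_funs.mult[OF poly_funs.const[of "-1"]] by simp

lemma poly_funs_diff: "p \<in> poly_funs C \<Longrightarrow> q \<in> poly_funs C \<Longrightarrow> (\<lambda>x. p x - q x) \<in> poly_funs C"
  using poly_funs.add[of p C "\<lambda>x. - q x"] poly_funs_uminus[of q C] by simp

lemma poly_funs_sum:
  "finite I \<Longrightarrow> (\<And>i. i \<in> I \<Longrightarrow> p i \<in> poly_funs C) \<Longrightarrow> (\<lambda>x. \<Sum>i\<in>I. p i x) \<in> poly_funs C"
  by (induction I rule: finite_induct) (auto intro: poly_funs.intros)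

lemma poly_funs_prod:
  "finite I \<Longrightarrow> (\<And>i. i \<in> I \<Longrightarrow> p i \<in> poly_funs C) \<Longrightarrow> (\<lambda>x. \<Prod>i\<in>I. p i x) \<in> poly_funs C"
  by (induction I rule: finite_induct) (auto intro: poly_funs.intros)

lemma poly_funs_mono: "p \<in> poly_funs C \<Longrightarrow> C \<subseteq> D \<Longrightarrow> p \<in> poly_funs D"
  by (induction p rule: poly_funs.induct) (auto intro: poly_funs.intros simp: subset_iff)

text \<open>Products of polynomials make the generating sets stable under intersection, so they form
  a base and not merely a subbase.\<close>

lemma openin_zariskiE:
  assumes "openin (zariski_topology C X) U" "x \<in> U"
  obtains p where "p \<in> poly_funs C" "x \<in> X" "p x \<noteq> 0" "{y \<in> X. p y \<noteq> 0} \<subseteq> U"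
proof -
  have "\<exists>p\<in>poly_funs C. x \<in> X \<and> p x \<noteq> 0 \<and> {y \<in> X. p y \<noteq> 0} \<subseteq> U"
    using assms unfolding zariski_topology_def openin_topology_generated_by_iff
  proof (induction arbitrary: x rule: generate_topology_on.induct)
    case Empty
    then show ?case by simp
  next
    case (Int a b)
    obtain p where p: "p \<in> poly_funs C" "x \<in> X" "p x \<noteq> 0" "{y \<in> X. p y \<noteq> 0} \<subseteq> a"
      using Int.IH(1)[of x] Int.prems by blast
    obtain q where q: "q \<in> poly_funs C" "q x \<noteq> 0" "{y \<in> X. q y \<noteq> 0} \<subseteq> b"
      using Int.IH(2)[of x] Int.prems by blast
    show ?case
      by (rule bexI[OF _ poly_funs.mult[OF p(1) q(1)]]) (use p q in auto)
  next
    case (UN K)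
    then obtain k where k: "k \<in> K" "x \<in> k" by blast
    with UN.IH[OF this] show ?case by blast
  next
    case (Basis s)
    then show ?case by blast
  qed
  then show thesis using that by blast
qed

lemma openin_zariski_basic:
  "p \<in> poly_funs C \<Longrightarrow> openin (zariski_topology C X) {y \<in> X. p y \<noteq> 0}"
  unfolding zariski_topology_def by (rule topology_generated_by_Basis) blast

lemma topspace_zariski [simp]: "topspace (zariski_topology C X) = X"
proof
  show "topspace (zariski_topology C X) \<subseteq> X"
  proof
    fix x assume "x \<in> topspace (zariski_topology C X)"
    then show "x \<in> X" by (rule openin_zariskiE[OF openin_topspace])
  qed
  have "openin (zariski_topology C X) {y \<in> X. 1 \<noteq> (0::complex)}"
    by (rule openin_zariski_basic[OF poly_funs.const])
  from openin_subset[OF this] show "X \<subseteq> topspace (zariski_topology C X)" by auto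
qed

text \<open>A point outside \<open>Z\<close> has a principal neighbourhood missing \<open>Z\<close>,
  and the polynomial defining it separates the two.\<close>

lemma closedin_zariski_iff_zeros:
  assumes "closedin (zariski_topology C X) Z"
  shows "Z = {x \<in> X. \<forall>p\<in>poly_funs C. (\<forall>z\<in>Z. p z = 0) \<longrightarrow> p x = 0}"
proof
  show "Z \<subseteq> {x \<in> X. \<forall>p\<in>poly_funs C. (\<forall>z\<in>Z. p z = 0) \<longrightarrow> p x = 0}"
    using closedin_subset[OF assms] by auto
  show "{x \<in> X. \<forall>p\<in>poly_funs C. (\<forall>z\<in>Z. p z = 0) \<longrightarrow> p x = 0} \<subseteq> Z"
  proof (rule ccontr)
    assume "\<not> ?thesis"
    then obtain x where x: "x \<in> X" "x \<notin> Z" "\<And>p. p \<in> poly_funs C \<Longrightarrow> \<forall>z\<in>Z. p z = 0 \<Longrightarrow> p x = 0" by blast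
    have "openin (zariski_topology C X) (X - Z)" "x \<in> X - Z"
      using assms x by (auto simp: closedin_def)
    then show False
      by (rule openin_zariskiE) (use x closedin_subset[OF assms] in fastforce)
  qed
qed

section \<open>Ideals of functions and the weak Nullstellensatz\<close>

definition function_ideal :: "('a \<Rightarrow> complex) set \<Rightarrow> ('a \<Rightarrow> complex) set \<Rightarrow> bool" where
  "function_ideal R J \<longleftrightarrow> J \<subseteq> R \<and> (\<lambda>_. 0) \<in> J \<and> (\<forall>a\<in>J. \<forall>b\<in>J. (\<lambda>x. a x + b x) \<in> J) \<and>
     (\<forall>a\<in>R. \<forall>b\<in>J. (\<lambda>x. a x * b x) \<in> J)"

lemma function_idealD:
  assumes "function_ideal R J"
  shows "a \<in> J \<Longrightarrow> a \<in> R" "a \<in> J \<Longrightarrow> b \<in> J \<Longrightarrow> (\<lambda>x. a x + b x) \<in> J"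
    "a \<in> R \<Longrightarrow> b \<in> J \<Longrightarrow> (\<lambda>x. a x * b x) \<in> J" "(\<lambda>_. 0) \<in> J"
  using assms by (auto simp: function_ideal_def)

lemma function_ideal_scale:
  assumes "function_ideal (poly_funs D) J" "b \<in> J"
  shows "(\<lambda>x. c * b x) \<in> J"
  using function_idealD(3)[OF assms(1) poly_funs.const assms(2)] .

lemma function_ideal_diff:
  assumes "function_ideal (poly_funs D) J" "a \<in> J" "b \<in> J"
  shows "(\<lambda>x. a x - b x) \<in> J"
  using function_idealD(2)[OF assms(1,2) function_ideal_scale[OF assms(1,3), of "-1"]] by simp

lemma function_ideal_sum:
  assumes "function_ideal R J" "finite I" "\<And>i. i \<in> I \<Longrightarrow> p i \<in> J"
  shows "(\<lambda>x. \<Sum>i\<in>I. p i x) \<in> J"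
  using assms(2,3) by (induction I rule: finite_induct) (auto intro: function_idealD[OF assms(1)])

lemma exists_maximal_function_ideal:
  assumes J: "function_ideal R J" and one: "(\<lambda>_. 1) \<notin> J"
  shows "\<exists>m. function_ideal R m \<and> J \<subseteq> m \<and> (\<lambda>_. 1) \<notin> m \<and>
    (\<forall>K. function_ideal R K \<longrightarrow> m \<subseteq> K \<longrightarrow> (\<lambda>_. 1) \<notin> K \<longrightarrow> K = m)"
proof -
  define A where "A = {K. function_ideal R K \<and> J \<subseteq> K \<and> (\<lambda>_. 1) \<notin> K}"
  have "\<exists>m\<in>A. \<forall>X\<in>A. m \<subseteq> X \<longrightarrow> X = m"
  proof (rule subset_Zorn_nonempty)
    show "A \<noteq> {}" using J one by (auto simp: A_def)
    fix \<C> assume C: "\<C> \<noteq> {}" "subset.chain A \<C>"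
    then have sub: "\<And>K. K \<in> \<C> \<Longrightarrow> function_ideal R K \<and> J \<subseteq> K \<and> (\<lambda>_. 1) \<notin> K"
      by (auto simp: subset.chain_def A_def)
    have "function_ideal R (\<Union>\<C>)"
      unfolding function_ideal_def
    proof (intro conjI ballI)
      show "\<Union>\<C> \<subseteq> R" using sub function_idealD(1) by blast
      show "(\<lambda>_. 0) \<in> \<Union>\<C>" using sub C(1) by (auto simp: function_ideal_def)
      fix a b assume "a \<in> \<Union>\<C>" "b \<in> \<Union>\<C>"
      then obtain K L where "K \<in> \<C>" "L \<in> \<C>" "a \<in> K" "b \<in> L" by blast
      moreover then have "K \<subseteq> L \<or> L \<subseteq> K" using C(2) by (auto simp: subset_chain_def)
      ultimately obtain M where "M \<in> \<C>" "a \<in> M" "b \<in> M" by blast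
      then show "(\<lambda>x. a x + b x) \<in> \<Union>\<C>" using sub function_idealD(2) by blast
    next
      fix a b assume "a \<in> R" "b \<in> \<Union>\<C>"
      then show "(\<lambda>x. a x * b x) \<in> \<Union>\<C>" using sub function_idealD(3) by blast
    qed
    then show "\<Union>\<C> \<in> A" using sub C(1) by (auto simp: A_def)
  qed
  then obtain m where m: "m \<in> A" "\<And>X. X \<in> A \<Longrightarrow> m \<subseteq> X \<Longrightarrow> X = m" by blast
  show ?thesis
    by (rule exI[of _ m]) (use m in \<open>auto simp: A_def\<close>)
qed

lemma maximal_function_ideal_inverse:
  assumes m: "function_ideal (poly_funs D) m" "(\<lambda>_. 1) \<notin> m"
    and max: "\<And>K. function_ideal (poly_funs D) K \<Longrightarrow> m \<subseteq> K \<Longrightarrow> (\<lambda>_. 1) \<notin> K \<Longrightarrow> K = m"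
    and a: "a \<in> poly_funs D" "a \<notin> m"
  shows "\<exists>b\<in>poly_funs D. (\<lambda>x. a x * b x - 1) \<in> m"
proof -
  \<comment> \<open>The ideal generated by \<open>m\<close> and \<open>a\<close>. By maximality it
    contains 1, and the cofactor of \<open>a\<close> is the inverse sought.\<close>
  define K where "K = {f \<in> poly_funs D. \<exists>b\<in>poly_funs D. (\<lambda>x. f x - a x * b x) \<in> m}"
  have K: "function_ideal (poly_funs D) K"
    unfolding function_ideal_def
  proof (intro conjI ballI)
    show "K \<subseteq> poly_funs D" by (auto simp: K_def)
    show "(\<lambda>_. 0) \<in> K"
      unfolding K_def using function_idealD(4)[OF m(1)]
      by (auto intro!: poly_funs.const bexI[of _ "\<lambda>_. 0"])
    fix f g assume "f \<in> K" "g \<in> K"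
    then obtain b b' where b: "b \<in> poly_funs D" "b' \<in> poly_funs D" "f \<in> poly_funs D" "g \<in> poly_funs D"
      "(\<lambda>x. f x - a x * b x) \<in> m" "(\<lambda>x. g x - a x * b' x) \<in> m" by (auto simp: K_def)
    from function_idealD(2)[OF m(1) b(5,6)]
    have "(\<lambda>x. f x + g x - a x * (b x + b' x)) \<in> m" by (simp add: algebra_simps)
    then show "(\<lambda>x. f x + g x) \<in> K"
      unfolding K_def using b poly_funs.add by (auto intro!: bexI[of _ "\<lambda>x. b x + b' x"])
  next
    fix f g assume f: "f \<in> poly_funs D" and "g \<in> K"
    then obtain b where b: "b \<in> poly_funs D" "g \<in> poly_funs D" "(\<lambda>x. g x - a x * b x) \<in> m"
      by (auto simp: K_def)
    from function_idealD(3)[OF m(1) f b(3)]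
    have "(\<lambda>x. f x * g x - a x * (f x * b x)) \<in> m" by (simp add: algebra_simps)
    then show "(\<lambda>x. f x * g x) \<in> K"
      unfolding K_def using b f poly_funs.mult by (auto intro!: bexI[of _ "\<lambda>x. f x * b x"])
  qed
  have "m \<subseteq> K"
    unfolding K_def using function_idealD(1)[OF m(1)]
    by (auto intro!: bexI[of _ "\<lambda>_. 0"] poly_funs.const)
  moreover have "a \<in> K"
    unfolding K_def using a function_idealD(4)[OF m(1)]
    by (auto intro!: bexI[of _ "\<lambda>_. 1"] poly_funs.const)
  ultimately have "(\<lambda>_. 1) \<in> K" using max[OF K] a(2) by blast
  then obtain b where "b \<in> poly_funs D" "(\<lambda>x. 1 - a x * b x) \<in> m" by (auto simp: K_def)
  moreover from function_ideal_scale[OF m(1) this(2), of "-1"]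
  have "(\<lambda>x. a x * b x - 1) \<in> m" by (simp add: algebra_simps)
  ultimately show ?thesis by blast
qed

lemma sum_fun_apply: "(\<Sum>i\<in>I. f i) x = (\<Sum>i\<in>I. f i x)"
  by (induction I rule: infinite_finite_induct) auto

text \<open>Supplies span and independence for complex functions, for the dimension count in the
  Nullstellensatz.\<close>

interpretation cfun: vector_space "\<lambda>(c::complex) (f::'a \<Rightarrow> complex) x. c * f x"
  by unfold_locales (auto simp: algebra_simps fun_eq_iff)

text \<open>Monomials are indexed by lists of coordinates, so countably many coordinates give only
  countably many of them.\<close>

lemma poly_funs_subset_span_monomials:
  "poly_funs D \<subseteq> cfun.span ((\<lambda>ds x. \<Prod>d\<leftarrow>ds. d x) ` lists D)"
proof
  let ?mon = "\<lambda>ds x. \<Prod>d\<leftarrow>ds. d x :: complex"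
  fix p assume "p \<in> poly_funs D"
  then show "p \<in> cfun.span (?mon ` lists D)"
  proof induction
    case (const c)
    have "(\<lambda>x. c * ?mon [] x) \<in> cfun.span (?mon ` lists D)"
      by (intro cfun.span_scale cfun.span_base imageI) simp
    then show ?case by simp
  next
    case (coord d)
    then have "?mon [d] \<in> cfun.span (?mon ` lists D)"
      by (intro cfun.span_base imageI) simp
    then show ?case by simp
  next
    case (add p q)
    then show ?case using cfun.span_add[of p _ q] by (simp add: plus_fun_def)
  next
    case (mult p q)
    have 1: "(\<lambda>x. ?mon ds x * q x) \<in> cfun.span (?mon ` lists D)" if ds: "ds \<in> lists D" for ds
      using mult.IH(2)
    proof (induction rule: cfun.span_induct_alt)
      case base
      then show ?case using cfun.span_zero by (simp add: zero_fun_def)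
    next
      case (step c a b)
      then obtain es where es: "es \<in> lists D" "a = ?mon es" by blast
      then have "(\<lambda>x. c * ?mon (ds @ es) x) \<in> cfun.span (?mon ` lists D)"
        using ds by (intro cfun.span_scale cfun.span_base imageI) simp
      from cfun.span_add[OF this step(2)]
      show ?case by (simp add: es(2) plus_fun_def algebra_simps)
    qed
    show ?case
      using mult.IH(1)
    proof (induction rule: cfun.span_induct_alt)
      case base
      then show ?case using cfun.span_zero by (simp add: zero_fun_def)
    next
      case (step c a b)
      then obtain ds where "ds \<in> lists D" "a = ?mon ds" by blast
      with 1 have "(\<lambda>x. c * (a x * q x)) \<in> cfun.span (?mon ` lists D)"
        by (intro cfun.span_scale) simp
      from cfun.span_add[OF this step(2)]
      show ?case by (simp add: plus_fun_def algebra_simps)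
    qed
  qed
qed

text \<open>The weak Nullstellensatz over an uncountable field: a residue field of the countably
  generated algebra has countable dimension, whereas the inverses of \<open>a - c\<close> for \<open>c\<close> in the
  ground field would be uncountably many linearly independent elements.\<close>

lemma maximal_function_ideal_residue:
  assumes D: "countable D" and m: "function_ideal (poly_funs D) m" "(\<lambda>_. 1) \<notin> m"
    and max: "\<And>K. function_ideal (poly_funs D) K \<Longrightarrow> m \<subseteq> K \<Longrightarrow> (\<lambda>_. 1) \<notin> K \<Longrightarrow> K = m"
    and a: "a \<in> poly_funs D"
  shows "\<exists>c. (\<lambda>x. a x - c) \<in> m"
proof (rule ccontr)
  assume neg: "\<nexists>c. (\<lambda>x. a x - c) \<in> m"
  have prime: "(\<lambda>x. b x * g x) \<notin> m" if b: "b \<in> poly_funs D" "b \<notin> m" and g: "g \<in> poly_funs D" "g \<notin> m" for b g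
  proof
    assume bg: "(\<lambda>x. b x * g x) \<in> m"
    obtain b' where b': "b' \<in> poly_funs D" "(\<lambda>x. b x * b' x - 1) \<in> m"
      using maximal_function_ideal_inverse[OF m max b] by blast
    from function_ideal_diff[OF m(1) function_idealD(3)[OF m(1) b'(1) bg] function_idealD(3)[OF m(1) g(1) b'(2)]]
    have "g \<in> m" by (simp add: algebra_simps)
    with g show False by simp
  qed
  have ac: "(\<lambda>x. a x - c) \<in> poly_funs D" for c
    by (intro poly_funs_diff a poly_funs.const)
  \<comment> \<open>The complex numbers are algebraically closed, so \<open>P\<close> splits into
    linear factors; each \<open>a - c\<close> is nonzero modulo \<open>m\<close>, and so is their
    product.\<close>
  have poly_notin: "(\<lambda>x. poly P (a x)) \<in> poly_funs D - m" if "P \<noteq> 0" for P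
    using that
  proof (induction "degree P" arbitrary: P)
    case 0
    then obtain c where c: "P = [:c:]" "c \<noteq> 0" by (metis degree_eq_zeroE pCons_0_0)
    have "(\<lambda>_. c) \<notin> m"
      using function_ideal_scale[OF m(1), of "\<lambda>_. c" "1 / c"] m(2) c(2) by auto
    then show ?case using c poly_funs.const by simp
  next
    case (Suc n)
    then have "\<not> constant (poly P)" by (metis constant_degree nat.distinct(1))
    then obtain c where "poly P c = 0" using Fundamental_Theorem_Algebra.fundamental_theorem_of_algebra by blast
    then obtain Q where Q: "P = [:- c, 1:] * Q" by (metis poly_eq_0_iff_dvd dvdE)
    then have "Q \<noteq> 0" using Suc.prems by auto
    moreover then have "degree Q = n" using Suc.hyps(2) Q degree_mult_eq[of "[:- c, 1:]" Q] by auto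
    ultimately have "(\<lambda>x. poly Q (a x)) \<in> poly_funs D - m" using Suc.hyps(1) by simp
    moreover have "(\<lambda>x. a x - c) \<in> poly_funs D - m" using neg ac by simp
    ultimately show ?case
      using prime[of "\<lambda>x. a x - c" "\<lambda>x. poly Q (a x)"] poly_funs.mult[OF ac, of "\<lambda>x. poly Q (a x)" c]
      unfolding Q poly_mult by simp
  qed
  have "\<exists>b\<in>poly_funs D. (\<lambda>x. (a x - c) * b x - 1) \<in> m" for c
    using maximal_function_ideal_inverse[OF m max ac] neg by blast
  then obtain y where y: "\<And>c. y c \<in> poly_funs D" "\<And>c. (\<lambda>x. (a x - c) * y c x - 1) \<in> m" by metis
  have zero: "u c = 0" if fin: "finite F" and rel: "(\<lambda>x. \<Sum>c\<in>F. u c * y c x) = (\<lambda>_. 0)" and c: "c \<in> F" for F u c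
  proof (rule ccontr)
    assume uc: "u c \<noteq> 0"
    \<comment> \<open>Modulo \<open>m\<close> the \<open>y d\<close> are the inverses of
      \<open>a - d\<close>. Clearing denominators in the linear relation leaves \<open>P\<close>
      evaluated at \<open>a\<close>; at \<open>c\<close> only the term \<open>d = c\<close>
      survives, so \<open>P\<close> is not the zero polynomial.\<close>
    define P where "P = (\<Sum>d\<in>F. smult (u d) (\<Prod>e\<in>F - {d}. [:- e, 1:]))"
    have "poly P c = (\<Sum>d\<in>F. if d = c then u c * (\<Prod>e\<in>F - {c}. c - e) else 0)"
      unfolding P_def poly_sum using fin c
      by (intro sum.cong refl) (auto simp: poly_prod intro!: prod_zero bexI[of _ c])
    also have "\<dots> \<noteq> 0" using fin c uc by (auto simp: sum.delta)
    finally have "P \<noteq> 0" by auto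
    from poly_notin[OF this] have notin: "(\<lambda>x. poly P (a x)) \<notin> m" by simp
    have "(\<lambda>x. \<Sum>d\<in>F. u d * (\<Prod>e\<in>F - {d}. a x - e) * ((a x - d) * y d x - 1)) \<in> m"
    proof (intro function_ideal_sum[OF m(1) fin] function_idealD(3)[OF m(1)] y)
      fix d assume "d \<in> F"
      show "(\<lambda>x. u d * (\<Prod>e\<in>F - {d}. a x - e)) \<in> poly_funs D"
        using fin by (intro poly_funs.mult poly_funs.const poly_funs_prod ac) auto
    qed
    moreover have "(\<Sum>d\<in>F. u d * (\<Prod>e\<in>F - {d}. a x - e) * ((a x - d) * y d x - 1)) = - poly P (a x)" for x
    proof -
      have "u d * (\<Prod>e\<in>F - {d}. a x - e) * ((a x - d) * y d x - 1)
          = (\<Prod>e\<in>F. a x - e) * (u d * y d x) - u d * (\<Prod>e\<in>F - {d}. a x - e)" if "d \<in> F" for d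
        unfolding prod.remove[OF fin that, of "\<lambda>e. a x - e"] by (simp add: algebra_simps)
      then have "(\<Sum>d\<in>F. u d * (\<Prod>e\<in>F - {d}. a x - e) * ((a x - d) * y d x - 1))
          = (\<Prod>e\<in>F. a x - e) * (\<Sum>d\<in>F. u d * y d x) - (\<Sum>d\<in>F. u d * (\<Prod>e\<in>F - {d}. a x - e))"
        by (simp add: sum_subtractf sum_distrib_left)
      also have "(\<Sum>d\<in>F. u d * y d x) = 0" using fun_cong[OF rel, of x] by simp
      also have "(\<Sum>d\<in>F. u d * (\<Prod>e\<in>F - {d}. a x - e)) = poly P (a x)"
        by (simp add: P_def poly_sum poly_prod)
      finally show ?thesis by simp
    qed
    ultimately have "(\<lambda>x. - poly P (a x)) \<in> m" by simp
    from function_ideal_scale[OF m(1) this, of "-1"] notin show False by simp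
  qed
  have inj: "inj y"
  proof (rule injI, rule ccontr)
    fix c d assume "y c = y d" "c \<noteq> d"
    then show False using zero[of "{c, d}" "\<lambda>e. if e = c then 1 else - 1" c] by (auto simp: fun_eq_iff)
  qed
  let ?mon = "\<lambda>ds x. \<Prod>d\<leftarrow>ds. d x :: complex"
  have "countable (?mon ` lists D)" using D by simp
  moreover have "?mon ` lists D \<noteq> {}" by auto
  ultimately obtain e where e: "?mon ` lists D = range (e :: nat \<Rightarrow> _)" using range_from_nat_into by metis
  \<comment> \<open>At most \<open>n\<close> of the independent \<open>y c\<close> fit into the span
    of \<open>n\<close> monomials, yet every \<open>y c\<close> lies in one of these spans: the
    uncountable plane would be a countable union of finite sets.\<close>
  define W where "W n = {c. y c \<in> cfun.span (e ` {..<n})}" for n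
  have "finite (W n)" for n
  proof (rule ccontr)
    assume "infinite (W n)"
    then obtain F where F: "F \<subseteq> W n" "finite F" "card F = Suc n"
      using infinite_arbitrarily_large by blast
    have "cfun.independent (y ` F)"
    proof (rule cfun.independent_if_scalars_zero)
      fix f v assume *: "(\<Sum>x\<in>y ` F. (\<lambda>xa. f x * x xa)) = 0" "v \<in> y ` F"
      then obtain c where c: "c \<in> F" "v = y c" by blast
      have "(\<Sum>x\<in>y ` F. (\<lambda>xa. f x * x xa)) = (\<lambda>x. \<Sum>c\<in>F. f (y c) * y c x)"
        using inj by (subst sum.reindex) (auto simp: inj_on_def fun_eq_iff sum_fun_apply)
      then show "f v = 0" using zero[OF F(2), of "\<lambda>c. f (y c)" c] c *(1) by (simp add: zero_fun_def)
    qed (use F in auto)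
    moreover have "y ` F \<subseteq> cfun.span (e ` {..<n})" using F(1) by (auto simp: W_def)
    ultimately have "card (y ` F) \<le> card (e ` {..<n})"
      using cfun.independent_span_bound[of "e ` {..<n}" "y ` F"] by simp
    also have "\<dots> \<le> n" using card_image_le[of "{..<n}" e] by simp
    finally show False using F inj card_image[of y F] by (simp add: inj_on_def inj_def)
  qed
  then have "countable (\<Union>n. W n)" by (intro countable_UN) (auto intro: countable_finite)
  moreover have "(\<Union>n. W n) = UNIV"
  proof -
    have "\<exists>n. v \<in> cfun.span (e ` {..<n})" if "v \<in> cfun.span (range e)" for v
      using that
    proof (induction rule: cfun.span_induct_alt)
      case base
      show ?case using cfun.span_zero by blast
    next
      case (step c v w)
      then obtain i n where i: "v = e i" "w \<in> cfun.span (e ` {..<n})" by auto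
      have "(\<lambda>x. c * v x) + w \<in> cfun.span (e ` {..<max n (Suc i)})"
      proof (intro cfun.span_add cfun.span_scale)
        show "v \<in> cfun.span (e ` {..<max n (Suc i)})" using i(1) by (intro cfun.span_base) auto
        show "w \<in> cfun.span (e ` {..<max n (Suc i)})"
          by (rule subsetD[OF cfun.span_mono i(2)]) auto
      qed
      then show ?case by blast
    qed
    then show ?thesis using y(1) poly_funs_subset_span_monomials[of D] unfolding W_def e by blast
  qed
  ultimately show False using uncountable_UNIV_complex by simp
qed

lemma det_in_poly_funs: "(\<lambda>A :: complex^'n^'n. det A) \<in> poly_funs entries"
  unfolding det_def
  by (intro poly_funs_sum poly_funs.mult poly_funs_prod poly_funs.const poly_funs.coord)
     (auto simp: finite_permutations entries_def)

text \<open>\<open>J\<close> is the ideal of denominators of \<open>f\<close>. Were it proper, a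
  maximal ideal above it would belong to a matrix \<open>A\<close>, which lies in \<open>G\<close>
  because \<open>J\<close> contains everything vanishing on \<open>G\<close>; but the local quotient
  for \<open>f\<close> near \<open>A\<close> provides a denominator that is nonzero at
  \<open>A\<close>.\<close>

proposition regular_imp_globally_polynomial:
  fixes G :: "(complex^'n^'n) set"
  assumes G: "linear_algebraic_group G" and f: "f \<in> regular (quasi_affine entries G) G"
  obtains p where "p \<in> poly_funs (insert (\<lambda>A. 1 / det A) entries)" "\<And>g. g \<in> G \<Longrightarrow> f g = p g"
proof -
  define D :: "(complex^'n^'n \<Rightarrow> complex) set" where "D = insert (\<lambda>A. 1 / det A) entries"
  have "(entries :: (complex^'n^'n \<Rightarrow> complex) set) = (\<lambda>(i, j) A. A $ i $ j) ` UNIV"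
    by (auto simp: entries_def image_iff)
  then have "finite (entries :: (complex^'n^'n \<Rightarrow> complex) set)" by (metis finite finite_imageI)
  then have cD: "countable D" by (simp add: D_def countable_finite)
  have entD: "p \<in> poly_funs D" if "p \<in> poly_funs entries" for p
    using poly_funs_mono[OF that, of D] by (auto simp: D_def)
  have GL: "G \<subseteq> {A. invertible A}"
    using G subgroup.subset by (fastforce simp: linear_algebraic_group_def GL_def)
  define J where "J = {a \<in> poly_funs D. \<exists>b\<in>poly_funs D. \<forall>g\<in>G. a g * f g = b g}"
  have J: "function_ideal (poly_funs D) J"
    unfolding function_ideal_def
  proof (intro conjI ballI)
    show "J \<subseteq> poly_funs D" by (auto simp: J_def)
    show "(\<lambda>_. 0) \<in> J"
      unfolding J_def by (auto intro!: poly_funs.const bexI[of _ "\<lambda>_. 0"])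
  next
    fix a b assume "a \<in> J" "b \<in> J"
    then obtain a' b' where *: "a \<in> poly_funs D" "b \<in> poly_funs D" "a' \<in> poly_funs D" "b' \<in> poly_funs D"
      "\<forall>g\<in>G. a g * f g = a' g" "\<forall>g\<in>G. b g * f g = b' g" by (auto simp: J_def)
    then have "\<forall>g\<in>G. (a g + b g) * f g = a' g + b' g" by (simp add: algebra_simps)
    then show "(\<lambda>x. a x + b x) \<in> J"
      unfolding J_def using poly_funs.add[OF *(1,2)] poly_funs.add[OF *(3,4)]
      by (intro CollectI conjI bexI[of _ "\<lambda>x. a' x + b' x"])
  next
    fix a b assume a: "a \<in> poly_funs D" and "b \<in> J"
    then obtain b' where *: "b \<in> poly_funs D" "b' \<in> poly_funs D" "\<forall>g\<in>G. b g * f g = b' g"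
      by (auto simp: J_def)
    then have "\<forall>g\<in>G. (a g * b g) * f g = a g * b' g" by (simp add: mult.assoc)
    then show "(\<lambda>x. a x * b x) \<in> J"
      unfolding J_def using poly_funs.mult[OF a *(1)] poly_funs.mult[OF a *(2)]
      by (intro CollectI conjI bexI[of _ "\<lambda>x. a x * b' x"])
  qed
  have van: "a \<in> J" if "a \<in> poly_funs D" "\<And>g. g \<in> G \<Longrightarrow> a g = 0" for a
    unfolding J_def using that by (auto intro!: poly_funs.const bexI[of _ "\<lambda>_. 0"])
  have "(\<lambda>_. 1) \<in> J"
  proof (rule ccontr)
    assume "(\<lambda>_. 1) \<notin> J"
    from exists_maximal_function_ideal[OF J this] obtain m
      where m: "function_ideal (poly_funs D) m" "J \<subseteq> m" "(\<lambda>_. 1) \<notin> m"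
      and max: "\<And>K. function_ideal (poly_funs D) K \<Longrightarrow> m \<subseteq> K \<Longrightarrow> (\<lambda>_. 1) \<notin> K \<Longrightarrow> K = m"
      by blast
    \<comment> \<open>Each entry is congruent to a constant modulo \<open>m\<close>; these constants
      are assembled into the matrix \<open>A\<close>, the point belonging to
      \<open>m\<close>.\<close>
    have "\<forall>i j. \<exists>c. (\<lambda>A. A $ i $ j - c) \<in> m"
      by (intro allI maximal_function_ideal_residue[OF cD m(1,3) max] entD poly_funs.coord)
         (auto simp: entries_def)
    then obtain c where c: "\<And>i j. (\<lambda>A. A $ i $ j - c i j) \<in> m" by metis
    define A where "A = (\<chi> i j. c i j)"
    have const: "c = 0" if "(\<lambda>_. c) \<in> m" for c
      using function_ideal_scale[OF m(1) that, of "1 / c"] m(3) by (cases "c = 0") auto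
    have eval: "(\<lambda>x. p x - p A) \<in> m" if "p \<in> poly_funs entries" for p
      using that
    proof induction
      case (const c)
      then show ?case using function_idealD(4)[OF m(1)] by simp
    next
      case (coord x)
      then show ?case using c by (auto simp: entries_def A_def)
    next
      case (add p q)
      from function_idealD(2)[OF m(1) add.IH] show ?case by (simp add: algebra_simps)
    next
      case (mult p q)
      from function_idealD(2)[OF m(1) function_idealD(3)[OF m(1) entD[OF mult.hyps(1)] mult.IH(2)]
          function_ideal_scale[OF m(1) mult.IH(1), of "q A"]]
      show ?case by (simp add: algebra_simps)
    qed
    have evalm: "p A = 0" if "p \<in> poly_funs entries" "p \<in> m" for p
      using const function_ideal_diff[OF m(1) that(2) eval[OF that(1)]] by simp
    have inv: "(\<lambda>A. 1 / det A) \<in> poly_funs D" by (intro poly_funs.coord) (simp add: D_def)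
    have "det A \<noteq> 0"
    proof
      assume "det A = 0"
      then have "(\<lambda>A. det A) \<in> m" using eval[OF det_in_poly_funs] by simp
      from function_idealD(3)[OF m(1) inv this] have "(\<lambda>A. 1 / det A * det A) \<in> m" .
      \<comment> \<open>The functions live on all matrices, with \<open>1 / det A = 0\<close> at
        singular ones, so this difference is not identically 0. It vanishes on \<open>G\<close>, and
        that puts it into \<open>J\<close>.\<close>
      moreover have "(\<lambda>A. 1 / det A * det A - 1) \<in> m"
        by (intro subsetD[OF m(2)] van poly_funs_diff poly_funs.mult poly_funs.const inv
            entD[OF det_in_poly_funs])
           (use GL in \<open>auto simp: invertible_det_nz\<close>)
      ultimately have "(\<lambda>A. 1 / det A * det A - (1 / det A * det A - 1)) \<in> m"
        by (rule function_ideal_diff[OF m(1)])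
      moreover have "x - (x - 1) = (1::complex)" for x by simp
      ultimately have "(\<lambda>A. 1) \<in> m" by (simp only:)
      with m(3) show False by simp
    qed
    then have "A \<in> carrier GL" by (simp add: GL_def invertible_det_nz)
    moreover have "p A = 0" if "p \<in> poly_funs entries" "\<forall>g\<in>G. p g = 0" for p
      using evalm van that entD m(2) by blast
    ultimately have AG: "A \<in> G"
      using G closedin_zariski_iff_zeros unfolding linear_algebraic_group_def by blast
    then obtain V p q where V: "openin (zariski_topology entries G) V" "A \<in> V"
      "p \<in> poly_funs entries" "q \<in> poly_funs entries" "\<forall>y\<in>V. q y \<noteq> 0 \<and> f y = p y / q y"
      using f by (auto simp: quasi_affine_def)
    from V(1,2) obtain r where r: "r \<in> poly_funs entries" "r A \<noteq> 0" "{y \<in> G. r y \<noteq> 0} \<subseteq> V"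
      by (rule openin_zariskiE)
    \<comment> \<open>The factor \<open>r\<close> vanishes on \<open>G\<close> outside
      \<open>V\<close>, which turns the local identity for \<open>f\<close> into one on all of
      \<open>G\<close>.\<close>
    have "r g * q g * f g = r g * p g" if "g \<in> G" for g
      using V(5) r(3) that by (cases "r g = 0") auto
    then have "(\<lambda>x. r x * q x) \<in> J"
      unfolding J_def using entD[OF poly_funs.mult[OF r(1) V(4)]] entD[OF poly_funs.mult[OF r(1) V(3)]]
      by (intro CollectI conjI bexI[of _ "\<lambda>x. r x * p x"]) auto
    then have "r A * q A = 0"
      using evalm[OF poly_funs.mult[OF r(1) V(4)]] m(2) by blast
    with r(2) V(2,5) show False by auto
  qed
  then show thesis using that unfolding J_def D_def by auto
qed

section \<open>Invertible regular functions are characters\<close>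

text \<open>Borel--Caratheodory: the Schwarz lemma applied to \<open>h / (2 M - h)\<close> on a disc where
  \<open>Re h < M\<close>.\<close>

lemma norm_le_of_Re_less:
  assumes h: "h holomorphic_on ball 0 R" "h 0 = 0" and R: "R > 0"
    and Re: "\<And>z. norm z < R \<Longrightarrow> Re (h z) < M" and z: "norm z \<le> R / 2"
  shows "norm (h z) \<le> 2 * M"
proof -
  have M: "M > 0" using Re[of 0] R h(2) by simp
  define u where "u \<zeta> = h (of_real R * \<zeta>) / (2 * of_real M - h (of_real R * \<zeta>))" for \<zeta>
  have in_ball: "norm (of_real R * \<zeta>) < R" if "norm \<zeta> < 1" for \<zeta> :: complex
    using that R by (simp add: norm_mult)
  have less: "norm w < norm (2 * of_real M - w)" if "Re w < M" for w
  proof -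
    have "(2 * M - Re w)\<^sup>2 - (Re w)\<^sup>2 = 4 * (M * (M - Re w))"
      by (simp add: power2_eq_square algebra_simps)
    moreover have "M * (M - Re w) > 0" using that M by simp
    ultimately have "(Re w)\<^sup>2 < (2 * M - Re w)\<^sup>2" by linarith
    then show ?thesis
      by (simp add: cmod_def)
  qed
  have "u holomorphic_on ball 0 1"
    unfolding u_def
  proof (intro holomorphic_on_divide holomorphic_on_diff holomorphic_on_const)
    have "(h \<circ> (\<lambda>\<zeta>. of_real R * \<zeta>)) holomorphic_on ball 0 1"
      by (rule holomorphic_on_compose_gen[OF _ h(1)]) (auto intro!: holomorphic_intros in_ball)
    then show "(\<lambda>\<zeta>. h (of_real R * \<zeta>)) holomorphic_on ball 0 1"
      and "(\<lambda>\<zeta>. h (of_real R * \<zeta>)) holomorphic_on ball 0 1" by (simp_all add: o_def)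
    fix \<zeta> :: complex assume "\<zeta> \<in> ball 0 1"
    then show "2 * of_real M - h (of_real R * \<zeta>) \<noteq> 0"
      using less[OF Re[OF in_ball, of \<zeta>]] by force
  qed
  moreover have "u 0 = 0" by (simp add: u_def h(2))
  moreover have "norm (u \<zeta>) < 1" if "norm \<zeta> < 1" for \<zeta>
    using less[OF Re[OF in_ball[OF that]]] unfolding u_def norm_divide
    by (metis divide_less_eq_1 norm_ge_zero not_less order_le_less_trans)
  moreover have "norm (z / of_real R) < 1" using z R by (simp add: norm_divide)
  ultimately have "norm (u (z / of_real R)) \<le> norm (z / of_real R)"
    by (rule Schwarz_Lemma(1))
  also have "\<dots> \<le> 1 / 2" using z R by (simp add: norm_divide field_simps)
  finally have "norm (h z) / norm (2 * of_real M - h z) \<le> 1 / 2"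
    using R by (simp add: u_def norm_divide)
  moreover have "norm (2 * of_real M - h z) > 0"
    using less[OF Re, of z] z R by (smt (verit) norm_ge_zero field_sum_of_halves)
  ultimately have "2 * norm (h z) \<le> norm (2 * of_real M - h z)" by (simp add: field_simps)
  also have "\<dots> \<le> 2 * M + norm (h z)"
    using norm_triangle_ineq4[of "2 * of_real M" "h z"] M by (simp add: norm_mult)
  finally show ?thesis by simp
qed

text \<open>Order one of Hadamard's factorisation without zeros: a logarithm has linearly bounded
  real part, hence linearly bounded modulus by Borel-Caratheodory, hence is affine. The bound on
  \<open>c\<close> involves \<open>K\<close> and not \<open>C\<close>, which later gives uniformity
  over the group.\<close>

lemma entire_nonvanishing_exponential_type:
  assumes F: "F holomorphic_on UNIV" "\<And>z. F z \<noteq> 0"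
    and bound: "\<And>z. norm (F z) \<le> C * exp (K * norm z)" and K: "K \<ge> 0"
  shows "\<exists>c. norm c \<le> 4 * K \<and> (\<forall>z. F z = F 0 * exp (c * z))"
proof -
  obtain g where g: "g holomorphic_on UNIV" "\<And>z. F z = exp (g z)"
    using contractible_imp_holomorphic_log[of F UNIV] F by auto
  define h where "h z = g z - g 0" for z
  have Fh: "F z = F 0 * exp (h z)" for z by (simp add: h_def g(2) exp_diff)
  have hol: "h holomorphic_on S" for S
    unfolding h_def using g(1) holomorphic_on_subset by (intro holomorphic_intros) blast
  have h0: "h 0 = 0" by (simp add: h_def)
  have C: "C > 0"
  proof -
    have "0 < norm (F 0)" using F(2) by simp
    also have "\<dots> \<le> C" using bound[of 0] by simp
    finally show ?thesis .
  qed
  define D where "D = ln (C / norm (F 0))"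
  have Re: "Re (h z) \<le> K * norm z + D" for z
  proof -
    have "norm (F 0) * exp (Re (h z)) \<le> C * exp (K * norm z)"
      using bound[of z] by (simp add: Fh[of z] norm_mult)
    then have "exp (Re (h z)) \<le> exp (K * norm z) * (C / norm (F 0))"
      using F(2)[of 0] by (simp add: field_simps)
    also have "\<dots> = exp (K * norm z + D)"
      using C F(2)[of 0] by (simp add: exp_add D_def)
    finally show ?thesis by simp
  qed
  have lin: "norm (h z) \<le> 4 * K * norm z + 2 * (K + D + 1)" for z
  proof -
    \<comment> \<open>Radius \<open>2 * norm z + 1\<close>: it is positive and keeps
      \<open>z\<close> in the half disc. The two factors 2 combine to the 4 in \<open>4 * K\<close>;
      the last summand 1 makes the bound on the real part strict.\<close>
    have "norm (h z) \<le> 2 * (K * (2 * norm z + 1) + D + 1)"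
    proof (rule norm_le_of_Re_less[OF hol h0])
      fix w :: complex assume "norm w < 2 * norm z + 1"
      then have "K * norm w \<le> K * (2 * norm z + 1)" using K by (intro mult_left_mono) auto
      then show "Re (h w) < K * (2 * norm z + 1) + D + 1" using Re[of w] by simp
    qed (auto intro: add_nonneg_pos)
    then show ?thesis by (simp add: algebra_simps)
  qed
  define E where "E = \<bar>2 * (K + D + 1)\<bar>"
  have "h z = (\<Sum>k\<le>1. (deriv ^^ k) h 0 / fact k * z ^ k)" for z
  proof (rule Liouville_polynomial[OF hol])
    fix w :: complex assume "1 \<le> norm w"
    then have "E \<le> E * norm w" by (simp add: E_def mult_le_cancel_left1)
    then have "4 * K * norm w + 2 * (K + D + 1) \<le> (4 * K + E) * norm w ^ 1"
      by (simp add: algebra_simps E_def)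
    with lin[of w] show "norm (h w) \<le> (4 * K + E) * norm w ^ 1" by linarith
  qed
  then have hc: "h z = deriv h 0 * z" for z using h0 by simp
  have "norm (deriv h 0) \<le> 4 * K"
  proof (rule ccontr)
    assume "\<not> ?thesis"
    then have pos: "norm (deriv h 0) - 4 * K > 0" by simp
    \<comment> \<open>Chosen so that the linear bound at the real point \<open>r\<close> would read
      \<open>E + 1 \<le> E\<close>.\<close>
    define r where "r = (E + 1) / (norm (deriv h 0) - 4 * K)"
    have r: "r > 0" using pos by (simp add: r_def E_def)
    have "norm (deriv h 0) * r \<le> 4 * K * r + E"
      using lin[of "of_real r"] r by (simp add: hc norm_mult E_def)
    then have "r * (norm (deriv h 0) - 4 * K) \<le> E" by (simp add: algebra_simps)
    moreover have "r * (norm (deriv h 0) - 4 * K) = E + 1" using pos by (simp add: r_def)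
    ultimately show False by simp
  qed
  with Fh hc show ?thesis by metis
qed

section \<open>Growth of rational functions along one-parameter groups\<close>

definition rational_coords :: "(complex^'n^'n \<Rightarrow> complex) set" where
  "rational_coords = insert (\<lambda>A. 1 / det A) entries"

text \<open>The order of the quantifiers is the point: the exponent \<open>K\<close> is fixed before
  \<open>g\<close>, and only the factor \<open>C\<close> may depend on \<open>g\<close>.\<close>

definition exp_growth :: "complex^'n^'n \<Rightarrow> (complex^'n^'n \<Rightarrow> complex) \<Rightarrow> bool" where
  "exp_growth A p \<longleftrightarrow> (\<exists>K\<ge>0. \<forall>g. invertible g \<longrightarrow>
     (\<exists>C\<ge>0. \<forall>t. norm (p (g ** mexp (csc t A))) \<le> C * exp (K * norm t)))"

lemma invertible_mat_1: "invertible (mat 1 :: complex^'n^'n)"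
  by (metis invertible_def matrix_mul_lid)

lemma exp_growth_poly_funs:
  fixes A :: "complex^'n^'n"
  assumes "p \<in> poly_funs D" "\<And>x. x \<in> D \<Longrightarrow> exp_growth A x"
  shows "exp_growth A p"
  using assms(1)
proof induction
  case (const c)
  show ?case unfolding exp_growth_def
    by (intro exI[of _ 0] conjI allI impI exI[of _ "norm c"]) auto
next
  case (coord x)
  then show ?case by (rule assms(2))
next
  case (add p q)
  obtain K L where KL: "K \<ge> 0" "L \<ge> 0"
    "\<And>g. invertible g \<Longrightarrow> \<exists>C\<ge>0. \<forall>t. norm (p (g ** mexp (csc t A))) \<le> C * exp (K * norm t)"
    "\<And>g. invertible g \<Longrightarrow> \<exists>C\<ge>0. \<forall>t. norm (q (g ** mexp (csc t A))) \<le> C * exp (L * norm t)"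
    using add.IH unfolding exp_growth_def by metis
  show ?case unfolding exp_growth_def
  proof (rule exI[of _ "K + L"], intro conjI allI impI)
    fix g :: "complex^'n^'n" assume "invertible g"
    then obtain B C where BC: "B \<ge> 0" "C \<ge> 0"
      "\<And>t. norm (p (g ** mexp (csc t A))) \<le> B * exp (K * norm t)"
      "\<And>t. norm (q (g ** mexp (csc t A))) \<le> C * exp (L * norm t)"
      using KL by metis
    have "norm (p (g ** mexp (csc t A)) + q (g ** mexp (csc t A))) \<le> (B + C) * exp ((K + L) * norm t)" for t
    proof -
      have "B * exp (K * norm t) \<le> B * exp ((K + L) * norm t)"
        "C * exp (L * norm t) \<le> C * exp ((K + L) * norm t)"
        using BC KL by (auto intro!: mult_left_mono simp: algebra_simps)
      then show ?thesis
        using norm_triangle_ineq[of "p (g ** mexp (csc t A))" "q (g ** mexp (csc t A))"] BC(3,4)[of t]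
        by (simp add: algebra_simps)
    qed
    then show "\<exists>C\<ge>0. \<forall>t. norm (p (g ** mexp (csc t A)) + q (g ** mexp (csc t A))) \<le> C * exp ((K + L) * norm t)"
      using BC by (intro exI[of _ "B + C"]) auto
  qed (use KL in simp)
next
  case (mult p q)
  obtain K L where KL: "K \<ge> 0" "L \<ge> 0"
    "\<And>g. invertible g \<Longrightarrow> \<exists>C\<ge>0. \<forall>t. norm (p (g ** mexp (csc t A))) \<le> C * exp (K * norm t)"
    "\<And>g. invertible g \<Longrightarrow> \<exists>C\<ge>0. \<forall>t. norm (q (g ** mexp (csc t A))) \<le> C * exp (L * norm t)"
    using mult.IH unfolding exp_growth_def by metis
  show ?case unfolding exp_growth_def
  proof (rule exI[of _ "K + L"], intro conjI allI impI)
    fix g :: "complex^'n^'n" assume "invertible g"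
    then obtain B C where BC: "B \<ge> 0" "C \<ge> 0"
      "\<And>t. norm (p (g ** mexp (csc t A))) \<le> B * exp (K * norm t)"
      "\<And>t. norm (q (g ** mexp (csc t A))) \<le> C * exp (L * norm t)"
      using KL by metis
    have "norm (p (g ** mexp (csc t A)) * q (g ** mexp (csc t A))) \<le> (B * C) * exp ((K + L) * norm t)" for t
    proof -
      have "norm (p (g ** mexp (csc t A)) * q (g ** mexp (csc t A)))
          \<le> (B * exp (K * norm t)) * (C * exp (L * norm t))"
        unfolding norm_mult using BC by (intro mult_mono) auto
      also have "\<dots> = (B * C) * exp ((K + L) * norm t)"
        by (simp add: exp_add algebra_simps)
      finally show ?thesis .
    qed
    then show "\<exists>C\<ge>0. \<forall>t. norm (p (g ** mexp (csc t A)) * q (g ** mexp (csc t A))) \<le> C * exp ((K + L) * norm t)"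
      using BC by (intro exI[of _ "B * C"]) auto
  qed (use KL in simp)
qed

lemma exp_growth_entries:
  fixes A :: "complex^'n^'n"
  assumes "x \<in> entries"
  shows "exp_growth A x"
proof -
  obtain i j where x: "x = (\<lambda>A. A $ i $ j)" using assms by (auto simp: entries_def)
  show ?thesis unfolding exp_growth_def x
  proof (rule exI[of _ "onorm ((*v) A)"], intro conjI allI impI)
    fix g :: "complex^'n^'n"
    have "norm ((g ** mexp (csc t A)) $ i $ j) \<le> (\<Sum>l\<in>UNIV. norm (g $ i $ l)) * exp (onorm ((*v) A) * norm t)" for t
    proof -
      have "norm ((g ** mexp (csc t A)) $ i $ j) \<le> (\<Sum>l\<in>UNIV. norm (g $ i $ l * mexp (csc t A) $ l $ j))"
        by (simp add: matrix_matrix_mult_def norm_sum)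
      also have "\<dots> \<le> (\<Sum>l\<in>UNIV. norm (g $ i $ l) * exp (onorm ((*v) A) * norm t))"
        using norm_mexp_csc_entry_le[of t A]
        by (intro sum_mono) (simp add: norm_mult mult_left_mono mult.commute)
      finally show ?thesis by (simp add: sum_distrib_right)
    qed
    then show "\<exists>C\<ge>0. \<forall>t. norm ((g ** mexp (csc t A)) $ i $ j) \<le> C * exp (onorm ((*v) A) * norm t)"
      by (intro exI[of _ "\<Sum>l\<in>UNIV. norm (g $ i $ l)"]) (auto intro: sum_nonneg)
  qed (simp add: onorm_pos_le)
qed

lemma det_mexp_csc_minus: "det (mexp (csc t A)) * det (mexp (csc (- t) A)) = 1"
  by (metis add.right_inverse csc_0 det_I det_mul mexp_0 mexp_csc_add)

text \<open>Only the inverse determinant needs an argument: along the group it is, up to the factor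
  \<open>1 / det g\<close>, the determinant at time \<open>- t\<close>, so the bound for
  \<open>det\<close> applies to it.\<close>

lemma exp_growth_rational:
  fixes A :: "complex^'n^'n"
  assumes "p \<in> poly_funs rational_coords"
  shows "exp_growth A p"
  using assms
proof (rule exp_growth_poly_funs)
  fix x :: "complex^'n^'n \<Rightarrow> complex" assume "x \<in> rational_coords"
  then consider "x \<in> entries" | "x = (\<lambda>A. 1 / det A)" by (auto simp: rational_coords_def)
  then show "exp_growth A x"
  proof cases
    case 2
    have "exp_growth A (\<lambda>A. det A)"
      by (rule exp_growth_poly_funs[OF det_in_poly_funs exp_growth_entries])
    then obtain K C where K: "K \<ge> 0" "C \<ge> 0" "\<And>t. norm (det (mat 1 ** mexp (csc t A))) \<le> C * exp (K * norm t)"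
      unfolding exp_growth_def using invertible_mat_1 by metis
    show ?thesis unfolding exp_growth_def 2
    proof (rule exI[of _ K], intro conjI allI impI K(1))
      fix g :: "complex^'n^'n"
      have "norm (1 / det (g ** mexp (csc t A))) \<le> norm (1 / det g) * C * exp (K * norm t)" for t
      proof -
        have "det (mexp (csc (- t) A)) = 1 / det (mexp (csc t A))"
          using det_mexp_csc_minus[of t A]
          by (metis mult_zero_left nonzero_mult_div_cancel_left zero_neq_one)
        then have "1 / det (g ** mexp (csc t A)) = 1 / det g * det (mexp (csc (- t) A))"
          by (simp add: det_mul)
        then show ?thesis
          using K(3)[of "- t"] unfolding mult.assoc by (simp add: norm_mult norm_divide divide_right_mono)
      qed
      then show "\<exists>C\<ge>0. \<forall>t. norm (1 / det (g ** mexp (csc t A))) \<le> C * exp (K * norm t)"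
        using K(2) by (intro exI[of _ "norm (1 / det g) * C"]) auto
    qed
  qed (rule exp_growth_entries)
qed

lemma holomorphic_rational_mexp:
  fixes g h A :: "complex^'n^'n"
  assumes p: "p \<in> poly_funs rational_coords" and g: "invertible g" and h: "invertible h"
  shows "(\<lambda>t. p (g ** mexp (csc t A) ** h)) holomorphic_on UNIV"
proof -
  have ent: "(\<lambda>t. (g ** mexp (csc t A) ** h) $ i $ j) holomorphic_on UNIV" for i j
    by (simp add: matrix_matrix_mult_def) (intro holomorphic_intros holomorphic_mexp_csc)
  have poly: "(\<lambda>t. q (g ** mexp (csc t A) ** h)) holomorphic_on UNIV" if "q \<in> poly_funs entries" for q
    using that
  proof induction
    case (coord x)
    then show ?case using ent by (auto simp: entries_def)
  qed (auto intro: holomorphic_on_add holomorphic_on_mult)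
  show ?thesis
    using p
  proof induction
    case (coord x)
    then consider "x \<in> entries" | "x = (\<lambda>A. 1 / det A)" by (auto simp: rational_coords_def)
    then show ?case
    proof cases
      case 2
      have "det (g ** mexp (csc t A) ** h) \<noteq> 0" for t
        using g h invertible_mexp[of "csc t A"] by (simp add: det_mul invertible_det_nz)
      then show ?thesis unfolding 2 using poly[OF det_in_poly_funs]
        by (intro holomorphic_on_divide holomorphic_on_const) auto
    qed (intro poly poly_funs.coord)
  qed (auto intro: holomorphic_on_add holomorphic_on_mult)
qed

section \<open>Linear algebraic groups as closed linear groups\<close>

lemma group_GL: "group GL"
proof (rule groupI)
  fix A :: "complex^'n^'n" assume "A \<in> carrier GL"
  then show "\<exists>B\<in>carrier GL. B \<otimes>\<^bsub>GL\<^esub> A = \<one>\<^bsub>GL\<^esub>"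
    by (auto simp: GL_def) (metis invertible_def)
qed (auto simp: GL_def matrix_mul_assoc invertible_mult invertible_mat_1)

lemma subgroup_GL_iff:
  "subgroup S GL \<longleftrightarrow> S \<subseteq> {A. invertible A} \<and> mat 1 \<in> S \<and> (\<forall>A\<in>S. \<forall>B\<in>S. A ** B \<in> S) \<and>
     (\<forall>A\<in>S. \<exists>B\<in>S. A ** B = mat 1 \<and> B ** A = mat 1)"
proof
  assume S: "subgroup S (GL :: (complex^'a^'a) monoid)"
  have "\<exists>B\<in>S. A ** B = mat 1 \<and> B ** A = mat 1" if "A \<in> S" for A
    using subgroup.m_inv_closed[OF S that] group.l_inv[OF group_GL subgroup.mem_carrier[OF S that]]
      group.r_inv[OF group_GL subgroup.mem_carrier[OF S that]] by (auto simp: GL_def)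
  then show "S \<subseteq> {A. invertible A} \<and> mat 1 \<in> S \<and> (\<forall>A\<in>S. \<forall>B\<in>S. A ** B \<in> S) \<and>
     (\<forall>A\<in>S. \<exists>B\<in>S. A ** B = mat 1 \<and> B ** A = mat 1)"
    using subgroup.subset[OF S] subgroup.one_closed[OF S] subgroup.m_closed[OF S] by (auto simp: GL_def)
next
  assume S: "S \<subseteq> {A. invertible A} \<and> mat 1 \<in> S \<and> (\<forall>A\<in>S. \<forall>B\<in>S. A ** B \<in> S) \<and>
     (\<forall>A\<in>S. \<exists>B\<in>S. A ** B = mat 1 \<and> B ** A = mat 1)"
  show "subgroup S (GL :: (complex^'a^'a) monoid)"
  proof (rule group.subgroupI[OF group_GL])
    fix A assume A: "A \<in> S"
    then obtain B where B: "B \<in> S" "B ** A = mat 1" using S by blast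
    then have "inv\<^bsub>GL\<^esub> A = B"
      using A S by (intro group.inv_equality[OF group_GL]) (auto simp: GL_def)
    then show "inv\<^bsub>GL\<^esub> A \<in> S" using B by simp
  qed (use S in \<open>auto simp: GL_def\<close>)
qed

lemma continuous_on_poly_funs_entries:
  assumes "p \<in> poly_funs entries"
  shows "continuous_on S (p :: complex^'n^'n \<Rightarrow> complex)"
  using assms
proof induction
  case (coord x)
  then show ?case by (auto simp: entries_def intro!: continuous_intros)
qed (auto intro: continuous_on_add continuous_on_mult)

lemma linear_algebraic_group_closed:
  assumes G: "linear_algebraic_group (G :: (complex^'n^'n) set)"
  shows "closed_linear_group G"
proof -
  have Z: "closedin (zariski_topology entries (carrier GL)) G" and sg: "subgroup G GL"
    using G by (auto simp: linear_algebraic_group_def)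
  define P where "P = {p \<in> poly_funs entries. \<forall>z\<in>G. p z = 0}"
  have "G = {A. invertible A} \<inter> (\<Inter>p\<in>P. {A. p A = 0})"
    by (subst closedin_zariski_iff_zeros[OF Z]) (auto simp: P_def GL_def)
  moreover have "closed (\<Inter>p\<in>P. {A. p A = 0})"
    by (intro closed_INT ballI closed_Collect_eq continuous_on_poly_funs_entries continuous_on_const)
       (auto simp: P_def)
  ultimately have "closedin (top_of_set {A. invertible A}) G" by (auto simp: closedin_closed)
  with sg show ?thesis by (simp add: closed_linear_group_def subgroup_GL_iff)
qed

text \<open>A polynomial vanishing on \<open>G\<close> gives an entire function of \<open>t\<close>
  that is 0 on the real axis, hence everywhere. Being algebraic is essential: for the unitary group,
  closed but not complex algebraic, the conclusion fails.\<close>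

lemma lie_complex:
  assumes G: "linear_algebraic_group (G :: (complex^'n^'n) set)" and A: "A \<in> lie G"
  shows "mexp (csc t A) \<in> G"
proof -
  have Z: "closedin (zariski_topology entries (carrier GL)) G"
    using G by (auto simp: linear_algebraic_group_def)
  have "p (mexp (csc t A)) = 0" if p: "p \<in> poly_funs entries" "\<forall>z\<in>G. p z = 0" for p
  proof (rule analytic_continuation[of "\<lambda>t. p (mexp (csc t A))" UNIV \<real> 0])
    have "p \<in> poly_funs rational_coords"
      using poly_funs_mono[OF p(1)] by (auto simp: rational_coords_def)
    from holomorphic_rational_mexp[OF this invertible_mat_1 invertible_mat_1]
    show "(\<lambda>t. p (mexp (csc t A))) holomorphic_on UNIV" by simp
    show "(0::complex) islimpt \<real>"
      unfolding islimpt_approachable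
    proof (intro allI impI)
      fix e :: real assume "e > 0"
      then show "\<exists>x'\<in>\<real>. x' \<noteq> 0 \<and> dist x' (0::complex) < e"
        by (intro bexI[of _ "of_real (e / 2)"]) auto
    qed
    fix z :: complex assume "z \<in> \<real>"
    then obtain r where "z = of_real r" by (auto simp: Reals_def)
    then show "p (mexp (csc z A)) = 0"
      using A p(2) by (simp add: csc_of_real lie_def)
  qed auto
  then have "mexp (csc t A) \<in> {x \<in> carrier GL. \<forall>p\<in>poly_funs entries. (\<forall>z\<in>G. p z = 0) \<longrightarrow> p x = 0}"
    by (simp add: GL_def)
  then show ?thesis using closedin_zariski_iff_zeros[OF Z] by simp
qed

context
  fixes G :: "(complex^'n^'n) set" and f :: "complex^'n^'n \<Rightarrow> complex"
  assumes G: "linear_algebraic_group G" and con: "connected G"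
    and reg: "f \<in> regular (quasi_affine entries G) G"
    and nz: "\<And>g. g \<in> G \<Longrightarrow> f g \<noteq> 0" and f1: "f (mat 1) = 1"
begin

lemma G_mult: "g \<in> G \<Longrightarrow> h \<in> G \<Longrightarrow> g ** h \<in> G"
  and G_invertible: "g \<in> G \<Longrightarrow> invertible g"
  and G_one: "mat 1 \<in> G"
  using G by (auto simp: linear_algebraic_group_def subgroup_GL_iff)

text \<open>At this stage the exponent \<open>c\<close> may still vary with \<open>g\<close>; only
  its bound \<open>K\<close> is uniform. The uniform bound is what rules the variation out
  afterwards.\<close>

lemma invertible_function_on_one_parameter_group:
  assumes A: "A \<in> lie G"
  shows "\<exists>K\<ge>0. \<forall>g\<in>G. \<exists>c. norm c \<le> K \<and> (\<forall>t. f (g ** mexp (csc t A)) = f g * exp (c * t))"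
proof -
  obtain p where p: "p \<in> poly_funs rational_coords" "\<And>g. g \<in> G \<Longrightarrow> f g = p g"
    using regular_imp_globally_polynomial[OF G reg] unfolding rational_coords_def by blast
  obtain K where K: "K \<ge> 0" "\<And>g. invertible g \<Longrightarrow>
      \<exists>C\<ge>0. \<forall>t. norm (p (g ** mexp (csc t A))) \<le> C * exp (K * norm t)"
    using exp_growth_rational[OF p(1), of A] unfolding exp_growth_def by blast
  show ?thesis
  proof (intro exI[of _ "4 * K"] conjI ballI)
    fix g assume g: "g \<in> G"
    obtain C where C: "\<And>t. norm (p (g ** mexp (csc t A))) \<le> C * exp (K * norm t)"
      using K(2)[OF G_invertible[OF g]] by blast
    have inG: "g ** mexp (csc t A) \<in> G" for t
      by (intro G_mult g lie_complex[OF G A])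
    have "\<exists>c. norm c \<le> 4 * K \<and>
        (\<forall>t. p (g ** mexp (csc t A)) = p (g ** mexp (csc 0 A)) * exp (c * t))"
    proof (rule entire_nonvanishing_exponential_type[OF _ _ C K(1)])
      show "(\<lambda>t. p (g ** mexp (csc t A))) holomorphic_on UNIV"
        using holomorphic_rational_mexp[OF p(1) G_invertible[OF g] invertible_mat_1] by simp
      show "p (g ** mexp (csc t A)) \<noteq> 0" for t
        using nz[OF inG] p(2)[OF inG] by simp
    qed
    then show "\<exists>c. norm c \<le> 4 * K \<and> (\<forall>t. f (g ** mexp (csc t A)) = f g * exp (c * t))"
      using p(2)[OF inG] p(2)[OF g] by simp
  qed (use K in simp)
qed

text \<open>For fixed \<open>A\<close> the ratio \<open>f (g exp A) / f g\<close> is bounded uniformly in \<open>g\<close>, so by Liouville's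
  theorem it does not change when \<open>g\<close> moves along a one-parameter group.\<close>

lemma ratio_invariant:
  assumes A: "A \<in> lie G" and B: "B \<in> lie G" and g: "g \<in> G"
  shows "f (g ** mexp B ** mexp A) / f (g ** mexp B) = f (g ** mexp A) / f g"
proof -
  obtain p where p: "p \<in> poly_funs rational_coords" "\<And>g. g \<in> G \<Longrightarrow> f g = p g"
    using regular_imp_globally_polynomial[OF G reg] unfolding rational_coords_def by blast
  obtain K where K: "\<And>g. g \<in> G \<Longrightarrow> \<exists>c. norm c \<le> K \<and> (\<forall>t. f (g ** mexp (csc t A)) = f g * exp (c * t))"
    using invertible_function_on_one_parameter_group[OF A] by blast
  have inG: "g ** mexp (csc s B) \<in> G" for s
    by (intro G_mult g lie_complex[OF G B])
  have inG': "g ** mexp (csc s B) ** mexp A \<in> G" for s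
    by (intro G_mult inG mexp_in_group A)
  define F where "F s = p (g ** mexp (csc s B) ** mexp A) / p (g ** mexp (csc s B))" for s
  have hol: "F holomorphic_on UNIV"
  proof -
    have "(\<lambda>s. p (g ** mexp (csc s B))) holomorphic_on UNIV"
      using holomorphic_rational_mexp[OF p(1) G_invertible[OF g] invertible_mat_1] by simp
    moreover have "p (g ** mexp (csc s B)) \<noteq> 0" for s using p(2)[OF inG] nz[OF inG] by simp
    ultimately show ?thesis
      unfolding F_def
      by (intro holomorphic_on_divide holomorphic_rational_mexp p G_invertible g invertible_mexp)
  qed
  have "bounded (range F)"
    unfolding bounded_iff
    proof (intro exI[of _ "exp K"] ballI)
      fix x assume "x \<in> range F"
      then obtain s where x: "x = F s" by blast
      obtain c where c: "norm c \<le> K" "\<And>t. f (g ** mexp (csc s B) ** mexp (csc t A)) = f (g ** mexp (csc s B)) * exp (c * t)"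
        using K[OF inG] by blast
      \<comment> \<open>Time 1 in the exponential formula: \<open>x = exp c\<close>, with
        \<open>c\<close> bounded independently of \<open>s\<close>.\<close>
      from c(2)[of 1] have "x = exp c"
        using nz[OF inG] p(2)[OF inG] p(2)[OF inG'] by (simp add: x F_def field_simps)
      then show "norm x \<le> exp K"
        using c(1) complex_Re_le_cmod[of c] by simp
    qed
  with hol have "F constant_on UNIV" by (rule Liouville_theorem)
  then have "F 1 = F 0" by (auto simp: constant_on_def)
  then show ?thesis
    using p(2)[OF inG[of 1]] p(2)[OF inG'[of 1]] p(2)[OF inG[of 0]] p(2)[OF inG'[of 0]]
    by (simp add: F_def)
qed

lemma mult_mexp:
  assumes A: "A \<in> lie G" and g: "g \<in> G"
  shows "f (g ** mexp A) = f g * f (mexp A)"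
proof -
  note cl = linear_algebraic_group_closed[OF G]
  \<comment> \<open>The list is reversed so that the induction peels off the rightmost factor, the
    one next to \<open>mexp A\<close>, as \<open>ratio_invariant\<close> requires.\<close>
  have "f (exp_word (rev Bs) ** mexp A) = f (exp_word (rev Bs)) * f (mexp A)" if "set Bs \<subseteq> lie G" for Bs
    using that
  proof (induction Bs)
    case (Cons B Bs)
    have w: "exp_word (rev Bs) \<in> G" "exp_word (rev Bs) ** mexp B \<in> G"
      using Cons.prems by (auto intro!: exp_word_in_group[OF cl] G_mult mexp_in_group)
    have "f (exp_word (rev Bs) ** mexp B ** mexp A) / f (exp_word (rev Bs) ** mexp B) = f (mexp A)"
      using ratio_invariant[OF A _ w(1), of B] Cons nz[OF w(1)] by simp
    then show ?case using nz[OF w(2)] by (simp add: exp_word_append field_simps)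
  qed (simp add: f1)
  moreover obtain As where "set As \<subseteq> lie G" "g = exp_word As"
    using connected_group_eq_exp_words[OF cl con g] by blast
  ultimately show ?thesis by (metis rev_rev_ident set_rev)
qed

text \<open>Rosenlicht's theorem for connected linear groups: writing \<open>h\<close> as a word
  reduces it to right factors that are single exponentials.\<close>

proposition invertible_regular_function_hom:
  assumes g: "g \<in> G" and h: "h \<in> G"
  shows "f (g ** h) = f g * f h"
proof -
  note cl = linear_algebraic_group_closed[OF G]
  have "f (g ** exp_word As) = f g * f (exp_word As)" if "set As \<subseteq> lie G" "g \<in> G" for As g
    using that
  proof (induction As arbitrary: g)
    case (Cons A As)
    then have A: "A \<in> lie G" "mexp A \<in> G" by (auto intro: mexp_in_group)
    have "f (g ** exp_word (A # As)) = f ((g ** mexp A) ** exp_word As)"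
      by (simp add: matrix_mul_assoc)
    also have "\<dots> = f (g ** mexp A) * f (exp_word As)"
      using Cons A by (intro Cons.IH) (auto intro: G_mult)
    also have "\<dots> = f g * f (mexp A) * f (exp_word As)"
      using mult_mexp A Cons.prems by simp
    also have "\<dots> = f g * f (mexp A ** exp_word As)"
      using Cons A by simp
    finally show ?case by simp
  qed (simp add: f1)
  then show ?thesis using connected_group_eq_exp_words[OF cl con h] g by blast
qed

end

section \<open>A continuous section of the character\<close>

text \<open>\<open>Arg2pi\<close> jumps at 1, but \<open>p\<close> has equal values at both ends and
  hides the jump. Continuity is read off the constant homotopy of loops, seen as a homotopy of
  circle maps.\<close>

lemma continuous_on_circle_of_loop:
  fixes p :: "real \<Rightarrow> 'a::real_normed_vector"
  assumes "continuous_on {0..1} p" "p 0 = p 1"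
  shows "continuous_on (sphere 0 1) (\<lambda>z. p (Arg2pi z / (2 * pi)))"
proof -
  have "homotopic_loops UNIV p p"
    using assms by (simp add: homotopic_loops_refl path_def pathstart_def pathfinish_def)
  from homotopic_with_imp_continuous[OF homotopic_loops_imp_homotopic_circlemaps[OF this]]
  show ?thesis by (simp add: o_def)
qed

text \<open>Scaling all exponents by \<open>r\<close> gives a path from the identity to the word;
  reversing and negating gives the path of inverses.\<close>

lemma continuous_on_exp_word:
  "continuous_on X (\<lambda>r. exp_word (map (\<lambda>B. r *\<^sub>R B) Bs))"
  "continuous_on X (\<lambda>r. exp_word (rev (map uminus (map (\<lambda>B. r *\<^sub>R B) Bs))))"
proof -
  show "continuous_on X (\<lambda>r. exp_word (map (\<lambda>B. r *\<^sub>R B) Bs))"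
    by (induction Bs) (auto intro!: continuous_intros)
  have "continuous_on X (\<lambda>r. mexp (- (r *\<^sub>R B)))" for B :: "complex^'a^'a"
    using continuous_on_mexp_scaleR[of X "\<lambda>r. - r" B] by (simp add: continuous_on_minus)
  then show "continuous_on X (\<lambda>r. exp_word (rev (map uminus (map (\<lambda>B. r *\<^sub>R B) Bs))))"
    by (induction Bs) (auto simp: exp_word_append intro!: continuous_on_matrix_mult)
qed

lemma exp_word_zero: "exp_word (map (\<lambda>B. 0 *\<^sub>R B) Bs) = mat 1"
  by (induction Bs) simp_all

lemma matrix_right_inverse_unique:
  fixes A B C :: "complex^'n^'n"
  assumes "A ** B = mat 1" "A ** C = mat 1"
  shows "B = C" "B ** A = mat 1"
proof -
  show 1: "B ** A = mat 1" using assms(1) by (simp add: matrix_left_right_inverse)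
  show "B = C" by (metis 1 assms(2) matrix_mul_assoc matrix_mul_lid matrix_mul_rid)
qed

text \<open>The passage from the Zariski to the classical topology: the global expression in entries
  and \<open>1 / det A\<close> is continuous on invertible matrices.\<close>

lemma continuous_on_regular_function:
  fixes G :: "(complex^'n^'n) set"
  assumes G: "linear_algebraic_group G" and reg: "f \<in> regular (quasi_affine entries G) G"
  shows "continuous_on G f"
proof -
  obtain p where p: "p \<in> poly_funs rational_coords" "\<And>g. g \<in> G \<Longrightarrow> f g = p g"
    using regular_imp_globally_polynomial[OF G reg] unfolding rational_coords_def by blast
  have inv: "det g \<noteq> 0" if "g \<in> G" for g
    using G that by (auto simp: linear_algebraic_group_def subgroup_GL_iff invertible_det_nz)
  have "continuous_on G p"
    using p(1)
  proof induction
    case (coord x)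
    then consider "x \<in> entries" | "x = (\<lambda>A. 1 / det A)" by (auto simp: rational_coords_def)
    then show ?case
    proof cases
      case 2
      then show ?thesis
        using inv by (auto intro!: continuous_on_divide continuous_on_const
            continuous_on_poly_funs_entries[OF det_in_poly_funs])
    qed (intro continuous_on_poly_funs_entries poly_funs.coord)
  qed (auto intro: continuous_on_add continuous_on_mult)
  then show ?thesis using p(2) continuous_on_cong by blast
qed

proposition character_section:
  fixes G :: "(complex^'n^'n) set"
  assumes G: "linear_algebraic_group G" and con: "connected G"
    and reg: "f \<in> regular (quasi_affine entries G) G"
    and nz: "\<And>g. g \<in> G \<Longrightarrow> f g \<noteq> 0" and f1: "f (mat 1) = 1"
    and nonconst: "\<exists>g\<in>G. f g \<noteq> 1" and conS: "connected {g \<in> G. f g = 1}"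
  obtains \<sigma> \<tau> where "continuous_on (UNIV - {0}) \<sigma>" "continuous_on (UNIV - {0}) \<tau>"
    "\<And>z. z \<noteq> 0 \<Longrightarrow> \<sigma> z \<in> G \<and> \<tau> z \<in> G \<and> f (\<sigma> z) = z \<and> \<sigma> z ** \<tau> z = mat 1 \<and> \<tau> z ** \<sigma> z = mat 1"
proof -
  have hom: "f (g ** h) = f g * f h" if "g \<in> G" "h \<in> G" for g h
    by (rule invertible_regular_function_hom[OF G con reg nz f1 that])
  note Gcl = linear_algebraic_group_closed[OF G]
  have Gm: "g ** h \<in> G" if "g \<in> G" "h \<in> G" for g h
    using that Gcl by (simp add: closed_linear_group_def)
  define S where "S = {g \<in> G. f g = 1}"
  have contf: "continuous_on G f" by (rule continuous_on_regular_function[OF G reg])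
  have Scl: "closed_linear_group S"
    unfolding closed_linear_group_def
  proof (intro conjI ballI)
    show "mat 1 \<in> S" using Gcl f1 by (simp add: S_def closed_linear_group_def)
    show "A ** B \<in> S" if "A \<in> S" "B \<in> S" for A B using that Gm hom by (simp add: S_def)
    show "\<exists>B\<in>S. A ** B = mat 1 \<and> B ** A = mat 1" if A: "A \<in> S" for A
    proof -
      obtain B where B: "B \<in> G" "A ** B = mat 1" "B ** A = mat 1"
        using A Gcl by (auto simp: S_def closed_linear_group_def)
      then have "f B = 1" using hom[of A B] A f1 by (simp add: S_def)
      with B show ?thesis by (auto simp: S_def)
    qed
    have "closedin (top_of_set G) S"
      unfolding S_def using continuous_closedin_preimage_constant[OF contf, of 1] by simp
    then show "closedin (top_of_set {A. invertible A}) S"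
      using Gcl unfolding closed_linear_group_def by (blast intro: closedin_trans)
  qed
  \<comment> \<open>Otherwise the multiplicative \<open>f\<close> would be 1 on every word, hence on
    all of \<open>G\<close>.\<close>
  have "\<exists>A\<in>lie G. f (mexp A) \<noteq> 1"
  proof (rule ccontr)
    assume no: "\<not> ?thesis"
    have "f (exp_word As) = 1" if "set As \<subseteq> lie G" for As
      using that
    proof (induction As)
      case (Cons A As)
      then have "f (mexp A ** exp_word As) = f (mexp A) * f (exp_word As)"
        by (intro hom mexp_in_group exp_word_in_group[OF Gcl]) auto
      with Cons no show ?case by auto
    qed (simp add: f1)
    with nonconst connected_group_eq_exp_words[OF Gcl con] show False by metis
  qed
  then obtain A where A: "A \<in> lie G" "f (mexp A) \<noteq> 1" by blast
  have one: "mat 1 \<in> G" using Gcl by (simp add: closed_linear_group_def)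
  obtain c where c: "\<And>t. f (mexp (csc t A)) = exp (c * t)"
    using invertible_function_on_one_parameter_group[OF G con reg nz f1 A(1)] one f1 by force
  have "c \<noteq> 0" using c[of 1] A(2) by auto
  \<comment> \<open>Time is divided by \<open>c\<close> so that
    \<open>f (e t) = exp t\<close>.\<close>
  define e where "e t = mexp (csc (t / c) A)" for t
  have eG: "e t \<in> G" for t unfolding e_def by (rule lie_complex[OF G A(1)])
  have fe: "f (e t) = exp t" for t using c[of "t / c"] \<open>c \<noteq> 0\<close> by (simp add: e_def)
  have eadd: "e (s + t) = e s ** e t" for s t
    by (simp add: e_def add_divide_distrib mexp_csc_add)
  have e0: "e 0 = mat 1" by (simp add: e_def)
  have einv: "e t ** e (- t) = mat 1" "e (- t) ** e t = mat 1" for t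
    using eadd[of t "- t"] eadd[of "- t" t] e0 by simp_all
  have conte: "continuous_on X (\<lambda>x. e (h x))" if "continuous_on X h" for X h
    unfolding e_def using \<open>c \<noteq> 0\<close> that by (intro continuous_intros) auto
  have "e (2 * pi * \<i>) \<in> S" using eG fe by (simp add: S_def)
  then obtain Bs where Bs: "set Bs \<subseteq> lie S" "e (2 * pi * \<i>) = exp_word Bs"
    using connected_group_eq_exp_words[OF Scl] conS unfolding S_def by blast
  define s where "s r = exp_word (map (\<lambda>B. r *\<^sub>R B) Bs)" for r
  define s' where "s' r = exp_word (rev (map uminus (map (\<lambda>B. r *\<^sub>R B) Bs)))" for r
  have ss': "s r ** s' r = mat 1" for r unfolding s_def s'_def by (rule exp_word_minus)
  have s's: "s' r ** s r = mat 1" for r by (rule matrix_right_inverse_unique(2)[OF ss' ss'])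
  have sS: "s r \<in> S" for r
    unfolding s_def using Bs(1) lie_scaleR by (intro exp_word_in_group[OF Scl]) auto
  have s'S: "s' r \<in> S" for r by (rule closed_linear_group_inverse[OF Scl sS ss'])
  have s0: "s 0 = mat 1" unfolding s_def by (rule exp_word_zero)
  have s'0: "s' 0 = mat 1" using ss'[of 0] s0 by simp
  have s1: "s 1 = e (2 * pi * \<i>)" by (simp add: s_def Bs(2)[symmetric])
  \<comment> \<open>Dividing by the path \<open>s\<close>, which runs inside \<open>S\<close> from
    the identity to \<open>e (2 * pi * \<i>)\<close>, closes the path to a loop and leaves the
    values of \<open>f\<close> alone.\<close>
  define p where "p r = e (2 * pi * r * \<i>) ** s' r" for r :: real
  define p' where "p' r = s r ** e (- (2 * pi * r * \<i>))" for r :: real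
  have pp': "p r ** p' r = mat 1" for r
  proof -
    have "p r ** p' r = e (2 * pi * r * \<i>) ** (s' r ** s r) ** e (- (2 * pi * r * \<i>))"
      by (simp add: p_def p'_def matrix_mul_assoc)
    then show ?thesis by (simp add: s's einv)
  qed
  have p'p: "p' r ** p r = mat 1" for r by (rule matrix_right_inverse_unique(2)[OF pp' pp'])
  have p01: "p 0 = p 1" using s1 ss'[of 1] s'0 e0 by (simp add: p_def)
  have p'01: "p' 0 = p' 1" using s1 s0 e0 einv by (simp add: p'_def)
  have contp: "continuous_on {0..1} p" "continuous_on {0..1} p'"
    unfolding p_def p'_def s_def s'_def
    by (intro continuous_on_matrix_mult continuous_on_exp_word conte continuous_intros)+
  define arg where "arg z = Arg2pi (z / norm z) / (2 * pi)" for z :: complex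
  have circ: "continuous_on (UNIV - {0}) (\<lambda>z. h (arg z))"
    if h: "continuous_on {0..1} h" "h 0 = h 1" for h :: "real \<Rightarrow> complex^'n^'n"
  proof -
    have "continuous_on (UNIV - {0}) (\<lambda>z::complex. z / norm z)"
      by (intro continuous_intros) auto
    moreover have "(\<lambda>z::complex. z / norm z) ` (UNIV - {0}) \<subseteq> sphere 0 1"
      by (auto simp: norm_divide split: if_splits)
    ultimately show ?thesis
      unfolding arg_def by (rule continuous_on_compose2[OF continuous_on_circle_of_loop[OF h]])
  qed
  \<comment> \<open>Polar coordinates: \<open>e\<close> lifts the modulus and the loop
    \<open>p\<close> lifts the argument. The inverse \<open>\<tau>\<close> is carried along
    explicitly, so that its continuity is proved in the same way.\<close>
  define \<sigma> where "\<sigma> z = e (of_real (ln (norm z))) ** p (arg z)" for z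
  define \<tau> where "\<tau> z = p' (arg z) ** e (- of_real (ln (norm z)))" for z
  show thesis
  proof (rule that[of \<sigma> \<tau>])
    show "continuous_on (UNIV - {0}) \<sigma>" "continuous_on (UNIV - {0}) \<tau>"
      unfolding \<sigma>_def \<tau>_def
      by (intro continuous_on_matrix_mult circ contp p01 p'01 conte continuous_intros; simp)+
    fix z :: complex assume z: "z \<noteq> 0"
    have st: "\<sigma> z ** \<tau> z = mat 1"
    proof -
      have "\<sigma> z ** \<tau> z = e (of_real (ln (norm z))) ** (p (arg z) ** p' (arg z)) ** e (- of_real (ln (norm z)))"
        by (simp add: \<sigma>_def \<tau>_def matrix_mul_assoc)
      then show ?thesis by (simp add: pp' einv)
    qed
    have SG: "s r \<in> G" "s' r \<in> G" "f (s' r) = 1" for r using sS s'S by (auto simp: S_def)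
    have pG: "p r \<in> G" "p' r \<in> G" for r by (auto simp: p_def p'_def intro!: Gm eG SG)
    have fp: "f (p r) = exp (2 * pi * r * \<i>)" for r
      unfolding p_def hom[OF eG SG(2)] fe SG(3) by simp
    have "f (\<sigma> z) = of_real (norm z) * exp (\<i> * of_real (Arg2pi (z / norm z)))"
      unfolding \<sigma>_def hom[OF eG pG(1)] fe fp
      using z by (simp add: arg_def exp_of_real mult.commute)
    also have "exp (\<i> * of_real (Arg2pi (z / norm z))) = z / norm z"
    proof -
      have "norm (z / norm z) = 1" using z by (simp add: norm_divide)
      then show ?thesis using Arg2pi_eq[of "z / norm z"] by (metis mult_1 of_real_1)
    qed
    finally have "f (\<sigma> z) = z" using z by simp
    moreover have "\<sigma> z \<in> G" "\<tau> z \<in> G" by (auto simp: \<sigma>_def \<tau>_def intro!: Gm eG pG)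
    ultimately show "\<sigma> z \<in> G \<and> \<tau> z \<in> G \<and> f (\<sigma> z) = z \<and> \<sigma> z ** \<tau> z = mat 1 \<and> \<tau> z ** \<sigma> z = mat 1"
      using st matrix_right_inverse_unique(2)[OF st st] by simp
  qed
qed

section \<open>Splitting the homogeneous space\<close>

lemma coset_proj_eq: "coset_proj H g = (\<lambda>h. g ** h) ` H"
  by (auto simp: coset_proj_def l_coset_def GL_def)

lemma coset_proj_translate: "(\<lambda>x. a ** x) ` coset_proj H g = coset_proj H (a ** g)"
  by (simp add: coset_proj_eq image_image matrix_mul_assoc)

lemma topspace_homogeneous_space': "topspace (homogeneous_space G H) = coset_proj H ` G"
  by (simp add: homogeneous_space_def)

lemma quotient_map_coset_proj: "quotient_map (top_of_set G) (homogeneous_space G H) (coset_proj H)"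
  unfolding homogeneous_space_def by (rule quotient_map_quotient_topology)

text \<open>Multiplying a quotient map by the identity of a locally compact Hausdorff space gives a
  quotient map again; this is where both properties are wanted.\<close>

lemma locally_compact_Cstar_space: "locally_compact_space Cstar_space" "Hausdorff_space Cstar_space"
  unfolding Cstar_space_def
  by (auto intro!: locally_compact_space_open_subset Hausdorff_space_subtopology
      simp: locally_compact_space_euclidean)

text \<open>The section translates the fibre over 1 to the fibre over \<open>z\<close>. Both maps
  are defined on cosets as sets, and their continuity is checked before passing to cosets, through
  quotient maps.\<close>

lemma homogeneous_space_splits:
  fixes G H S :: "(complex^'n^'n) set" and f :: "complex^'n^'n \<Rightarrow> complex"
    and \<sigma> \<tau> :: "complex \<Rightarrow> complex^'n^'n"
  assumes one: "mat 1 \<in> S" and G: "\<And>g h. g \<in> G \<Longrightarrow> h \<in> G \<Longrightarrow> g ** h \<in> G"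
    and hom: "\<And>g h. g \<in> G \<Longrightarrow> h \<in> G \<Longrightarrow> f (g ** h) = f g * f h"
    and nz: "\<And>g. g \<in> G \<Longrightarrow> f g \<noteq> 0" and contf: "continuous_on G f"
    and S_eq: "S = {g \<in> G. f g = 1}" and X: "\<And>g. g \<in> G \<Longrightarrow> X (coset_proj H g) = f g"
    and \<sigma>: "continuous_on (UNIV - {0}) \<sigma>" "continuous_on (UNIV - {0}) \<tau>"
      "\<And>z. z \<noteq> 0 \<Longrightarrow> \<sigma> z \<in> G \<and> \<tau> z \<in> G \<and> f (\<sigma> z) = z \<and> \<sigma> z ** \<tau> z = mat 1 \<and> \<tau> z ** \<sigma> z = mat 1"
  shows "homogeneous_space G H homeomorphic_space prod_topology (homogeneous_space S H) Cstar_space"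
proof -
  let ?\<pi> = "coset_proj H"
  define \<Phi> :: "(complex^'n^'n) set \<times> complex \<Rightarrow> (complex^'n^'n) set"
    where "\<Phi> = (\<lambda>(C, z). (\<lambda>x. \<sigma> z ** x) ` C)"
  define \<Psi> where "\<Psi> D = ((\<lambda>x. \<tau> (X D) ** x) ` D, X D)" for D :: "(complex^'n^'n) set"
  have \<Phi>\<pi>: "\<Phi> (?\<pi> s, z) = ?\<pi> (\<sigma> z ** s)" for s z by (simp add: \<Phi>_def coset_proj_translate)
  have \<Psi>\<pi>: "\<Psi> (?\<pi> g) = (?\<pi> (\<tau> (f g) ** g), f g)" if "g \<in> G" for g
    by (simp add: \<Psi>_def coset_proj_translate X[OF that])
  have f1: "f (mat 1) = 1" using one by (simp add: S_eq)
  have f\<tau>: "f (\<tau> z) * z = 1" if "z \<noteq> 0" for z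
    using hom[of "\<tau> z" "\<sigma> z"] \<sigma>(3)[OF that] f1 by simp
  \<comment> \<open>Translation by \<open>\<tau> (f g)\<close> cancels the value of the character
    and moves \<open>g\<close> into the fibre over 1.\<close>
  have inS: "\<tau> (f g) ** g \<in> S" if "g \<in> G" for g
    using that G hom \<sigma>(3)[OF nz[OF that]] f\<tau>[OF nz[OF that]] by (simp add: S_eq)
  have "continuous_map (homogeneous_space G H) (prod_topology (homogeneous_space S H) Cstar_space) \<Psi>"
  proof (rule continuous_compose_quotient_map[OF quotient_map_coset_proj])
    have "continuous_on G (\<lambda>g. \<tau> (f g) ** g)"
      using nz by (intro continuous_on_matrix_mult continuous_on_id continuous_on_compose2[OF \<sigma>(2) contf]) auto
    then have "continuous_map (top_of_set G) (top_of_set S) (\<lambda>g. \<tau> (f g) ** g)"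
      using inS by (auto simp: continuous_map_in_subtopology)
    from continuous_map_compose[OF this quotient_imp_continuous_map[OF quotient_map_coset_proj]]
    have "continuous_map (top_of_set G) (homogeneous_space S H) (\<lambda>g. ?\<pi> (\<tau> (f g) ** g))"
      by (simp add: o_def)
    moreover have "continuous_map (top_of_set G) Cstar_space f"
      using contf nz by (auto simp: Cstar_space_def continuous_map_in_subtopology)
    ultimately have "continuous_map (top_of_set G) (prod_topology (homogeneous_space S H) Cstar_space)
      (\<lambda>g. (?\<pi> (\<tau> (f g) ** g), f g))"
      by (rule continuous_map_pairedI)
    then show "continuous_map (top_of_set G) (prod_topology (homogeneous_space S H) Cstar_space) (\<Psi> \<circ> ?\<pi>)"
      by (rule continuous_map_eq) (simp add: \<Psi>\<pi>)
  qed
  moreover have "continuous_map (prod_topology (homogeneous_space S H) Cstar_space) (homogeneous_space G H) \<Phi>"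
  proof (rule continuous_compose_quotient_map)
    \<comment> \<open>A product of quotient maps need not be one; local compactness of the second
      factor makes it so here.\<close>
    show "quotient_map (prod_topology (top_of_set S) Cstar_space)
        (prod_topology (homogeneous_space S H) Cstar_space) (\<lambda>(s, z). (?\<pi> s, z))"
      by (intro quotient_map_prod_left quotient_map_coset_proj disjI1 locally_compact_Cstar_space)
    have "continuous_on (S \<times> (UNIV - {0})) (\<lambda>x. \<sigma> (snd x) ** fst x)"
      by (intro continuous_on_matrix_mult continuous_on_compose2[OF \<sigma>(1)] continuous_intros) auto
    moreover have "\<forall>s\<in>S. \<forall>z. z \<noteq> 0 \<longrightarrow> \<sigma> z ** s \<in> G"
      using \<sigma>(3) G by (simp add: S_eq)
    ultimately have "continuous_map (prod_topology (top_of_set S) Cstar_space) (top_of_set G) (\<lambda>x. \<sigma> (snd x) ** fst x)"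
      unfolding Cstar_space_def prod_topology_subtopology_eu
      by (auto simp: continuous_map_in_subtopology) metis
    from continuous_map_compose[OF this quotient_imp_continuous_map[OF quotient_map_coset_proj]]
    show "continuous_map (prod_topology (top_of_set S) Cstar_space) (homogeneous_space G H)
       (\<Phi> \<circ> (\<lambda>(s, z). (?\<pi> s, z)))"
      by (rule continuous_map_eq) (auto simp: \<Phi>\<pi>)
  qed
  moreover have "\<Phi> (\<Psi> D) = D" if D: "D \<in> topspace (homogeneous_space G H)" for D
  proof -
    obtain g where g: "g \<in> G" "D = ?\<pi> g" using D by (auto simp: topspace_homogeneous_space')
    have "\<sigma> (f g) ** (\<tau> (f g) ** g) = g"
      using \<sigma>(3)[OF nz[OF g(1)]] by (simp add: matrix_mul_assoc)
    then show ?thesis unfolding g(2) \<Psi>\<pi>[OF g(1)] \<Phi>\<pi> by simp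
  qed
  moreover have "\<Psi> (\<Phi> (C, z)) = (C, z)" if C: "C \<in> topspace (homogeneous_space S H)" "z \<noteq> 0" for C z
  proof -
    obtain s where s: "s \<in> S" "C = ?\<pi> s" using C by (auto simp: topspace_homogeneous_space')
    have sG: "s \<in> G" "f s = 1" using s(1) by (auto simp: S_eq)
    have "f (\<sigma> z ** s) = z" using hom \<sigma>(3)[OF C(2)] sG by simp
    moreover have "\<tau> z ** (\<sigma> z ** s) = s"
      using \<sigma>(3)[OF C(2)] by (simp add: matrix_mul_assoc)
    moreover have "\<sigma> z ** s \<in> G" using G \<sigma>(3)[OF C(2)] sG by simp
    ultimately show ?thesis unfolding s(2) \<Phi>\<pi> by (simp add: \<Psi>\<pi>)
  qed
  ultimately have "homeomorphic_maps (homogeneous_space G H)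
      (prod_topology (homogeneous_space S H) Cstar_space) \<Psi> \<Phi>"
    by (auto simp: homeomorphic_maps_def Cstar_space_def)
  then show ?thesis unfolding homeomorphic_space_def by blast
qed

section \<open>Homology of a product with the punctured plane\<close>

text \<open>All homotopies below move the plane factor only, where any two maps into a contractible
  set are homotopic.\<close>

lemma homotopic_prod_into_contractible:
  fixes A B :: "complex set"
  assumes "contractible A" "continuous_on B f" "continuous_on B g" "f ` B \<subseteq> A" "g ` B \<subseteq> A"
  shows "homotopic_with (\<lambda>h. True) (prod_topology X (top_of_set B)) (prod_topology X (top_of_set A))
     (\<lambda>z. (fst z, f (snd z))) (\<lambda>z. (fst z, g (snd z)))"
proof -
  have "homotopic_with_canon (\<lambda>h. True) B A f g"
    using assms by (intro homotopic_into_contractible) auto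
  then show ?thesis
    by (rule homotopic_with_prod_topology[of "\<lambda>_. True" X X id id, simplified])
qed

lemma prod_complex_subtopology:
  "subtopology (prod_topology X (top_of_set B)) (topspace X \<times> A) = prod_topology X (top_of_set (B \<inter> A))"
  by (simp add: prod_topology_subtopology subtopology_subtopology Times_Int_Times)

lemma trivial_homology_contractible_pair:
  fixes A B :: "complex set"
  assumes "contractible A" "contractible B" "A \<subseteq> B" "A \<noteq> {}"
  shows "trivial_group (relative_homology_group p (prod_topology X (top_of_set B)) (topspace X \<times> A))"
proof -
  obtain a where a: "a \<in> A" using assms(4) by blast
  let ?f = "\<lambda>z. (fst z, a)"
  have sub: "subtopology (prod_topology X (top_of_set B)) (topspace X \<times> A) = prod_topology X (top_of_set A)"
    using assms(3) by (simp add: prod_complex_subtopology Int_absorb1)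
  have id: "id = (\<lambda>z. (fst z, snd z))" by auto
  show ?thesis
  proof (rule trivial_relative_homology_group_gen[where f = ?f])
    show "continuous_map (prod_topology X (top_of_set B))
       (subtopology (prod_topology X (top_of_set B)) (topspace X \<times> A)) ?f"
      unfolding sub using a by (intro continuous_map_pairedI continuous_map_fst) auto
    show "homotopic_with (\<lambda>h. True) (subtopology (prod_topology X (top_of_set B)) (topspace X \<times> A))
       (subtopology (prod_topology X (top_of_set B)) (topspace X \<times> A)) ?f id"
      unfolding sub id using assms a by (intro homotopic_prod_into_contractible) auto
    show "homotopic_with (\<lambda>k. True) (prod_topology X (top_of_set B)) (prod_topology X (top_of_set B)) ?f id"
      unfolding id using assms a by (intro homotopic_prod_into_contractible) auto
  qed
qed

lemma iso_by_trivial_neighbours: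
  assumes "exact_seq ([C,B,A], [g,f])" "exact_seq ([D,C,B], [h,g])" "trivial_group A" "trivial_group D"
  shows "g \<in> iso B C"
  by (rule very_short_exact_sequence[of D C B A h g f]) (use assms in auto)

text \<open>In the long exact sequence of the triple, the groups of the pair \<open>S\<close>,
  \<open>T\<close> stand on both sides of the map induced by inclusion.\<close>

lemma homology_triple_subspace_iso:
  assumes T: "T \<subseteq> S"
    and "trivial_group (relative_homology_group p (subtopology X S) T)"
    and "trivial_group (relative_homology_group (p - 1) (subtopology X S) T)"
  shows "relative_homology_group p X T \<cong> relative_homology_group p X S"
  by (rule is_isoI)
     (rule iso_by_trivial_neighbours[OF homology_exactness_triple_3[OF T] homology_exactness_triple_1[OF T] assms(2,3)])

text \<open>The same sequence with the groups of \<open>X\<close>, \<open>T\<close> as outer terms,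
  so that now the connecting map is the isomorphism.\<close>

lemma homology_triple_boundary_iso:
  assumes T: "T \<subseteq> S"
    and "trivial_group (relative_homology_group p X T)"
    and "trivial_group (relative_homology_group (p - 1) X T)"
  shows "relative_homology_group p X S \<cong> relative_homology_group (p - 1) (subtopology X S) T"
  by (rule is_isoI)
     (rule iso_by_trivial_neighbours[OF homology_exactness_triple_1[OF T] homology_exactness_triple_2[OF T] assms(2,3)])

lemma homology_prod_contractible:
  fixes A :: "complex set"
  assumes "contractible A" "A \<noteq> {}"
  shows "homology_group p (prod_topology X (top_of_set A)) \<cong> homology_group p X"
proof (rule homotopy_equivalent_space_imp_isomorphic_homology_groups)
  obtain a where a: "a \<in> A" using assms(2) by blast
  have "homotopic_with (\<lambda>h. True) (prod_topology X (top_of_set A)) (prod_topology X (top_of_set A))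
     (\<lambda>z. (fst z, a)) (\<lambda>z. (fst z, snd z))"
    using assms a by (intro homotopic_prod_into_contractible) auto
  then have "homotopic_with (\<lambda>h. True) (prod_topology X (top_of_set A)) (prod_topology X (top_of_set A))
     ((\<lambda>x. (x, a)) \<circ> fst) id"
    by (simp add: o_def id_def)
  moreover have "continuous_map X (prod_topology X (top_of_set A)) (\<lambda>x. (x, a))"
    using a by (intro continuous_map_pairedI) auto
  ultimately show "prod_topology X (top_of_set A) homotopy_equivalent_space X"
    unfolding homotopy_equivalent_space_def
    by (intro exI[of _ fst] exI[of _ "\<lambda>x. (x, a)"]) (auto simp: continuous_map_fst o_def id_def)
qed

lemma excision_iso:
  assumes "X closure_of U \<subseteq> X interior_of T" "T \<subseteq> topspace X"
  shows "relative_homology_group p X T \<cong> relative_homology_group p (subtopology X (topspace X - U)) (T - U)"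
  using homology_excision_axiom[OF assms, of p]
  by (simp add: group.iso_sym is_isoI)

definition slit_left :: "complex set" where "slit_left = - (complex_of_real ` {..0})"
definition slit_right :: "complex set" where "slit_right = - (complex_of_real ` {0..})"
definition upper_half :: "complex set" where "upper_half = {z. Im z > 0}"
definition lower_half :: "complex set" where "lower_half = {z. Im z < 0}"

lemma contractible_slits:
  "contractible slit_left" "contractible slit_right" "contractible upper_half" "contractible lower_half"
  unfolding slit_left_def slit_right_def upper_half_def lower_half_def
  by (intro starlike_imp_contractible starlike_slotted_complex_plane_left
      starlike_slotted_complex_plane_right convex_imp_contractible convex_halfspace_Im_gt
      convex_halfspace_Im_lt)+

text \<open>Cutting the positive axis out of the pair of \<open>\<complex>\<^sup>*\<close> and the left slit plane leaves the right
  slit plane modulo two half planes, and excising the upper one shifts the degree.\<close>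

proposition homology_prod_Cstar:
  "homology_group p (prod_topology X Cstar_space) \<cong> homology_group p X \<times>\<times> homology_group (p - 1) X"
proof -
  let ?P = "\<lambda>A::complex set. prod_topology X (top_of_set A)"
  let ?X = "\<lambda>A::complex set. topspace X \<times> A"
  have E: "prod_topology X Cstar_space = ?P (UNIV - {0})" by (simp add: Cstar_space_def)
  let ?E = "?P (UNIV - {0})"
  have sub: "subtopology (?P B) (?X A) = ?P A" if "A \<subseteq> B" for A B
    using that by (simp add: prod_complex_subtopology Int_absorb1)
  have [simp]: "0 \<notin> slit_left" "1 \<in> slit_left" by (auto simp: slit_left_def complex_eq_iff)
  have halves: "slit_left \<inter> slit_right = upper_half \<union> lower_half"
    by (auto simp: slit_left_def slit_right_def upper_half_def lower_half_def image_iff complex_eq_iff)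
  \<comment> \<open>The slice over 1 is a retract and splits its homology off; what remains is the
    relative group, to be identified with the homology of \<open>X\<close> one degree lower.\<close>
  have "?X {1} retract_of_space ?E"
    unfolding retract_of_space_def sub[of "{1}" "UNIV - {0}", simplified]
    by (intro conjI exI[of _ "\<lambda>z. (fst z, 1)"] continuous_map_pairedI continuous_map_fst) auto
  then have 1: "homology_group p ?E \<cong> homology_group p (subtopology ?E (?X {1})) \<times>\<times> relative_homology_group p ?E (?X {1})"
    by (intro isomorphic_group_homology_group_prod_retract) simp
  have 2: "homology_group p (subtopology ?E (?X {1})) \<cong> homology_group p X"
    unfolding sub[of "{1}" "UNIV - {0}", simplified]
    by (rule homology_prod_contractible) auto
  \<comment> \<open>The point 1 is thickened to the left slit plane, an open set in which excision
    can take place; the pair they form has no homology.\<close>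
  have "relative_homology_group p ?E (?X {1}) \<cong> relative_homology_group p ?E (?X slit_left)"
  proof (rule homology_triple_subspace_iso)
    have "subtopology ?E (?X slit_left) = ?P slit_left" by (rule sub) auto
    moreover have "trivial_group (relative_homology_group q (?P slit_left) (?X {1}))" for q
      by (rule trivial_homology_contractible_pair) (auto simp: contractible_slits)
    ultimately show "trivial_group (relative_homology_group p (subtopology ?E (?X slit_left)) (?X {1}))"
      "trivial_group (relative_homology_group (p - 1) (subtopology ?E (?X slit_left)) (?X {1}))" by simp_all
  qed auto
  also have "\<dots> \<cong> relative_homology_group p (?P slit_right) (?X (upper_half \<union> lower_half))"
  proof -
    \<comment> \<open>The open positive axis is closed in the punctured plane and contained in the
      open left slit plane, as excision asks.\<close>
    let ?K = "?X (complex_of_real ` {0<..})"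
    have K: "complex_of_real ` {0<..} = (UNIV - {0}) \<inter> complex_of_real ` {0..}" by auto
    have cl: "closed (complex_of_real ` {0..})" "closed (complex_of_real ` {..0})"
      by (auto intro!: closed_injective_linear_image simp: inj_def)
    have "closedin ?E ?K"
      unfolding closedin_prod_Times_iff K using closedin_closed_Int[OF cl(1), of "UNIV - {0}"] by simp
    moreover have "openin ?E (?X slit_left)"
    proof -
      have "openin (top_of_set (UNIV - {0})) ((UNIV - {0}) \<inter> slit_left)"
        using cl(2) by (intro openin_open_Int) (simp add: slit_left_def open_Compl)
      moreover have "(UNIV - {0}) \<inter> slit_left = slit_left" by auto
      ultimately show ?thesis by (simp add: openin_prod_Times_iff)
    qed
    moreover have "?K \<subseteq> ?X slit_left" by (auto simp: slit_left_def)
    ultimately have "?E closure_of ?K \<subseteq> ?E interior_of (?X slit_left)"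
      by (simp add: closure_of_closedin interior_of_openin)
    then have "relative_homology_group p ?E (?X slit_left)
      \<cong> relative_homology_group p (subtopology ?E (topspace ?E - ?K)) (?X slit_left - ?K)"
      by (rule excision_iso) auto
    moreover have "topspace ?E - ?K = ?X slit_right"
      by (auto simp: slit_right_def image_iff less_le)
    moreover have "subtopology ?E (?X slit_right) = ?P slit_right"
      by (rule sub) (auto simp: slit_right_def)
    moreover have "?X slit_left - ?K = ?X (upper_half \<union> lower_half)"
      unfolding halves[symmetric] by (auto simp: slit_left_def slit_right_def image_iff less_le)
    ultimately show ?thesis by simp
  qed
  \<comment> \<open>The pair of the right slit plane and the upper half plane has no homology, so
    the connecting map of the triple is an isomorphism; it is the step that lowers the
    degree.\<close>
  also have "\<dots> \<cong> relative_homology_group (p - 1) (?P (upper_half \<union> lower_half)) (?X upper_half)"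
  proof -
    have up: "\<i> \<in> upper_half" by (simp add: upper_half_def)
    have le: "upper_half \<union> lower_half \<subseteq> slit_right" using halves by blast
    have "trivial_group (relative_homology_group q (?P slit_right) (?X upper_half))" for q
      by (rule trivial_homology_contractible_pair) (use le up in \<open>auto simp: contractible_slits\<close>)
    then have "relative_homology_group p (?P slit_right) (?X (upper_half \<union> lower_half))
       \<cong> relative_homology_group (p - 1) (subtopology (?P slit_right) (?X (upper_half \<union> lower_half))) (?X upper_half)"
      by (intro homology_triple_boundary_iso) auto
    then show ?thesis using sub[OF le] by simp
  qed
  \<comment> \<open>The half planes are disjoint and both open and closed in their union, so the
    upper one can be excised from itself; the lower one remains, relative to nothing.\<close>
  also have "\<dots> \<cong> homology_group (p - 1) (?P lower_half)"
  proof -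
    let ?H = "?P (upper_half \<union> lower_half)"
    have ops: "open upper_half" "open lower_half"
      by (auto simp: upper_half_def lower_half_def open_halfspace_Im_gt open_halfspace_Im_lt)
    have op: "openin ?H (?X upper_half)" "openin ?H (?X lower_half)"
      unfolding openin_prod_Times_iff using ops by (auto simp: openin_open_eq open_Un)
    have d: "topspace ?H - ?X upper_half = ?X lower_half"
      by (auto simp: upper_half_def lower_half_def)
    have d': "topspace ?H - ?X lower_half = ?X upper_half"
      by (auto simp: upper_half_def lower_half_def)
    have "closedin ?H (?X upper_half)"
      using openin_closedin_eq[of ?H "?X lower_half"] op(2) d' by simp
    then have "?H closure_of (?X upper_half) \<subseteq> ?H interior_of (?X upper_half)"
      using op(1) by (simp add: closure_of_closedin interior_of_openin)
    then have "relative_homology_group (p - 1) ?H (?X upper_half)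
      \<cong> relative_homology_group (p - 1) (subtopology ?H (topspace ?H - ?X upper_half)) (?X upper_half - ?X upper_half)"
      by (rule excision_iso) auto
    then show ?thesis unfolding d using sub[of lower_half "upper_half \<union> lower_half"] by simp
  qed
  also have "\<dots> \<cong> homology_group (p - 1) X"
  proof -
    have "- \<i> \<in> lower_half" by (simp add: lower_half_def)
    then show ?thesis by (intro homology_prod_contractible contractible_slits) auto
  qed
  finally have 3: "relative_homology_group p ?E (?X {1}) \<cong> homology_group (p - 1) X" .
  show ?thesis
    unfolding E
    by (rule iso_trans[OF 1 group.DirProd_iso_trans[OF _ 2 3]]) auto
qed

hide_const (open) Polynomial.smult Multiset.mult

section \<open>Cohomology as the dual of homology\<close>

lemma rat_field_simps [simp]:
  "carrier rat_field = UNIV" "x \<otimes>\<^bsub>rat_field\<^esub> y = x * y" "\<one>\<^bsub>rat_field\<^esub> = 1"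
  "\<zero>\<^bsub>rat_field\<^esub> = 0" "x \<oplus>\<^bsub>rat_field\<^esub> y = x + y"
  by (simp_all add: rat_field_def)

text \<open>The dual over the rationals of a multiplicatively written group, in the same extensional
  encoding as cochains, so that cochain modules are instances of it.\<close>

definition hom_module :: "('a, 'm) monoid_scheme \<Rightarrow> (rat, 'a \<Rightarrow> rat) module" where
  "hom_module A =
    \<lparr>carrier = {\<phi> \<in> extensional (carrier A).
        \<forall>x\<in>carrier A. \<forall>y\<in>carrier A. \<phi> (x \<otimes>\<^bsub>A\<^esub> y) = \<phi> x + \<phi> y},
     mult = undefined, one = undefined,
     zero = (\<lambda>c\<in>carrier A. 0), add = (\<lambda>\<phi> \<psi>. \<lambda>c\<in>carrier A. \<phi> c + \<psi> c),
     smult = (\<lambda>r \<phi>. \<lambda>c\<in>carrier A. r * \<phi> c)\<rparr>"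

lemma cochain_module_eq_hom_module: "cochain_module p X = hom_module (chain_group p X)"
  by (auto simp: cochain_module_def hom_module_def hom_def)

lemma abelian_group_pointwise:
  fixes M :: "(rat, 'a \<Rightarrow> rat) module"
  assumes car: "carrier M \<subseteq> extensional D"
    and zero: "\<zero>\<^bsub>M\<^esub> = (\<lambda>c\<in>D. 0)" "\<zero>\<^bsub>M\<^esub> \<in> carrier M"
    and add: "\<And>x y. x \<oplus>\<^bsub>M\<^esub> y = (\<lambda>c\<in>D. x c + y c)"
      "\<And>x y. x \<in> carrier M \<Longrightarrow> y \<in> carrier M \<Longrightarrow> x \<oplus>\<^bsub>M\<^esub> y \<in> carrier M"
    and minus: "\<And>x. x \<in> carrier M \<Longrightarrow> (\<lambda>c\<in>D. - x c) \<in> carrier M"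
  shows "abelian_group M"
proof (rule abelian_groupI)
  fix x assume x: "x \<in> carrier M"
  show "\<exists>y\<in>carrier M. y \<oplus>\<^bsub>M\<^esub> x = \<zero>\<^bsub>M\<^esub>"
    by (intro bexI[OF _ minus[OF x]]) (auto simp: add zero)
  show "\<zero>\<^bsub>M\<^esub> \<oplus>\<^bsub>M\<^esub> x = x"
    using x car by (auto simp: add zero fun_eq_iff extensional_def subset_iff)
qed (use add zero in \<open>auto simp: fun_eq_iff add.assoc add.commute\<close>)

lemma abelian_group_hom_module:
  assumes "group A" shows "abelian_group (hom_module A)"
  by (rule abelian_group_pointwise[where D = "carrier A"])
     (use monoid.m_closed[OF group.is_monoid[OF assms]] in \<open>auto simp: hom_module_def\<close>)

text \<open>\<open>module_isomorphic\<close> constrains a bijection on elements of the carrier only.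
  To invert it, sums and multiples must stay in the carrier, and this is what is recorded
  here.\<close>

definition module_closed :: "('r, 'k) ring_scheme \<Rightarrow> ('r, 'a, 'm) module_scheme \<Rightarrow> bool" where
  "module_closed R M \<longleftrightarrow>
    (\<forall>x\<in>carrier M. \<forall>y\<in>carrier M. x \<oplus>\<^bsub>M\<^esub> y \<in> carrier M) \<and>
    (\<forall>r\<in>carrier R. \<forall>x\<in>carrier M. r \<odot>\<^bsub>M\<^esub> x \<in> carrier M)"

lemma coset_eq_fibre:
  assumes M: "abelian_group M" and T: "abelian_group T"
    and L: "\<And>x. x \<in> carrier M \<Longrightarrow> L x \<in> carrier T"
      "\<And>x y. x \<in> carrier M \<Longrightarrow> y \<in> carrier M \<Longrightarrow> L (x \<oplus>\<^bsub>M\<^esub> y) = L x \<oplus>\<^bsub>T\<^esub> L y"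
    and ker: "N = {x \<in> carrier M. L x = \<zero>\<^bsub>T\<^esub>}" and x: "x \<in> carrier M"
  shows "N +>\<^bsub>M\<^esub> x = {y \<in> carrier M. L y = L x}"
proof -
  interpret M: abelian_group M by (rule M)
  interpret T: abelian_group T by (rule T)
  show ?thesis
  proof
    show "N +>\<^bsub>M\<^esub> x \<subseteq> {y \<in> carrier M. L y = L x}"
    proof
      fix y assume "y \<in> N +>\<^bsub>M\<^esub> x"
      then obtain n where n: "n \<in> carrier M" "L n = \<zero>\<^bsub>T\<^esub>" "y = n \<oplus>\<^bsub>M\<^esub> x"
        unfolding a_r_coset_def' ker by blast
      then have "L y = L x" using L(1)[OF x] L(2)[OF n(1) x] T.l_zero by simp
      then show "y \<in> {y \<in> carrier M. L y = L x}" using n x M.a_closed by simp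
    qed
    show "{y \<in> carrier M. L y = L x} \<subseteq> N +>\<^bsub>M\<^esub> x"
    proof
      fix y assume y: "y \<in> {y \<in> carrier M. L y = L x}"
      define n where "n = y \<oplus>\<^bsub>M\<^esub> (\<ominus>\<^bsub>M\<^esub> x)"
      have n: "n \<in> carrier M" "n \<oplus>\<^bsub>M\<^esub> x = y"
        using x y by (auto simp: n_def M.a_assoc M.l_neg)
      then have "L n \<oplus>\<^bsub>T\<^esub> L x = L x" using L(2)[of n x] x y by simp
      then have "L n \<oplus>\<^bsub>T\<^esub> L x \<oplus>\<^bsub>T\<^esub> (\<ominus>\<^bsub>T\<^esub> L x) = L x \<oplus>\<^bsub>T\<^esub> (\<ominus>\<^bsub>T\<^esub> L x)" by simp
      then have "L n = \<zero>\<^bsub>T\<^esub>"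
        using L(1)[OF n(1)] L(1)[OF x] T.a_inv_closed[OF L(1)[OF x]]
        by (simp only: T.a_assoc T.r_neg T.r_zero)
      with n show "y \<in> N +>\<^bsub>M\<^esub> x" unfolding a_r_coset_def' ker by blast
    qed
  qed
qed

text \<open>The first isomorphism theorem, stated for a given \<open>L\<close> so that it serves
  both cohomology and tensor products.\<close>

lemma quotient_module_isomorphic:
  assumes M: "abelian_group M" and T: "abelian_group T"
    and L: "\<And>x. x \<in> carrier M \<Longrightarrow> L x \<in> carrier T"
      "\<And>x y. x \<in> carrier M \<Longrightarrow> y \<in> carrier M \<Longrightarrow> L (x \<oplus>\<^bsub>M\<^esub> y) = L x \<oplus>\<^bsub>T\<^esub> L y"
      "\<And>r x. r \<in> carrier R \<Longrightarrow> x \<in> carrier M \<Longrightarrow> L (r \<odot>\<^bsub>M\<^esub> x) = r \<odot>\<^bsub>T\<^esub> L x"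
    and surj: "\<And>y. y \<in> carrier T \<Longrightarrow> \<exists>x\<in>carrier M. L x = y"
    and ker: "N = {x \<in> carrier M. L x = \<zero>\<^bsub>T\<^esub>}"
    and smult: "\<And>r x. r \<in> carrier R \<Longrightarrow> x \<in> carrier M \<Longrightarrow> r \<odot>\<^bsub>M\<^esub> x \<in> carrier M"
  shows "module_isomorphic R (quotient_module M N) T"
proof -
  interpret M: abelian_group M by (rule M)
  interpret T: abelian_group T by (rule T)
  have coset: "N +>\<^bsub>M\<^esub> x = {y \<in> carrier M. L y = L x}" if "x \<in> carrier M" for x
    using coset_eq_fibre[OF M T L(1,2) ker that] .
  define f where "f A = L (SOME a. a \<in> A)" for A
  have f: "f A = u" if "A \<noteq> {}" "\<And>a. a \<in> A \<Longrightarrow> L a = u" for A u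
    unfolding f_def using that(2)[of "SOME a. a \<in> A"] that(1) by (simp add: some_in_eq)
  have fc: "f (N +>\<^bsub>M\<^esub> x) = L x" if "x \<in> carrier M" for x
    by (rule f) (use that coset[OF that] in auto)
  have car: "carrier (quotient_module M N) = (\<lambda>x. N +>\<^bsub>M\<^esub> x) ` carrier M"
    unfolding quotient_module_def A_RCOSETS_def' by auto
  show ?thesis
    unfolding module_isomorphic_def
  proof (intro exI[of _ f] conjI ballI)
    show "bij_betw f (carrier (quotient_module M N)) (carrier T)"
      unfolding bij_betw_def
    proof
      show "inj_on f (carrier (quotient_module M N))"
      proof (rule inj_onI)
        fix A B assume "A \<in> carrier (quotient_module M N)" "B \<in> carrier (quotient_module M N)"
          and eq: "f A = f B"
        then obtain x y where xy: "x \<in> carrier M" "A = N +>\<^bsub>M\<^esub> x" "y \<in> carrier M" "B = N +>\<^bsub>M\<^esub> y"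
          unfolding car by blast
        then have "L x = L y" using eq fc by simp
        then show "A = B" using xy coset by simp
      qed
      show "f ` carrier (quotient_module M N) = carrier T"
      proof
        show "f ` carrier (quotient_module M N) \<subseteq> carrier T"
          unfolding car using fc L(1) by auto
        show "carrier T \<subseteq> f ` carrier (quotient_module M N)"
        proof
          fix y assume "y \<in> carrier T"
          then obtain x where "x \<in> carrier M" "L x = y" using surj by blast
          then show "y \<in> f ` carrier (quotient_module M N)"
            unfolding car by (intro image_eqI[of _ _ "N +>\<^bsub>M\<^esub> x"]) (simp_all add: fc)
        qed
      qed
    qed
  next
    fix A B assume "A \<in> carrier (quotient_module M N)" "B \<in> carrier (quotient_module M N)"
    then obtain x y where xy: "x \<in> carrier M" "A = N +>\<^bsub>M\<^esub> x" "y \<in> carrier M" "B = N +>\<^bsub>M\<^esub> y"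
      unfolding car by blast
    have "f (A <+>\<^bsub>M\<^esub> B) = L x \<oplus>\<^bsub>T\<^esub> L y"
    proof (rule f)
      have "x \<oplus>\<^bsub>M\<^esub> y \<in> A <+>\<^bsub>M\<^esub> B"
        unfolding set_add_def' using xy coset by blast
      then show "A <+>\<^bsub>M\<^esub> B \<noteq> {}" by blast
      fix a assume "a \<in> A <+>\<^bsub>M\<^esub> B"
      then obtain u v where "u \<in> A" "v \<in> B" "a = u \<oplus>\<^bsub>M\<^esub> v" unfolding set_add_def' by blast
      then show "L a = L x \<oplus>\<^bsub>T\<^esub> L y" using xy coset L(2) by simp
    qed
    then show "f (A \<oplus>\<^bsub>quotient_module M N\<^esub> B) = f A \<oplus>\<^bsub>T\<^esub> f B"
      using xy fc by (simp add: quotient_module_def)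
  next
    fix r A assume r: "r \<in> carrier R" and "A \<in> carrier (quotient_module M N)"
    then obtain x where x: "x \<in> carrier M" "A = N +>\<^bsub>M\<^esub> x" unfolding car by blast
    have "f (\<Union>a\<in>A. N +>\<^bsub>M\<^esub> (r \<odot>\<^bsub>M\<^esub> a)) = r \<odot>\<^bsub>T\<^esub> L x"
    proof (rule f)
      have "x \<in> A" "r \<odot>\<^bsub>M\<^esub> x \<in> N +>\<^bsub>M\<^esub> (r \<odot>\<^bsub>M\<^esub> x)" using x coset smult[OF r] by auto
      then show "(\<Union>a\<in>A. N +>\<^bsub>M\<^esub> (r \<odot>\<^bsub>M\<^esub> a)) \<noteq> {}" by blast
      fix b assume "b \<in> (\<Union>a\<in>A. N +>\<^bsub>M\<^esub> (r \<odot>\<^bsub>M\<^esub> a))"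
      then obtain a where a: "a \<in> A" "b \<in> N +>\<^bsub>M\<^esub> (r \<odot>\<^bsub>M\<^esub> a)" by blast
      then have "a \<in> carrier M" "L a = L x" using x coset by auto
      then show "L b = r \<odot>\<^bsub>T\<^esub> L x" using a(2) coset[OF smult[OF r]] L(3)[OF r] by simp
    qed
    then show "f (r \<odot>\<^bsub>quotient_module M N\<^esub> A) = r \<odot>\<^bsub>T\<^esub> f A"
      using x fc by (simp add: quotient_module_def)
  qed
qed

lemma quotient_module_closed:
  assumes M: "abelian_group M" and T: "abelian_group T"
    and L: "\<And>x. x \<in> carrier M \<Longrightarrow> L x \<in> carrier T"
      "\<And>x y. x \<in> carrier M \<Longrightarrow> y \<in> carrier M \<Longrightarrow> L (x \<oplus>\<^bsub>M\<^esub> y) = L x \<oplus>\<^bsub>T\<^esub> L y"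
      "\<And>r x. r \<in> carrier R \<Longrightarrow> x \<in> carrier M \<Longrightarrow> L (r \<odot>\<^bsub>M\<^esub> x) = r \<odot>\<^bsub>T\<^esub> L x"
    and ker: "N = {x \<in> carrier M. L x = \<zero>\<^bsub>T\<^esub>}"
    and smult: "\<And>r x. r \<in> carrier R \<Longrightarrow> x \<in> carrier M \<Longrightarrow> r \<odot>\<^bsub>M\<^esub> x \<in> carrier M"
  shows "module_closed R (quotient_module M N)"
proof -
  interpret M: abelian_group M by (rule M)
  interpret T: abelian_group T by (rule T)
  have coset: "N +>\<^bsub>M\<^esub> x = {y \<in> carrier M. L y = L x}" if "x \<in> carrier M" for x
    using coset_eq_fibre[OF M T L(1,2) ker that] .
  have car: "carrier (quotient_module M N) = (\<lambda>x. N +>\<^bsub>M\<^esub> x) ` carrier M"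
    unfolding quotient_module_def A_RCOSETS_def' by auto
  show ?thesis
    unfolding module_closed_def
  proof (intro conjI ballI)
    fix A B assume "A \<in> carrier (quotient_module M N)" "B \<in> carrier (quotient_module M N)"
    then obtain x y where xy: "x \<in> carrier M" "A = N +>\<^bsub>M\<^esub> x" "y \<in> carrier M" "B = N +>\<^bsub>M\<^esub> y"
      unfolding car by blast
    have "A <+>\<^bsub>M\<^esub> B = N +>\<^bsub>M\<^esub> (x \<oplus>\<^bsub>M\<^esub> y)"
    proof
      show "A <+>\<^bsub>M\<^esub> B \<subseteq> N +>\<^bsub>M\<^esub> (x \<oplus>\<^bsub>M\<^esub> y)"
      proof
        fix a assume "a \<in> A <+>\<^bsub>M\<^esub> B"
        then obtain u v where "u \<in> A" "v \<in> B" "a = u \<oplus>\<^bsub>M\<^esub> v" unfolding set_add_def' by blast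
        then show "a \<in> N +>\<^bsub>M\<^esub> (x \<oplus>\<^bsub>M\<^esub> y)" using xy coset L(2) by simp
      qed
      show "N +>\<^bsub>M\<^esub> (x \<oplus>\<^bsub>M\<^esub> y) \<subseteq> A <+>\<^bsub>M\<^esub> B"
      proof
        fix w assume "w \<in> N +>\<^bsub>M\<^esub> (x \<oplus>\<^bsub>M\<^esub> y)"
        then have w: "w \<in> carrier M" "L w = L x \<oplus>\<^bsub>T\<^esub> L y" using xy coset L(2) by simp_all
        define u where "u = w \<oplus>\<^bsub>M\<^esub> (\<ominus>\<^bsub>M\<^esub> y)"
        have u: "u \<in> carrier M" "u \<oplus>\<^bsub>M\<^esub> y = w"
          using xy w by (auto simp: u_def M.a_assoc M.l_neg)
        then have "L u \<oplus>\<^bsub>T\<^esub> L y = L x \<oplus>\<^bsub>T\<^esub> L y" using L(2)[OF u(1) xy(3)] w by simp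
        then have "L u \<oplus>\<^bsub>T\<^esub> L y \<oplus>\<^bsub>T\<^esub> (\<ominus>\<^bsub>T\<^esub> L y) = L x \<oplus>\<^bsub>T\<^esub> L y \<oplus>\<^bsub>T\<^esub> (\<ominus>\<^bsub>T\<^esub> L y)" by simp
        then have "L u = L x"
          using L(1)[OF u(1)] L(1)[OF xy(1)] L(1)[OF xy(3)] T.a_inv_closed[OF L(1)[OF xy(3)]]
          by (simp only: T.a_assoc T.r_neg T.r_zero)
        then have "u \<in> A" "y \<in> B" using u xy coset by auto
        then show "w \<in> A <+>\<^bsub>M\<^esub> B" unfolding set_add_def' using u(2) by blast
      qed
    qed
    then show "A \<oplus>\<^bsub>quotient_module M N\<^esub> B \<in> carrier (quotient_module M N)"
      unfolding car using xy by (simp add: quotient_module_def)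
  next
    fix r A assume r: "r \<in> carrier R" and "A \<in> carrier (quotient_module M N)"
    then obtain x where x: "x \<in> carrier M" "A = N +>\<^bsub>M\<^esub> x" unfolding car by blast
    have "N +>\<^bsub>M\<^esub> (r \<odot>\<^bsub>M\<^esub> a) = N +>\<^bsub>M\<^esub> (r \<odot>\<^bsub>M\<^esub> x)" if "a \<in> A" for a
      using that x coset coset[OF smult[OF r]] L(3)[OF r] by simp
    moreover have "x \<in> A" using x coset by simp
    ultimately have "(\<Union>a\<in>A. N +>\<^bsub>M\<^esub> (r \<odot>\<^bsub>M\<^esub> a)) = N +>\<^bsub>M\<^esub> (r \<odot>\<^bsub>M\<^esub> x)" by blast
    then show "r \<odot>\<^bsub>quotient_module M N\<^esub> A \<in> carrier (quotient_module M N)"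
      unfolding car using smult[OF r x(1)] by (simp add: quotient_module_def)
  qed
qed

lemma quotient_module_isomorphic_closed:
  assumes M: "abelian_group M" and T: "abelian_group T"
    and L: "\<And>x. x \<in> carrier M \<Longrightarrow> L x \<in> carrier T"
      "\<And>x y. x \<in> carrier M \<Longrightarrow> y \<in> carrier M \<Longrightarrow> L (x \<oplus>\<^bsub>M\<^esub> y) = L x \<oplus>\<^bsub>T\<^esub> L y"
      "\<And>r x. r \<in> carrier R \<Longrightarrow> x \<in> carrier M \<Longrightarrow> L (r \<odot>\<^bsub>M\<^esub> x) = r \<odot>\<^bsub>T\<^esub> L x"
    and surj: "\<And>y. y \<in> carrier T \<Longrightarrow> \<exists>x\<in>carrier M. L x = y"
    and ker: "N = {x \<in> carrier M. L x = \<zero>\<^bsub>T\<^esub>}"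
    and smult: "\<And>r x. r \<in> carrier R \<Longrightarrow> x \<in> carrier M \<Longrightarrow> r \<odot>\<^bsub>M\<^esub> x \<in> carrier M"
  shows "module_isomorphic R (quotient_module M N) T \<and> module_closed R (quotient_module M N)"
  using quotient_module_isomorphic[OF assms] quotient_module_closed[OF M T L ker smult] by blast

subsection \<open>Extending homomorphisms into the rationals\<close>

text \<open>Graphs of partial homomorphisms from a free abelian group to the rationals. As sets of
  pairs they are ordered by inclusion, which suits Zorn's lemma; the clause for
  \<open>frag_cmul\<close> also provides negatives.\<close>

definition frag_graph :: "(('b \<Rightarrow>\<^sub>0 int) \<times> rat) set \<Rightarrow> bool" where
  "frag_graph F \<longleftrightarrow> (0, 0) \<in> F \<and>
     (\<forall>a q b r. (a, q) \<in> F \<longrightarrow> (b, r) \<in> F \<longrightarrow> (a + b, q + r) \<in> F) \<and>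
     (\<forall>a q c. (a, q) \<in> F \<longrightarrow> (frag_cmul c a, of_int c * q) \<in> F) \<and>
     (\<forall>a q r. (a, q) \<in> F \<longrightarrow> (a, r) \<in> F \<longrightarrow> q = r)"

lemma frag_graphD:
  assumes "frag_graph F"
  shows "(0, 0) \<in> F" "(a, q) \<in> F \<Longrightarrow> (b, r) \<in> F \<Longrightarrow> (a + b, q + r) \<in> F"
    "(a, q) \<in> F \<Longrightarrow> (frag_cmul c a, of_int c * q) \<in> F" "(a, q) \<in> F \<Longrightarrow> (a, r) \<in> F \<Longrightarrow> q = r"
  using assms unfolding frag_graph_def by blast+

text \<open>Divisibility of the rationals: if a nonzero multiple \<open>n\<close> of
  \<open>a\<close> is already in the domain, with value \<open>r\<close>, the value at
  \<open>a\<close> must be \<open>r / n\<close>; otherwise it is free, and 0 is taken.\<close>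

lemma frag_graph_extend:
  assumes F: "frag_graph F"
  shows "\<exists>q. frag_graph {(x + frag_cmul k a, s + of_int k * q) | x s k. (x, s) \<in> F}"
proof -
  have "\<exists>q. \<forall>m t. (frag_cmul m a, t) \<in> F \<longrightarrow> t = of_int m * q"
  proof (cases "\<exists>n r. n \<noteq> 0 \<and> (frag_cmul n a, r) \<in> F")
    case True
    then obtain n r where nr: "n \<noteq> 0" "(frag_cmul n a, r) \<in> F" by blast
    have "t = of_int m * (r / of_int n)" if t: "(frag_cmul m a, t) \<in> F" for m t
    proof -
      have "(frag_cmul (n * m) a, of_int n * t) \<in> F" "(frag_cmul (n * m) a, of_int m * r) \<in> F"
        using frag_graphD(3)[OF F t, of n] frag_graphD(3)[OF F nr(2), of m]
        by (simp_all add: mult.commute)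
      then have "of_int n * t = of_int m * r" by (rule frag_graphD(4)[OF F])
      then show ?thesis using nr(1) by (simp add: field_simps)
    qed
    then show ?thesis by blast
  next
    case False
    have "t = of_int m * 0" if "(frag_cmul m a, t) \<in> F" for m t
    proof -
      have "m = 0" using False that by blast
      then have "(0, t) \<in> F" using that by simp
      then show ?thesis using frag_graphD(4)[OF F frag_graphD(1)[OF F]] by simp
    qed
    then show ?thesis by blast
  qed
  then obtain q where q: "\<And>m t. (frag_cmul m a, t) \<in> F \<Longrightarrow> t = of_int m * q" by blast
  define E where "E = {(x + frag_cmul k a, s + of_int k * q) | x s k. (x, s) \<in> F}"
  have I: "(x + frag_cmul k a, s + of_int k * q) \<in> E" if "(x, s) \<in> F" for x s k
    unfolding E_def using that by blast
  have D: "\<exists>x s k. z = x + frag_cmul k a \<and> u = s + of_int k * q \<and> (x, s) \<in> F" if "(z, u) \<in> E" for z u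
    using that unfolding E_def by blast
  have "frag_graph E"
    unfolding frag_graph_def
  proof (intro conjI allI impI)
    show "(0, 0) \<in> E" using I[OF frag_graphD(1)[OF F], of 0] by simp
  next
    fix z u w v assume zu: "(z, u) \<in> E" and wv: "(w, v) \<in> E"
    obtain x s k where 1: "z = x + frag_cmul k a" "u = s + of_int k * q" "(x, s) \<in> F"
      using D[OF zu] by blast
    obtain y t l where 2: "w = y + frag_cmul l a" "v = t + of_int l * q" "(y, t) \<in> F"
      using D[OF wv] by blast
    have "z + w = x + y + frag_cmul (k + l) a" "u + v = s + t + of_int (k + l) * q"
      by (simp_all add: 1 2 frag_cmul_distrib algebra_simps)
    then show "(z + w, u + v) \<in> E" using I[OF frag_graphD(2)[OF F 1(3) 2(3)], of "k + l"] by simp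
  next
    fix z u c assume zu: "(z, u) \<in> E"
    obtain x s k where 1: "z = x + frag_cmul k a" "u = s + of_int k * q" "(x, s) \<in> F"
      using D[OF zu] by blast
    have "frag_cmul c z = frag_cmul c x + frag_cmul (c * k) a" "of_int c * u = of_int c * s + of_int (c * k) * q"
      by (simp_all add: 1 frag_cmul_distrib2 algebra_simps)
    then show "(frag_cmul c z, of_int c * u) \<in> E"
      using I[OF frag_graphD(3)[OF F 1(3), of c], of "c * k"] by simp
  next
    fix z u v assume zu: "(z, u) \<in> E" and zv: "(z, v) \<in> E"
    obtain x s k where 1: "z = x + frag_cmul k a" "u = s + of_int k * q" "(x, s) \<in> F"
      using D[OF zu] by blast
    obtain y t l where 2: "z = y + frag_cmul l a" "v = t + of_int l * q" "(y, t) \<in> F"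
      using D[OF zv] by blast
    have m1: "(y + frag_cmul (- 1) x, t + of_int (- 1) * s) \<in> F"
      using frag_graphD(2)[OF F 2(3) frag_graphD(3)[OF F 1(3), of "- 1"]] .
    have m2: "y + frag_cmul (- 1) x = frag_cmul (k + - l) a"
    proof -
      have "y = x + frag_cmul k a - frag_cmul l a" using 1(1) 2(1) by (simp add: eq_diff_eq)
      moreover have "frag_cmul (k + - l) a = frag_cmul k a - frag_cmul l a"
        unfolding frag_cmul_distrib by simp
      ultimately show ?thesis by simp
    qed
    have "t + of_int (- 1) * s = of_int (k + - l) * q" using m1 unfolding m2 by (rule q)
    then show "u = v" unfolding 1(2) 2(2) by (simp add: algebra_simps)
  qed
  then show ?thesis unfolding E_def by blast
qed

text \<open>The rationals are an injective abelian group, here for subgroups of chain groups; this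
  is the reason for the absence of Ext terms.\<close>

lemma rational_hom_extension:
  fixes \<phi> :: "('b \<Rightarrow>\<^sub>0 int) \<Rightarrow> rat"
  assumes H: "0 \<in> H" "\<And>x y. x \<in> H \<Longrightarrow> y \<in> H \<Longrightarrow> x + y \<in> H" "\<And>x. x \<in> H \<Longrightarrow> - x \<in> H"
    and \<phi>: "\<And>x y. x \<in> H \<Longrightarrow> y \<in> H \<Longrightarrow> \<phi> (x + y) = \<phi> x + \<phi> y"
  shows "\<exists>\<psi>. (\<forall>x y. \<psi> (x + y) = \<psi> x + \<psi> y) \<and> (\<forall>x\<in>H. \<psi> x = \<phi> x)"
proof -
  have \<phi>0: "\<phi> 0 = 0" using \<phi>[OF H(1) H(1)] by simp
  have \<phi>m: "\<phi> (- x) = - \<phi> x" if "x \<in> H" for x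
    using \<phi>[OF that H(3)[OF that]] \<phi>0 by simp
  have cm: "frag_cmul (int n) x \<in> H \<and> \<phi> (frag_cmul (int n) x) = of_nat n * \<phi> x" if "x \<in> H" for n x
    by (induction n) (use that H \<phi> \<phi>0 in \<open>auto simp: frag_cmul_distrib algebra_simps\<close>)
  have cmul: "frag_cmul c x \<in> H \<and> \<phi> (frag_cmul c x) = of_int c * \<phi> x" if "x \<in> H" for c x
  proof (cases c)
    case (nonneg n)
    then show ?thesis using cm[OF that, of n] by simp
  next
    case (neg n)
    then have c: "frag_cmul c x = - frag_cmul (int (Suc n)) x" by simp
    have 1: "- frag_cmul (int (Suc n)) x \<in> H" using cm[OF that] H(3) by blast
    have 2: "\<phi> (- frag_cmul (int (Suc n)) x) = - (of_nat (Suc n) * \<phi> x)"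
      using cm[OF that, of "Suc n"] \<phi>m by metis
    have 3: "of_int c * \<phi> x = - (of_nat (Suc n) * \<phi> x)" unfolding neg by (simp add: algebra_simps)
    show ?thesis unfolding c by (rule conjI[OF 1 trans[OF 2 3[symmetric]]])
  qed
  define F0 where "F0 = (\<lambda>x. (x, \<phi> x)) ` H"
  have F0: "frag_graph F0"
    unfolding frag_graph_def
  proof (intro conjI allI impI)
    show "(0, 0) \<in> F0" using H(1) \<phi>0 by (auto simp: F0_def)
  next
    fix a q b r assume "(a, q) \<in> F0" "(b, r) \<in> F0"
    then show "(a + b, q + r) \<in> F0" using H(2)[of a b] \<phi>[of a b] by (auto simp: F0_def)
  next
    fix a q c assume "(a, q) \<in> F0"
    then show "(frag_cmul c a, of_int c * q) \<in> F0" using cmul[of a c] by (auto simp: F0_def)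
  qed (auto simp: F0_def)
  define A where "A = {F. frag_graph F \<and> F0 \<subseteq> F}"
  have "\<exists>m\<in>A. \<forall>X\<in>A. m \<subseteq> X \<longrightarrow> X = m"
  proof (rule subset_Zorn_nonempty)
    show "A \<noteq> {}" using F0 by (auto simp: A_def)
    fix \<C> assume C: "\<C> \<noteq> {}" "subset.chain A \<C>"
    then have sub: "\<And>K. K \<in> \<C> \<Longrightarrow> frag_graph K \<and> F0 \<subseteq> K"
      by (auto simp: subset.chain_def A_def)
    have two: "\<exists>M\<in>\<C>. x \<in> M \<and> y \<in> M" if "x \<in> \<Union>\<C>" "y \<in> \<Union>\<C>" for x y
      using that C(2) unfolding subset_chain_def by blast
    have "frag_graph (\<Union>\<C>)"
      unfolding frag_graph_def
    proof (intro conjI allI impI)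
      show "(0, 0) \<in> \<Union>\<C>" using sub C(1) frag_graphD(1) by blast
    next
      fix a q b r assume "(a, q) \<in> \<Union>\<C>" "(b, r) \<in> \<Union>\<C>"
      from two[OF this] obtain M where M: "M \<in> \<C>" "(a, q) \<in> M" "(b, r) \<in> M" by blast
      then have "(a + b, q + r) \<in> M" using sub[OF M(1)] frag_graphD(2) by blast
      then show "(a + b, q + r) \<in> \<Union>\<C>" using M by blast
    next
      fix a q c assume "(a, q) \<in> \<Union>\<C>"
      then obtain K where K: "K \<in> \<C>" "(a, q) \<in> K" by blast
      then have "(frag_cmul c a, of_int c * q) \<in> K" using sub[OF K(1)] frag_graphD(3) by blast
      then show "(frag_cmul c a, of_int c * q) \<in> \<Union>\<C>" using K by blast
    next
      fix a q r assume "(a, q) \<in> \<Union>\<C>" "(a, r) \<in> \<Union>\<C>"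
      from two[OF this] obtain M where M: "M \<in> \<C>" "(a, q) \<in> M" "(a, r) \<in> M" by blast
      show "q = r" using sub[OF M(1)] frag_graphD(4)[OF _ M(2,3)] by blast
    qed
    then show "\<Union>\<C> \<in> A" using sub C(1) by (auto simp: A_def)
  qed
  then obtain F where "F \<in> A" and max: "\<And>X. X \<in> A \<Longrightarrow> F \<subseteq> X \<Longrightarrow> X = F" by blast
  then have F: "frag_graph F" "F0 \<subseteq> F" by (simp_all add: A_def)
  \<comment> \<open>A maximal graph that missed \<open>a\<close> could be extended to it.\<close>
  have total: "\<exists>q. (a, q) \<in> F" for a
  proof -
    obtain q where q: "frag_graph {(x + frag_cmul k a, s + of_int k * q) | x s k. (x, s) \<in> F}"
      (is "frag_graph ?F") using frag_graph_extend[OF F(1)] by blast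
    have "F \<subseteq> ?F"
    proof clarify
      fix x s assume "(x, s) \<in> F"
      then show "\<exists>y t k. (x, s) = (y + frag_cmul k a, t + of_int k * q) \<and> (y, t) \<in> F"
        by (intro exI[of _ x] exI[of _ s] exI[of _ 0]) simp
    qed
    with F(2) q max have "?F = F" by (simp add: A_def)
    moreover have "(0 + frag_cmul 1 a, 0 + of_int 1 * q) \<in> ?F"
      using frag_graphD(1)[OF F(1)] by blast
    ultimately show ?thesis by auto
  qed
  define \<psi> where "\<psi> a = (THE q. (a, q) \<in> F)" for a
  have \<psi>I: "\<psi> a = q" if "(a, q) \<in> F" for a q
    unfolding \<psi>_def using that frag_graphD(4)[OF F(1)] by (intro the_equality) auto
  show ?thesis
  proof (intro exI[of _ \<psi>] conjI allI ballI)
    fix x y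
    obtain q r where "(x, q) \<in> F" "(y, r) \<in> F" using total by blast
    then show "\<psi> (x + y) = \<psi> x + \<psi> y"
      using \<psi>I frag_graphD(2)[OF F(1)] by metis
  next
    fix x assume "x \<in> H"
    then show "\<psi> x = \<phi> x" using F(2) by (intro \<psi>I) (auto simp: F0_def)
  qed
qed

subsection \<open>The universal coefficient isomorphism\<close>

lemma cochain_module_simps:
  "\<zero>\<^bsub>cochain_module p X\<^esub> = (\<lambda>c\<in>singular_chain_set p X. 0)"
  "\<phi> \<oplus>\<^bsub>cochain_module p X\<^esub> \<psi> = (\<lambda>c\<in>singular_chain_set p X. \<phi> c + \<psi> c)"
  "r \<odot>\<^bsub>cochain_module p X\<^esub> \<phi> = (\<lambda>c\<in>singular_chain_set p X. r * \<phi> c)"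
  by (simp_all add: cochain_module_def)

lemma cochain_iff:
  "\<phi> \<in> carrier (cochain_module p X) \<longleftrightarrow> \<phi> \<in> extensional (singular_chain_set p X) \<and>
    (\<forall>x y. singular_chain p X x \<longrightarrow> singular_chain p X y \<longrightarrow> \<phi> (x + y) = \<phi> x + \<phi> y)"
  by (auto simp: cochain_module_eq_hom_module hom_module_def)

lemma cocycle_iff:
  "\<phi> \<in> cocycles p X \<longleftrightarrow> \<phi> \<in> carrier (cochain_module p X) \<and>
    (\<forall>c. singular_chain (Suc p) X c \<longrightarrow> \<phi> (chain_boundary (Suc p) c) = 0)"
  by (auto simp: cocycles_def coboundary_def cochain_module_simps fun_eq_iff restrict_def)

lemma boundary_chain: "singular_chain (Suc p) X c \<Longrightarrow> singular_chain p X (chain_boundary (Suc p) c)"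
  using singular_chain_boundary[of "Suc p" X c] by simp

lemma abelian_group_cocycles: "abelian_group (cochain_module p X\<lparr>carrier := cocycles p X\<rparr>)"
  by (rule abelian_group_pointwise[where D = "singular_chain_set p X"])
     (auto simp: cochain_module_simps cocycle_iff cochain_iff singular_chain_add boundary_chain)

lemma cochain_zero: "\<phi> \<in> carrier (cochain_module p X) \<Longrightarrow> \<phi> 0 = 0"
  by (auto simp: cochain_iff dest!: spec[of _ 0])

lemma cochain_diff:
  assumes "\<phi> \<in> carrier (cochain_module p X)" "singular_chain p X x" "singular_chain p X y"
  shows "\<phi> (x - y) = \<phi> x - \<phi> y"
proof -
  have "\<phi> (x - y + y) = \<phi> (x - y) + \<phi> y"
    using assms singular_chain_diff unfolding cochain_iff by blast
  then show ?thesis by simp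
qed

lemma restrict_cochain:
  assumes "\<And>x y. \<psi> (x + y) = \<psi> x + \<psi> y"
  shows "restrict \<psi> (singular_chain_set p X) \<in> carrier (cochain_module p X)"
  using assms by (simp add: cochain_iff singular_chain_add)

lemma cocycle_homologous:
  assumes \<phi>: "\<phi> \<in> cocycles p X" and ab: "singular_relcycle p X {} a" "homologous_rel p X {} a b"
  shows "\<phi> b = \<phi> a"
proof -
  have a: "singular_chain p X a" using ab(1) by (simp add: singular_cycle)
  have bd: "singular_relboundary p X {} (a - b)" using ab(2) by (simp add: homologous_rel_def)
  then obtain c where c: "singular_chain (Suc p) X c" "chain_boundary (Suc p) c = a - b"
    by (auto simp: singular_boundary)
  have b: "singular_chain p X b"
    using singular_chain_diff[OF a boundary_chain[OF c(1)]] c(2) by simp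
  have "\<phi> (a - b) = 0" using \<phi> c cocycle_iff by metis
  then show ?thesis using cochain_diff[of \<phi>, OF _ a b] \<phi> by (simp add: cocycle_iff)
qed

text \<open>A chain homologous to \<open>z + w\<close> is \<open>z\<close> plus a chain homologous
  to \<open>w\<close>, so the set product of two classes exhausts the class of the sum.\<close>

lemma homology_set_class_simps:
  assumes "singular_relcycle p X {} z" "singular_relcycle p X {} w"
  shows "homologous_rel_set p X {} z \<otimes>\<^bsub>homology_group (int p) X\<^esub> homologous_rel_set p X {} w
    = homologous_rel_set p X {} (z + w)"
proof -
  have "\<exists>u v. homologous_rel p X {} z u \<and> homologous_rel p X {} w v \<and> x = u + v"
    if "homologous_rel p X {} (z + w) x" for x
    using that by (intro exI[of _ z] exI[of _ "x - z"])
      (auto simp: homologous_rel_def algebra_simps)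
  then show ?thesis
    unfolding mult_relative_homology_group by (auto intro: homologous_rel_add)
qed

text \<open>Both surjectivity onto \<open>Hom (H\<^sub>p, \<rat>)\<close> and the identification of the kernel with the
  coboundaries extend a homomorphism from a subgroup to all chains.\<close>

lemma cocycle_vanishing_on_cycles_iff:
  assumes \<phi>: "\<phi> \<in> cocycles p X"
  shows "(\<forall>z. singular_relcycle p X {} z \<longrightarrow> \<phi> z = 0) \<longleftrightarrow> \<phi> \<in> coboundaries p X"
proof (cases p)
  case 0
  \<comment> \<open>In degree 0 every chain is a cycle, and the only coboundary is zero.\<close>
  have "\<phi> \<in> extensional (singular_chain_set 0 X)" using \<phi> 0 by (simp add: cocycle_iff cochain_iff)
  then show ?thesis
    by (auto simp: 0 coboundaries_def cochain_module_simps singular_cycle chain_boundary_def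
        fun_eq_iff extensional_def)
next
  case (Suc q)
  have ext: "\<phi> \<in> extensional (singular_chain_set (Suc q) X)"
    and add: "\<And>x y. singular_chain (Suc q) X x \<Longrightarrow> singular_chain (Suc q) X y \<Longrightarrow> \<phi> (x + y) = \<phi> x + \<phi> y"
    using \<phi> Suc by (auto simp: cocycle_iff cochain_iff)
  show ?thesis
  proof
    assume "\<phi> \<in> coboundaries p X"
    then obtain \<psi> where \<psi>: "\<psi> \<in> carrier (cochain_module q X)" "\<phi> = coboundary q X \<psi>"
      by (auto simp: Suc coboundaries_def)
    then show "\<forall>z. singular_relcycle p X {} z \<longrightarrow> \<phi> z = 0"
      by (auto simp: Suc coboundary_def singular_cycle cochain_zero)
  next
    assume van: "\<forall>z. singular_relcycle p X {} z \<longrightarrow> \<phi> z = 0"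
    define B where "B = chain_boundary (Suc q) ` singular_chain_set (Suc q) X"
    \<comment> \<open>A primitive must send the boundary of \<open>c\<close> to
      \<open>\<phi> c\<close>; the choice of \<open>c\<close> is immaterial because
      \<open>\<phi>\<close> vanishes on cycles.\<close>
    define s where "s b = (SOME c. singular_chain (Suc q) X c \<and> chain_boundary (Suc q) c = b)" for b
    have s: "singular_chain (Suc q) X (s b)" "chain_boundary (Suc q) (s b) = b" if "b \<in> B" for b
    proof -
      have "\<exists>c. singular_chain (Suc q) X c \<and> chain_boundary (Suc q) c = b"
        using that by (auto simp: B_def)
      from someI_ex[OF this] show "singular_chain (Suc q) X (s b)" "chain_boundary (Suc q) (s b) = b"
        by (simp_all add: s_def)
    qed
    have sb: "\<phi> (s (chain_boundary (Suc q) c)) = \<phi> c" if c: "singular_chain (Suc q) X c" for c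
    proof -
      have b: "chain_boundary (Suc q) c \<in> B" using c by (simp add: B_def)
      have "singular_relcycle p X {} (s (chain_boundary (Suc q) c) - c)"
        using s[OF b] c by (simp add: Suc singular_cycle singular_chain_diff chain_boundary_diff)
      then have "\<phi> (s (chain_boundary (Suc q) c) - c) = 0" using van by blast
      then show ?thesis
        using cochain_diff[of \<phi> "Suc q" X, OF _ s(1)[OF b] c] \<phi> by (simp add: Suc cocycle_iff)
    qed
    have "\<exists>\<psi>. (\<forall>x y. \<psi> (x + y) = \<psi> x + \<psi> y) \<and> (\<forall>x\<in>B. \<psi> x = \<phi> (s x))"
    proof (rule rational_hom_extension)
      show "0 \<in> B" unfolding B_def by (rule image_eqI[of _ _ 0]) auto
      fix x y assume "x \<in> B" "y \<in> B"
      then obtain c d where cd: "singular_chain (Suc q) X c" "x = chain_boundary (Suc q) c"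
        "singular_chain (Suc q) X d" "y = chain_boundary (Suc q) d" by (auto simp: B_def)
      have xy: "x + y = chain_boundary (Suc q) (c + d)" by (simp add: cd chain_boundary_add)
      show "x + y \<in> B" unfolding xy B_def using singular_chain_add[OF cd(1,3)] by (intro imageI) simp
      show "\<phi> (s (x + y)) = \<phi> (s x) + \<phi> (s y)"
        unfolding xy sb[OF singular_chain_add[OF cd(1,3)]] unfolding cd(2,4) sb[OF cd(1)] sb[OF cd(3)]
        by (rule add[OF cd(1,3)])
    next
      fix x assume "x \<in> B"
      then obtain c where c: "singular_chain (Suc q) X c" "x = chain_boundary (Suc q) c"
        by (auto simp: B_def)
      then have "- x = chain_boundary (Suc q) (- c)" by (simp add: chain_boundary_minus)
      then show "- x \<in> B" unfolding B_def using c(1) by (intro image_eqI[of _ _ "- c"]) (simp_all add: singular_chain_minus)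
    qed
    then obtain \<psi> where \<psi>: "\<And>x y. \<psi> (x + y) = \<psi> x + \<psi> y" "\<And>x. x \<in> B \<Longrightarrow> \<psi> x = \<phi> (s x)" by blast
    have "coboundary q X (restrict \<psi> (singular_chain_set q X)) = \<phi>"
    proof
      fix c
      show "coboundary q X (restrict \<psi> (singular_chain_set q X)) c = \<phi> c"
      proof (cases "singular_chain (Suc q) X c")
        case True
        then have "chain_boundary (Suc q) c \<in> B" by (simp add: B_def)
        then show ?thesis
          using \<psi>(2) sb[OF True] True boundary_chain[OF True] by (simp add: coboundary_def)
      next
        case False
        then show ?thesis using ext by (simp add: coboundary_def extensional_def)
      qed
    qed
    then show "\<phi> \<in> coboundaries p X"
      using restrict_cochain[OF \<psi>(1), where p = q and X = X] unfolding Suc coboundaries_def by auto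
  qed
qed

text \<open>The isomorphism evaluates cocycles on homology classes. Closure is proved alongside, so
  that the isomorphism can be reversed when it is applied.\<close>

proposition universal_coefficients:
  "module_isomorphic rat_field (cohomology p X) (hom_module (homology_group (int p) X)) \<and>
   module_closed rat_field (cohomology p X)"
proof -
  let ?H = "homology_group (int p) X"
  define rep where "rep C = (SOME z. singular_relcycle p X {} z \<and> C = homologous_rel_set p X {} z)" for C
  have car: "carrier ?H = homologous_rel_set p X {} ` singular_relcycle_set p X {}"
    by (rule carrier_relative_homology_group)
  have rep: "singular_relcycle p X {} (rep C)" "homologous_rel_set p X {} (rep C) = C" if "C \<in> carrier ?H" for C
  proof -
    have "\<exists>z. singular_relcycle p X {} z \<and> C = homologous_rel_set p X {} z"
      using that unfolding car by blast
    from someI_ex[OF this] show "singular_relcycle p X {} (rep C)" "homologous_rel_set p X {} (rep C) = C"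
      unfolding rep_def by simp_all
  qed
  define L where "L \<phi> = (\<lambda>C\<in>carrier ?H. \<phi> (rep C))" for \<phi> :: "_ \<Rightarrow> rat"
  have Lz: "L \<phi> (homologous_rel_set p X {} z) = \<phi> z"
    if \<phi>: "\<phi> \<in> cocycles p X" and z: "singular_relcycle p X {} z" for \<phi> z
  proof -
    have C: "homologous_rel_set p X {} z \<in> carrier ?H" unfolding car using z by blast
    have "homologous_rel p X {} z (rep (homologous_rel_set p X {} z))"
      using rep(2)[OF C] homologous_rel_refl[of p X "{}" "rep (homologous_rel_set p X {} z)"] by blast
    from cocycle_homologous[OF \<phi> z this] show ?thesis using C by (simp add: L_def)
  qed
  have L_hom: "L \<phi> \<in> carrier (hom_module ?H)" if \<phi>: "\<phi> \<in> cocycles p X" for \<phi>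
  proof -
    have "L \<phi> (C \<otimes>\<^bsub>?H\<^esub> D) = L \<phi> C + L \<phi> D" if CD: "C \<in> carrier ?H" "D \<in> carrier ?H" for C D
    proof -
      obtain z w where zw: "singular_relcycle p X {} z" "C = homologous_rel_set p X {} z"
        "singular_relcycle p X {} w" "D = homologous_rel_set p X {} w"
        using CD unfolding car by blast
      then have "singular_chain p X z" "singular_chain p X w" by (simp_all add: singular_cycle)
      then have "\<phi> (z + w) = \<phi> z + \<phi> w" using \<phi> by (simp add: cocycle_iff cochain_iff)
      then show ?thesis
        using zw Lz[OF \<phi>] singular_relcycle_add[OF zw(1,3)] by (simp add: homology_set_class_simps)
    qed
    then show ?thesis by (simp add: hom_module_def L_def[abs_def])
  qed
  let ?Q = "quotient_module (cochain_module p X\<lparr>carrier := cocycles p X\<rparr>) (coboundaries p X)"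
  have "module_isomorphic rat_field ?Q (hom_module ?H) \<and> module_closed rat_field ?Q"
  proof (rule quotient_module_isomorphic_closed[OF abelian_group_cocycles
        abelian_group_hom_module[OF group_relative_homology_group]])
    fix \<phi> assume "\<phi> \<in> carrier (cochain_module p X\<lparr>carrier := cocycles p X\<rparr>)"
    then show "L \<phi> \<in> carrier (hom_module ?H)" using L_hom by simp
  next
    fix \<phi> \<psi> assume "\<phi> \<in> carrier (cochain_module p X\<lparr>carrier := cocycles p X\<rparr>)"
      "\<psi> \<in> carrier (cochain_module p X\<lparr>carrier := cocycles p X\<rparr>)"
    show "L (\<phi> \<oplus>\<^bsub>cochain_module p X\<lparr>carrier := cocycles p X\<rparr>\<^esub> \<psi>) = L \<phi> \<oplus>\<^bsub>hom_module ?H\<^esub> L \<psi>"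
      using rep(1) by (auto simp: L_def cochain_module_simps hom_module_def singular_cycle restrict_def fun_eq_iff)
  next
    fix r \<phi> assume "r \<in> carrier rat_field" "\<phi> \<in> carrier (cochain_module p X\<lparr>carrier := cocycles p X\<rparr>)"
    show "L (r \<odot>\<^bsub>cochain_module p X\<lparr>carrier := cocycles p X\<rparr>\<^esub> \<phi>) = r \<odot>\<^bsub>hom_module ?H\<^esub> L \<phi>"
      using rep(1) by (auto simp: L_def cochain_module_simps hom_module_def singular_cycle restrict_def fun_eq_iff)
  next
    fix r \<phi> assume "r \<in> carrier rat_field" "\<phi> \<in> carrier (cochain_module p X\<lparr>carrier := cocycles p X\<rparr>)"
    then show "r \<odot>\<^bsub>cochain_module p X\<lparr>carrier := cocycles p X\<rparr>\<^esub> \<phi> \<in> carrier (cochain_module p X\<lparr>carrier := cocycles p X\<rparr>)"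
      by (auto simp: cochain_module_simps cocycle_iff cochain_iff singular_chain_add boundary_chain algebra_simps)
  next
    have "L \<phi> = \<zero>\<^bsub>hom_module ?H\<^esub> \<longleftrightarrow> (\<forall>z. singular_relcycle p X {} z \<longrightarrow> \<phi> z = 0)" if \<phi>: "\<phi> \<in> cocycles p X" for \<phi>
    proof
      assume 0: "L \<phi> = \<zero>\<^bsub>hom_module ?H\<^esub>"
      show "\<forall>z. singular_relcycle p X {} z \<longrightarrow> \<phi> z = 0"
      proof (intro allI impI)
        fix z assume z: "singular_relcycle p X {} z"
        then have "homologous_rel_set p X {} z \<in> carrier ?H" unfolding car by blast
        then show "\<phi> z = 0" using Lz[OF \<phi> z] unfolding 0 by (simp add: hom_module_def)
      qed
    next
      assume "\<forall>z. singular_relcycle p X {} z \<longrightarrow> \<phi> z = 0"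
      then show "L \<phi> = \<zero>\<^bsub>hom_module ?H\<^esub>"
        using rep(1) by (auto simp: L_def hom_module_def fun_eq_iff restrict_def)
    qed
    moreover have "coboundaries p X \<subseteq> cocycles p X"
    proof
      fix \<phi> assume \<phi>: "\<phi> \<in> coboundaries p X"
      show "\<phi> \<in> cocycles p X"
      proof (cases p)
        case 0
        then show ?thesis using \<phi>
          by (auto simp: coboundaries_def cochain_module_simps cocycle_iff cochain_iff singular_chain_add
              dest: boundary_chain)
      next
        case (Suc q)
        then obtain \<psi> where \<psi>: "\<psi> \<in> carrier (cochain_module q X)" "\<phi> = coboundary q X \<psi>"
          using \<phi> by (auto simp: coboundaries_def)
        then show ?thesis
          by (auto simp: Suc coboundary_def cocycle_iff cochain_iff singular_chain_add chain_boundary_add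
              boundary_chain cochain_zero[OF \<psi>(1)] chain_boundary_boundary_alt)
      qed
    qed
    ultimately show "coboundaries p X = {\<phi> \<in> carrier (cochain_module p X\<lparr>carrier := cocycles p X\<rparr>).
        L \<phi> = \<zero>\<^bsub>hom_module ?H\<^esub>}"
      using cocycle_vanishing_on_cycles_iff[of _ p X] by auto
  next
    fix g assume g: "g \<in> carrier (hom_module ?H)"
    let ?g = "\<lambda>z. g (homologous_rel_set p X {} z)"
    have gadd: "?g (z + w) = ?g z + ?g w"
      if "singular_relcycle p X {} z" "singular_relcycle p X {} w" for z w
    proof -
      have "g (homologous_rel_set p X {} z \<otimes>\<^bsub>?H\<^esub> homologous_rel_set p X {} w) = ?g z + ?g w"
        using g that unfolding hom_module_def car by simp
      then show ?thesis unfolding homology_set_class_simps[OF that] .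
    qed
    \<comment> \<open>Surjectivity: the homomorphism on cycles extends to all chains, and the
      extension is a cocycle since boundaries represent the class 0.\<close>
    have "\<exists>\<psi>. (\<forall>x y. \<psi> (x + y) = \<psi> x + \<psi> y) \<and> (\<forall>x\<in>singular_relcycle_set p X {}. \<psi> x = ?g x)"
      by (rule rational_hom_extension)
         (auto simp: singular_relcycle_add singular_relcycle_minus gadd)
    then obtain \<psi> where \<psi>: "\<And>x y. \<psi> (x + y) = \<psi> x + \<psi> y"
      "\<And>z. singular_relcycle p X {} z \<Longrightarrow> \<psi> z = ?g z" by blast
    let ?\<phi> = "restrict \<psi> (singular_chain_set p X)"
    have g0: "?g 0 = 0" using gadd[of 0 0] by simp
    have "\<psi> (chain_boundary (Suc p) c) = 0" if c: "singular_chain (Suc p) X c" for c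
    proof -
      have b: "singular_relboundary p X {} (chain_boundary (Suc p) c)"
        using c by (auto simp: singular_boundary)
      then have "homologous_rel_set p X {} (chain_boundary (Suc p) c) = homologous_rel_set p X {} 0"
        unfolding homologous_rel_set_eq by (simp add: homologous_rel_def)
      then show ?thesis using \<psi>(2)[OF singular_relboundary_imp_relcycle[OF b]] g0 by simp
    qed
    then have \<phi>: "?\<phi> \<in> cocycles p X"
      using restrict_cochain[OF \<psi>(1)] unfolding cocycle_iff by (simp add: boundary_chain)
    have "L ?\<phi> = g"
    proof
      fix C
      show "L ?\<phi> C = g C"
      proof (cases "C \<in> carrier ?H")
        case True
        then show ?thesis using rep[OF True] \<psi>(2)[OF rep(1)[OF True]] by (simp add: L_def singular_cycle)
      next
        case False
        then show ?thesis using g by (simp add: L_def hom_module_def extensional_def)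
      qed
    qed
    with \<phi> show "\<exists>\<phi>\<in>carrier (cochain_module p X\<lparr>carrier := cocycles p X\<rparr>). L \<phi> = g" by auto
  qed
  then show ?thesis by (simp add: cohomology_def)
qed

section \<open>Tensor products with a line\<close>

lemma module_isomorphic_trans:
  assumes "module_isomorphic R M N" "module_isomorphic R N P"
  shows "module_isomorphic R M P"
proof -
  obtain f g where f: "bij_betw f (carrier M) (carrier N)"
    "\<forall>x\<in>carrier M. \<forall>y\<in>carrier M. f (x \<oplus>\<^bsub>M\<^esub> y) = f x \<oplus>\<^bsub>N\<^esub> f y"
    "\<forall>r\<in>carrier R. \<forall>x\<in>carrier M. f (r \<odot>\<^bsub>M\<^esub> x) = r \<odot>\<^bsub>N\<^esub> f x"
    and g: "bij_betw g (carrier N) (carrier P)"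
    "\<forall>x\<in>carrier N. \<forall>y\<in>carrier N. g (x \<oplus>\<^bsub>N\<^esub> y) = g x \<oplus>\<^bsub>P\<^esub> g y"
    "\<forall>r\<in>carrier R. \<forall>x\<in>carrier N. g (r \<odot>\<^bsub>N\<^esub> x) = r \<odot>\<^bsub>P\<^esub> g x"
    using assms unfolding module_isomorphic_def by blast
  have "f x \<in> carrier N" if "x \<in> carrier M" for x
    using bij_betwE[OF f(1)] that by blast
  then show ?thesis
    unfolding module_isomorphic_def
    by (intro exI[of _ "g \<circ> f"] conjI bij_betw_trans[OF f(1) g(1)]) (simp_all add: f g)
qed

lemma module_isomorphic_sym:
  assumes "module_isomorphic R M N" "module_closed R M"
  shows "module_isomorphic R N M"
proof -
  obtain f where f: "bij_betw f (carrier M) (carrier N)"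
    "\<forall>x\<in>carrier M. \<forall>y\<in>carrier M. f (x \<oplus>\<^bsub>M\<^esub> y) = f x \<oplus>\<^bsub>N\<^esub> f y"
    "\<forall>r\<in>carrier R. \<forall>x\<in>carrier M. f (r \<odot>\<^bsub>M\<^esub> x) = r \<odot>\<^bsub>N\<^esub> f x"
    using assms unfolding module_isomorphic_def by blast
  let ?g = "inv_into (carrier M) f"
  have g: "?g y \<in> carrier M" "f (?g y) = y" if "y \<in> carrier N" for y
    using that f(1) by (auto simp: bij_betw_def inv_into_into f_inv_into_f)
  have gf: "?g (f x) = x" if "x \<in> carrier M" for x
    using that f(1) by (simp add: bij_betw_def)
  show ?thesis
    unfolding module_isomorphic_def
  proof (intro exI[of _ ?g] conjI ballI bij_betw_inv_into f(1))
    fix x y assume xy: "x \<in> carrier N" "y \<in> carrier N"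
    have "x \<oplus>\<^bsub>N\<^esub> y = f (?g x \<oplus>\<^bsub>M\<^esub> ?g y)" using f(2) g[OF xy(1)] g[OF xy(2)] by simp
    then show "?g (x \<oplus>\<^bsub>N\<^esub> y) = ?g x \<oplus>\<^bsub>M\<^esub> ?g y"
      using gf g[OF xy(1)] g[OF xy(2)] assms(2) by (simp add: module_closed_def)
  next
    fix r x assume rx: "r \<in> carrier R" "x \<in> carrier N"
    have "r \<odot>\<^bsub>N\<^esub> x = f (r \<odot>\<^bsub>M\<^esub> ?g x)" using f(3) g[OF rx(2)] rx(1) by simp
    then show "?g (r \<odot>\<^bsub>N\<^esub> x) = r \<odot>\<^bsub>M\<^esub> ?g x"
      using gf g[OF rx(2)] rx(1) assms(2) by (simp add: module_closed_def)
  qed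
qed

lemma hom_module_simps:
  "\<zero>\<^bsub>hom_module A\<^esub> = (\<lambda>c\<in>carrier A. 0)"
  "\<phi> \<oplus>\<^bsub>hom_module A\<^esub> \<psi> = (\<lambda>c\<in>carrier A. \<phi> c + \<psi> c)"
  "r \<odot>\<^bsub>hom_module A\<^esub> \<phi> = (\<lambda>c\<in>carrier A. r * \<phi> c)"
  by (simp_all add: hom_module_def)

lemma hom_module_iff:
  "\<phi> \<in> carrier (hom_module A) \<longleftrightarrow> \<phi> \<in> extensional (carrier A) \<and>
    (\<forall>x\<in>carrier A. \<forall>y\<in>carrier A. \<phi> (x \<otimes>\<^bsub>A\<^esub> y) = \<phi> x + \<phi> y)"
  by (simp add: hom_module_def)

lemma hom_module_one:
  assumes "group A" "\<phi> \<in> carrier (hom_module A)"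
  shows "\<phi> \<one>\<^bsub>A\<^esub> = 0"
proof -
  interpret group A by (rule assms(1))
  have "\<phi> (\<one>\<^bsub>A\<^esub> \<otimes>\<^bsub>A\<^esub> \<one>\<^bsub>A\<^esub>) = \<phi> \<one>\<^bsub>A\<^esub> + \<phi> \<one>\<^bsub>A\<^esub>"
    using assms(2) one_closed unfolding hom_module_iff by blast
  then show ?thesis by simp
qed

lemma hom_module_iso:
  assumes "A \<cong> B" and A: "group A"
  shows "module_isomorphic rat_field (hom_module A) (hom_module B)"
proof -
  obtain f where f: "f \<in> iso A B" using assms(1) by (auto simp: is_iso_def)
  let ?g = "inv_into (carrier A) f"
  have g: "?g \<in> iso B A" by (rule group.iso_set_sym[OF A f])
  have fc: "f x \<in> carrier B" if "x \<in> carrier A" for x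
    using f that by (auto simp: iso_def hom_def)
  have gc: "?g y \<in> carrier A" if "y \<in> carrier B" for y
    using g that by (auto simp: iso_def hom_def)
  have fg: "f (?g y) = y" if "y \<in> carrier B" for y
    using f that by (simp add: iso_def bij_betw_def f_inv_into_f)
  have gf: "?g (f x) = x" if "x \<in> carrier A" for x
    using f that by (simp add: iso_def bij_betw_def)
  have fm: "f (x \<otimes>\<^bsub>A\<^esub> y) = f x \<otimes>\<^bsub>B\<^esub> f y" if "x \<in> carrier A" "y \<in> carrier A" for x y
    using f that by (simp add: iso_def hom_def)
  have gm: "?g (x \<otimes>\<^bsub>B\<^esub> y) = ?g x \<otimes>\<^bsub>A\<^esub> ?g y" if "x \<in> carrier B" "y \<in> carrier B" for x y
    using g that by (simp add: iso_def hom_def)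
  have Am: "x \<otimes>\<^bsub>A\<^esub> y \<in> carrier A" if "x \<in> carrier A" "y \<in> carrier A" for x y
    using that monoid.m_closed[OF group.is_monoid[OF A]] by blast
  have Bm: "x \<otimes>\<^bsub>B\<^esub> y \<in> carrier B" if "x \<in> carrier B" "y \<in> carrier B" for x y
    using fm[of "?g x" "?g y"] gc[OF that(1)] gc[OF that(2)] fg that Am fc by metis
  show ?thesis
    unfolding module_isomorphic_def
  proof (intro exI[of _ "\<lambda>\<phi>. \<lambda>b\<in>carrier B. \<phi> (?g b)"] conjI ballI)
    show "bij_betw (\<lambda>\<phi>. \<lambda>b\<in>carrier B. \<phi> (?g b)) (carrier (hom_module A)) (carrier (hom_module B))"
    proof (rule bij_betw_byWitness[where f' = "\<lambda>\<psi>. \<lambda>a\<in>carrier A. \<psi> (f a)"])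
      show "\<forall>\<phi>\<in>carrier (hom_module A). (\<lambda>a\<in>carrier A. (\<lambda>b\<in>carrier B. \<phi> (?g b)) (f a)) = \<phi>"
        by (auto simp: hom_module_iff fun_eq_iff extensional_def fc gf restrict_def)
      show "\<forall>\<psi>\<in>carrier (hom_module B). (\<lambda>b\<in>carrier B. (\<lambda>a\<in>carrier A. \<psi> (f a)) (?g b)) = \<psi>"
        by (auto simp: hom_module_iff fun_eq_iff extensional_def gc fg restrict_def)
      show "(\<lambda>\<phi>. \<lambda>b\<in>carrier B. \<phi> (?g b)) ` carrier (hom_module A) \<subseteq> carrier (hom_module B)"
        by (auto simp: hom_module_iff gc gm Bm)
      show "(\<lambda>\<psi>. \<lambda>a\<in>carrier A. \<psi> (f a)) ` carrier (hom_module B) \<subseteq> carrier (hom_module A)"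
        by (auto simp: hom_module_iff fc fm Am)
    qed
  qed (auto simp: hom_module_simps fun_eq_iff gc restrict_def)
qed

section \<open>Free modules over the rationals\<close>

lemma free_module_simps:
  "f \<oplus>\<^bsub>free_module R I\<^esub> g = (\<lambda>i. f i \<oplus>\<^bsub>R\<^esub> g i)"
  "r \<odot>\<^bsub>free_module R I\<^esub> f = (\<lambda>i. r \<otimes>\<^bsub>R\<^esub> f i)"
  "\<zero>\<^bsub>free_module R I\<^esub> = (\<lambda>i. \<zero>\<^bsub>R\<^esub>)"
  by (simp_all add: free_module_def)

lemma free_module_iff:
  "f \<in> carrier (free_module rat_field I) \<longleftrightarrow> finite {i. f i \<noteq> 0} \<and> {i. f i \<noteq> 0} \<subseteq> I"
  by (simp add: free_module_def)

lemma free_module_closed: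
  assumes "f \<in> carrier (free_module rat_field I)"
  shows "g \<in> carrier (free_module rat_field I) \<Longrightarrow> (\<lambda>i. f i + g i) \<in> carrier (free_module rat_field I)"
    and "(\<lambda>i. r * f i) \<in> carrier (free_module rat_field I)"
proof -
  show "(\<lambda>i. f i + g i) \<in> carrier (free_module rat_field I)" if "g \<in> carrier (free_module rat_field I)"
  proof -
    have "{i. f i + g i \<noteq> 0} \<subseteq> {i. f i \<noteq> 0} \<union> {i. g i \<noteq> 0}" by auto
    then show ?thesis using assms that unfolding free_module_iff
      by (meson Un_least finite_UnI finite_subset order_trans)
  qed
  have "{i. r * f i \<noteq> 0} \<subseteq> {i. f i \<noteq> 0}" by auto
  then show "(\<lambda>i. r * f i) \<in> carrier (free_module rat_field I)"
    using assms unfolding free_module_iff by (meson finite_subset order_trans)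
qed

lemma abelian_group_free_module: "abelian_group (free_module rat_field I)"
proof (rule abelian_groupI)
  fix f assume f: "f \<in> carrier (free_module rat_field I)"
  show "\<exists>g\<in>carrier (free_module rat_field I). g \<oplus>\<^bsub>free_module rat_field I\<^esub> f = \<zero>\<^bsub>free_module rat_field I\<^esub>"
    by (rule bexI[OF _ free_module_closed(2)[OF f, of "- 1"]]) (simp add: free_module_simps)
qed (auto simp: free_module_simps free_module_closed add.assoc add.commute, simp_all add: free_module_iff)

lemma free_module_minus:
  assumes "f \<in> carrier (free_module rat_field I)" "g \<in> carrier (free_module rat_field I)"
  shows "f \<ominus>\<^bsub>free_module rat_field I\<^esub> g = (\<lambda>i. f i - g i)"
proof -
  have "\<ominus>\<^bsub>free_module rat_field I\<^esub> g = (\<lambda>i. - 1 * g i)"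
    by (rule abelian_group.minus_equality[OF abelian_group_free_module])
       (use assms(2) free_module_closed(2)[OF assms(2), of "- 1"] in \<open>auto simp: free_module_simps\<close>)
  then show ?thesis by (simp add: a_minus_def free_module_simps)
qed

lemma submodule_free_module:
  assumes "K \<subseteq> carrier (free_module rat_field I)" "(\<lambda>i. 0) \<in> K"
    "\<And>f g. f \<in> K \<Longrightarrow> g \<in> K \<Longrightarrow> (\<lambda>i. f i + g i) \<in> K" "\<And>r f. f \<in> K \<Longrightarrow> (\<lambda>i. r * f i) \<in> K"
  shows "submodule K rat_field (free_module rat_field I)"
proof -
  let ?F = "free_module rat_field I"
  have "subgroup K (add_monoid ?F)"
  proof (rule group.subgroupI)
    show "Group.group (add_monoid ?F)"
      using abelian_group_free_module[of I] by (simp add: abelian_group_def abelian_group_axioms_def comm_group_def)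
    fix f assume f: "f \<in> K"
    have "\<ominus>\<^bsub>?F\<^esub> f = (\<lambda>i. - 1 * f i)"
      by (rule abelian_group.minus_equality[OF abelian_group_free_module])
         (use f assms(1) assms(4)[OF f, of "- 1"] in \<open>auto simp: free_module_simps\<close>)
    then show "inv\<^bsub>add_monoid ?F\<^esub> f \<in> K" using assms(4)[OF f, of "- 1"] by (simp add: a_inv_def)
  qed (use assms in \<open>auto simp: free_module_simps\<close>)
  then show ?thesis
    unfolding submodule_def submodule_axioms_def using assms(4) by (simp add: free_module_simps)
qed

lemma submodule_free_moduleD:
  assumes "submodule K rat_field (free_module rat_field I)"
  shows "K \<subseteq> carrier (free_module rat_field I)" "(\<lambda>i. 0) \<in> K"
    "\<And>f g. f \<in> K \<Longrightarrow> g \<in> K \<Longrightarrow> (\<lambda>i. f i + g i) \<in> K" "\<And>r f. f \<in> K \<Longrightarrow> (\<lambda>i. r * f i) \<in> K"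
proof -
  have sg: "subgroup K (add_monoid (free_module rat_field I))"
    using assms by (simp add: submodule_def)
  show "K \<subseteq> carrier (free_module rat_field I)" "(\<lambda>i. 0) \<in> K"
    "\<And>f g. f \<in> K \<Longrightarrow> g \<in> K \<Longrightarrow> (\<lambda>i. f i + g i) \<in> K"
    using subgroup.subset[OF sg] subgroup.one_closed[OF sg] subgroup.m_closed[OF sg]
    by (simp_all add: free_module_simps)
  show "(\<lambda>i. r * f i) \<in> K" if "f \<in> K" for r f
    using submodule.smult_closed[OF assms, of r f] that by (simp add: free_module_simps)
qed

abbreviation tensor_gen :: "'a \<times> 'b \<Rightarrow> 'a \<times> 'b \<Rightarrow> rat" where
  "tensor_gen \<equiv> free_gen rat_field"

lemma tensor_gen_apply: "tensor_gen i j = (if j = i then 1 else 0)"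
  by (simp add: free_gen_def)

lemma tensor_gen_carrier: "i \<in> I \<Longrightarrow> tensor_gen i \<in> carrier (free_module rat_field I)"
  by (auto simp: free_module_iff tensor_gen_apply)

text \<open>\<open>c\<close> is a linear coordinate on \<open>N\<close>, which is at most one-dimensional, and \<open>\<mu>\<close> realises \<open>M\<close>
  by functions, so that the map \<open>x \<otimes> y \<mapsto> c y \<cdot> \<mu> x\<close> out of the free module is an ordinary sum.\<close>

locale tensor_with_line =
  fixes M :: "(rat, 'a) module" and N :: "(rat, 'b) module" and A :: "'g monoid"
    and \<mu> :: "'a \<Rightarrow> 'g \<Rightarrow> rat" and c :: "'b \<Rightarrow> rat" and n1 :: 'b
  assumes A: "Group.group A"
    and \<mu>: "bij_betw \<mu> (carrier M) (carrier (hom_module A))"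
      "\<And>x y. x \<in> carrier M \<Longrightarrow> y \<in> carrier M \<Longrightarrow> \<mu> (x \<oplus>\<^bsub>M\<^esub> y) = \<mu> x \<oplus>\<^bsub>hom_module A\<^esub> \<mu> y"
      "\<And>r x. x \<in> carrier M \<Longrightarrow> \<mu> (r \<odot>\<^bsub>M\<^esub> x) = r \<odot>\<^bsub>hom_module A\<^esub> \<mu> x"
    and M: "module_closed rat_field M"
    and c: "inj_on c (carrier N)"
      "\<And>x y. x \<in> carrier N \<Longrightarrow> y \<in> carrier N \<Longrightarrow> c (x \<oplus>\<^bsub>N\<^esub> y) = c x + c y"
      "\<And>r x. x \<in> carrier N \<Longrightarrow> c (r \<odot>\<^bsub>N\<^esub> x) = r * c x"
    and N: "module_closed rat_field N"
    and n1: "n1 \<in> carrier N" "c n1 = 1"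
begin

definition F where "F = free_module rat_field (carrier M \<times> carrier N)"
definition K where "K = generated_submodule rat_field F (bilinear_relations rat_field M N)"
definition L where "L f = (\<lambda>a\<in>carrier A. \<Sum>i\<in>{i. f i \<noteq> 0}. f i * (c (snd i) * \<mu> (fst i) a))"

lemma \<mu>_carrier: "x \<in> carrier M \<Longrightarrow> \<mu> x \<in> carrier (hom_module A)"
  using bij_betwE[OF \<mu>(1)] by blast

lemma L_eq:
  assumes "finite S" "{i. f i \<noteq> 0} \<subseteq> S" "a \<in> carrier A"
  shows "L f a = (\<Sum>i\<in>S. f i * (c (snd i) * \<mu> (fst i) a))"
  using assms by (auto simp: L_def intro!: sum.mono_neutral_left)

lemma L_gen:
  assumes "a \<in> carrier A"
  shows "L (tensor_gen (x, y)) a = c y * \<mu> x a"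
  using L_eq[of "{(x, y)}" "tensor_gen (x, y)" a] assms by (auto simp: tensor_gen_apply)

lemma L_add:
  assumes "f \<in> carrier F" "g \<in> carrier F" "a \<in> carrier A"
  shows "L (\<lambda>i. f i + g i) a = L f a + L g a"
proof -
  let ?S = "{i. f i \<noteq> 0} \<union> {i. g i \<noteq> 0}"
  have S: "finite ?S" using assms by (simp add: F_def free_module_iff)
  have sub: "{i. f i \<noteq> 0} \<subseteq> ?S" "{i. g i \<noteq> 0} \<subseteq> ?S" "{i. f i + g i \<noteq> 0} \<subseteq> ?S" by auto
  show ?thesis
    unfolding L_eq[OF S sub(1) assms(3)] L_eq[OF S sub(2) assms(3)] L_eq[OF S sub(3) assms(3)]
    by (simp add: sum.distrib[symmetric] distrib_right)
qed

lemma L_scale: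
  assumes "f \<in> carrier F" "a \<in> carrier A"
  shows "L (\<lambda>i. r * f i) a = r * L f a"
proof -
  have S: "finite {i. f i \<noteq> 0}" using assms by (simp add: F_def free_module_iff)
  show ?thesis
    using L_eq[OF S _ assms(2), of f] L_eq[OF S _ assms(2), of "\<lambda>i. r * f i"]
    by (auto simp: sum_distrib_left algebra_simps)
qed

lemma L_carrier:
  assumes "f \<in> carrier F"
  shows "L f \<in> carrier (hom_module A)"
proof -
  have "L f (a \<otimes>\<^bsub>A\<^esub> b) = L f a + L f b" if ab: "a \<in> carrier A" "b \<in> carrier A" for a b
  proof -
    have "a \<otimes>\<^bsub>A\<^esub> b \<in> carrier A" using ab monoid.m_closed[OF group.is_monoid[OF A]] by blast
    moreover have "\<mu> (fst i) (a \<otimes>\<^bsub>A\<^esub> b) = \<mu> (fst i) a + \<mu> (fst i) b" if "f i \<noteq> 0" for i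
    proof -
      have "fst i \<in> carrier M" using that assms by (force simp: F_def free_module_iff)
      from \<mu>_carrier[OF this] show ?thesis using ab by (simp add: hom_module_iff)
    qed
    ultimately show ?thesis
      using ab by (simp add: L_def sum.distrib[symmetric] algebra_simps)
  qed
  then show ?thesis by (simp add: hom_module_iff L_def[abs_def])
qed

lemma gen_F: "x \<in> carrier M \<Longrightarrow> y \<in> carrier N \<Longrightarrow> tensor_gen (x, y) \<in> carrier F"
  by (simp add: F_def tensor_gen_carrier)

lemma M_closed: "x \<in> carrier M \<Longrightarrow> y \<in> carrier M \<Longrightarrow> x \<oplus>\<^bsub>M\<^esub> y \<in> carrier M"
    "x \<in> carrier M \<Longrightarrow> r \<odot>\<^bsub>M\<^esub> x \<in> carrier M"
  and N_closed: "x' \<in> carrier N \<Longrightarrow> y' \<in> carrier N \<Longrightarrow> x' \<oplus>\<^bsub>N\<^esub> y' \<in> carrier N"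
    "x' \<in> carrier N \<Longrightarrow> r \<odot>\<^bsub>N\<^esub> x' \<in> carrier N"
  using M N by (auto simp: module_closed_def)

lemma F_closed: "f \<in> carrier F \<Longrightarrow> g \<in> carrier F \<Longrightarrow> (\<lambda>i. f i + g i) \<in> carrier F"
  "f \<in> carrier F \<Longrightarrow> (\<lambda>i. r * f i) \<in> carrier F"
  by (simp_all add: F_def free_module_closed)

text \<open>This will turn out to be \<open>K\<close>. One inclusion is formal, by minimality of the
  generated submodule; the other needs a normal form.\<close>

definition kernel_L where "kernel_L = {f \<in> carrier F. L f = \<zero>\<^bsub>hom_module A\<^esub>}"

lemma kernel_L_iff: "f \<in> kernel_L \<longleftrightarrow> f \<in> carrier F \<and> (\<forall>a\<in>carrier A. L f a = 0)"
  by (auto simp: kernel_L_def hom_module_simps fun_eq_iff L_def)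

lemma submodule_kernel_L: "submodule kernel_L rat_field F"
  unfolding F_def
proof (rule submodule_free_module)
  show "kernel_L \<subseteq> carrier (free_module rat_field (carrier M \<times> carrier N))"
    by (auto simp: kernel_L_def F_def)
  have "(\<lambda>i. 0) \<in> carrier F" by (simp add: F_def free_module_iff)
  then show "(\<lambda>i. 0) \<in> kernel_L" by (simp add: kernel_L_iff L_def)
qed (auto simp: kernel_L_iff L_add L_scale F_closed)

lemma F_minus: "f \<in> carrier F \<Longrightarrow> g \<in> carrier F \<Longrightarrow> f \<ominus>\<^bsub>F\<^esub> g = (\<lambda>i. f i - g i)"
  and F_simps: "f \<oplus>\<^bsub>F\<^esub> g = (\<lambda>i. f i + g i)" "r \<odot>\<^bsub>F\<^esub> f = (\<lambda>i. r * f i)"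
  by (simp_all add: F_def free_module_minus free_module_simps)

lemma diff_kernel_L:
  assumes "f \<in> carrier F" "g \<in> carrier F" "\<And>a. a \<in> carrier A \<Longrightarrow> L f a = L g a"
  shows "f \<ominus>\<^bsub>F\<^esub> g \<in> kernel_L"
proof -
  have "L (\<lambda>i. f i + - 1 * g i) a = 0" if "a \<in> carrier A" for a
    using L_add[OF assms(1) F_closed(2)[OF assms(2)] that, of "- 1"] L_scale[OF assms(2) that, of "- 1"]
      assms(3)[OF that] by simp
  moreover have "(\<lambda>i. f i + - 1 * g i) \<in> carrier F" by (intro F_closed assms)
  ultimately show ?thesis using assms by (simp add: kernel_L_iff F_minus)
qed

lemma relations_kernel_L: "bilinear_relations rat_field M N \<subseteq> kernel_L"
proof -
  have \<mu>a: "\<mu> (x \<oplus>\<^bsub>M\<^esub> x') a = \<mu> x a + \<mu> x' a" if "x \<in> carrier M" "x' \<in> carrier M" "a \<in> carrier A" for x x' a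
    using that \<mu>(2) by (simp add: hom_module_simps)
  have \<mu>s: "\<mu> (r \<odot>\<^bsub>M\<^esub> x) a = r * \<mu> x a" if "x \<in> carrier M" "a \<in> carrier A" for r x a
    using that \<mu>(3) by (simp add: hom_module_simps)
  have 1: "tensor_gen (x \<oplus>\<^bsub>M\<^esub> x', y) \<ominus>\<^bsub>F\<^esub> (tensor_gen (x, y) \<oplus>\<^bsub>F\<^esub> tensor_gen (x', y)) \<in> kernel_L"
    if "x \<in> carrier M" "x' \<in> carrier M" "y \<in> carrier N" for x x' y
    using that by (intro diff_kernel_L)
      (auto simp: F_simps gen_F M_closed F_closed L_add L_gen \<mu>a algebra_simps)
  have 2: "tensor_gen (x, y \<oplus>\<^bsub>N\<^esub> y') \<ominus>\<^bsub>F\<^esub> (tensor_gen (x, y) \<oplus>\<^bsub>F\<^esub> tensor_gen (x, y')) \<in> kernel_L"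
    if "x \<in> carrier M" "y \<in> carrier N" "y' \<in> carrier N" for x y y'
    using that by (intro diff_kernel_L)
      (auto simp: F_simps gen_F N_closed F_closed L_add L_gen c algebra_simps)
  have 3: "tensor_gen (r \<odot>\<^bsub>M\<^esub> x, y) \<ominus>\<^bsub>F\<^esub> r \<odot>\<^bsub>F\<^esub> tensor_gen (x, y) \<in> kernel_L"
    if "x \<in> carrier M" "y \<in> carrier N" for r x y
    using that by (intro diff_kernel_L)
      (auto simp: F_simps gen_F M_closed F_closed L_scale L_gen \<mu>s algebra_simps)
  have 4: "tensor_gen (x, r \<odot>\<^bsub>N\<^esub> y) \<ominus>\<^bsub>F\<^esub> r \<odot>\<^bsub>F\<^esub> tensor_gen (x, y) \<in> kernel_L"
    if "x \<in> carrier M" "y \<in> carrier N" for r x y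
    using that by (intro diff_kernel_L)
      (auto simp: F_simps gen_F N_closed F_closed L_scale L_gen c algebra_simps)
  show ?thesis
    unfolding bilinear_relations_def Let_def F_def[symmetric]
    using 1 2 3 4 by blast
qed

lemma K_subset: "K \<subseteq> kernel_L"
  unfolding K_def generated_submodule_def
  using submodule_kernel_L relations_kernel_L by blast

lemma relations_K: "bilinear_relations rat_field M N \<subseteq> K"
  by (auto simp: K_def generated_submodule_def)

lemma K_closed: "f \<in> K \<Longrightarrow> g \<in> K \<Longrightarrow> (\<lambda>i. f i + g i) \<in> K" "f \<in> K \<Longrightarrow> (\<lambda>i. r * f i) \<in> K"
  unfolding K_def generated_submodule_def
  using submodule_free_moduleD[of _ "carrier M \<times> carrier N"] by (auto simp: F_def)

lemma K_rel_add:
  assumes "x \<in> carrier M" "x' \<in> carrier M" "y \<in> carrier N"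
  shows "(\<lambda>i. tensor_gen (x \<oplus>\<^bsub>M\<^esub> x', y) i - (tensor_gen (x, y) i + tensor_gen (x', y) i)) \<in> K"
proof -
  have "tensor_gen (x \<oplus>\<^bsub>M\<^esub> x', y) \<ominus>\<^bsub>F\<^esub> (tensor_gen (x, y) \<oplus>\<^bsub>F\<^esub> tensor_gen (x', y)) \<in> K"
    by (rule subsetD[OF relations_K])
       (use assms in \<open>unfold bilinear_relations_def Let_def F_def[symmetric], blast\<close>)
  then show ?thesis using assms by (simp add: F_minus F_simps gen_F M_closed F_closed)
qed

lemma K_rel_smult_left:
  assumes "x \<in> carrier M" "y \<in> carrier N"
  shows "(\<lambda>i. tensor_gen (r \<odot>\<^bsub>M\<^esub> x, y) i - r * tensor_gen (x, y) i) \<in> K"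
proof -
  have "r \<in> carrier rat_field" by simp
  then have "tensor_gen (r \<odot>\<^bsub>M\<^esub> x, y) \<ominus>\<^bsub>F\<^esub> r \<odot>\<^bsub>F\<^esub> tensor_gen (x, y) \<in> K"
    by (intro subsetD[OF relations_K])
       (use assms in \<open>unfold bilinear_relations_def Let_def F_def[symmetric], blast\<close>)
  then show ?thesis using assms by (simp add: F_minus F_simps gen_F M_closed F_closed)
qed

lemma K_rel_smult_right:
  assumes "x \<in> carrier M" "y \<in> carrier N"
  shows "(\<lambda>i. tensor_gen (x, r \<odot>\<^bsub>N\<^esub> y) i - r * tensor_gen (x, y) i) \<in> K"
proof -
  have "r \<in> carrier rat_field" by simp
  then have "tensor_gen (x, r \<odot>\<^bsub>N\<^esub> y) \<ominus>\<^bsub>F\<^esub> r \<odot>\<^bsub>F\<^esub> tensor_gen (x, y) \<in> K"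
    by (intro subsetD[OF relations_K])
       (use assms in \<open>unfold bilinear_relations_def Let_def F_def[symmetric], blast\<close>)
  then show ?thesis using assms by (simp add: F_minus F_simps gen_F N_closed F_closed)
qed

text \<open>The zero of \<open>M\<close> is reached through \<open>\<mu>\<close>: \<open>m0\<close>
  is the preimage of the zero homomorphism, so \<open>0 \<odot> m0 = m0\<close>, and the relation
  for the scalar 0 is the generator itself.\<close>

lemma K_zero:
  obtains m0 where "m0 \<in> carrier M" "\<And>a. a \<in> carrier A \<Longrightarrow> \<mu> m0 a = 0" "tensor_gen (m0, n1) \<in> K"
proof -
  have "\<zero>\<^bsub>hom_module A\<^esub> \<in> carrier (hom_module A)"
    by (rule abelian_monoid.zero_closed[OF abelian_group.axioms(1)[OF abelian_group_hom_module[OF A]]])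
  then obtain m0 where m0: "m0 \<in> carrier M" "\<mu> m0 = \<zero>\<^bsub>hom_module A\<^esub>"
    using \<mu>(1) unfolding bij_betw_def by (metis imageE)
  have "\<mu> (0 \<odot>\<^bsub>M\<^esub> m0) = \<mu> m0"
    using m0 \<mu>(3) by (simp add: hom_module_simps)
  then have "0 \<odot>\<^bsub>M\<^esub> m0 = m0"
    using m0 \<mu>(1) M_closed by (metis bij_betw_def inj_onD)
  then have "tensor_gen (m0, n1) \<in> K" using K_rel_smult_left[OF m0(1) n1(1), of 0] by simp
  with m0 show thesis using that[of m0] by (simp add: hom_module_simps)
qed

text \<open>Every \<open>y\<close> is the multiple \<open>c y\<close> of \<open>n1\<close>, so
  scalars move to the left factor and a whole sum collapses to a single tensor with
  \<open>n1\<close>.\<close>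

lemma K_normal_form:
  assumes "f \<in> carrier F"
  shows "\<exists>m\<in>carrier M. (\<lambda>i. f i - tensor_gen (m, n1) i) \<in> K"
proof -
  have *: "\<exists>m\<in>carrier M. (\<lambda>i. f i - tensor_gen (m, n1) i) \<in> K"
    if "finite S" "f \<in> carrier F" "{i. f i \<noteq> 0} \<subseteq> S" for S f
    using that
  proof (induction S arbitrary: f rule: finite_induct)
    case empty
    obtain m0 where m0: "m0 \<in> carrier M" "tensor_gen (m0, n1) \<in> K" using K_zero by blast
    have "(\<lambda>i. f i - tensor_gen (m0, n1) i) = (\<lambda>i. - 1 * tensor_gen (m0, n1) i)"
      using empty by (auto simp: fun_eq_iff)
    then have "(\<lambda>i. f i - tensor_gen (m0, n1) i) \<in> K"
      using K_closed(2)[OF m0(2), of "- 1"] by simp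
    then show ?case using m0(1) by blast
  next
    case (insert i S)
    show ?case
    proof (cases "f i = 0")
      case True
      then have "{j. f j \<noteq> 0} \<subseteq> S" using insert.prems(2) by auto
      then show ?thesis using insert.IH[OF insert.prems(1)] by blast
    next
      case False
      then have "i \<in> carrier M \<times> carrier N" using insert.prems(1) by (auto simp: F_def free_module_iff)
      then obtain x y where i: "i = (x, y)" and xy: "x \<in> carrier M" "y \<in> carrier N" by blast
      define g where "g = f(i := 0)"
      have "{j. g j \<noteq> 0} \<subseteq> {j. f j \<noteq> 0}" by (auto simp: g_def)
      then have "g \<in> carrier F"
        using insert.prems(1) unfolding F_def free_module_iff by (meson finite_subset order_trans)
      moreover have "{j. g j \<noteq> 0} \<subseteq> S" using insert.prems(2) by (auto simp: g_def)
      ultimately obtain m where m: "m \<in> carrier M" "(\<lambda>j. g j - tensor_gen (m, n1) j) \<in> K"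
        using insert.IH by blast
      \<comment> \<open>\<open>c\<close> is injective and takes the same value on both
        sides.\<close>
      have y: "y = c y \<odot>\<^bsub>N\<^esub> n1"
        using c(1) xy(2) N_closed(2)[OF n1(1), of "c y"] c(3)[OF n1(1), of "c y"] n1(2)
        by (simp add: inj_on_def)
      obtain r where r: "f i = r" by blast
      define m' where "m' = (r * c y) \<odot>\<^bsub>M\<^esub> x"
      have m': "m' \<in> carrier M" using xy(1) M_closed by (simp add: m'_def)
      have 1: "(\<lambda>j. tensor_gen (x, y) j - c y * tensor_gen (x, n1) j) \<in> K"
        using K_rel_smult_right[OF xy(1) n1(1), of "c y"] y by simp
      have 2: "(\<lambda>j. tensor_gen (m', n1) j - (r * c y) * tensor_gen (x, n1) j) \<in> K"
        unfolding m'_def by (rule K_rel_smult_left[OF xy(1) n1(1)])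
      have 3: "(\<lambda>j. tensor_gen (m \<oplus>\<^bsub>M\<^esub> m', n1) j - (tensor_gen (m, n1) j + tensor_gen (m', n1) j)) \<in> K"
        by (rule K_rel_add[OF m(1) m' n1(1)])
      \<comment> \<open>Multiples of the three relations are added so that every generator cancels
        except the one at \<open>(x, y)\<close>, completing \<open>g\<close> to \<open>f\<close>,
        and the new normal form.\<close>
      have "(\<lambda>j. g j - tensor_gen (m, n1) j
          + (r * (tensor_gen (x, y) j - c y * tensor_gen (x, n1) j)
          + (- 1 * (tensor_gen (m', n1) j - (r * c y) * tensor_gen (x, n1) j)
          + - 1 * (tensor_gen (m \<oplus>\<^bsub>M\<^esub> m', n1) j - (tensor_gen (m, n1) j + tensor_gen (m', n1) j))))) \<in> K"
        (is "?h \<in> K")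
        by (intro K_closed m(2) 1 2 3)
      moreover have "f j = g j + r * tensor_gen (x, y) j" for j
        using r by (simp add: g_def i tensor_gen_apply)
      then have "?h = (\<lambda>j. f j - tensor_gen (m \<oplus>\<^bsub>M\<^esub> m', n1) j)"
        by (intro ext) (simp add: right_diff_distrib)
      ultimately have "(\<lambda>j. f j - tensor_gen (m \<oplus>\<^bsub>M\<^esub> m', n1) j) \<in> K" by (simp only:)
      then show ?thesis using M_closed(1)[OF m(1) m'] by blast
    qed
  qed
  show ?thesis using *[of "{i. f i \<noteq> 0}" f] assms by (simp add: F_def free_module_iff)
qed

text \<open>A kernel element is congruent to one generator \<open>(m, n1)\<close>, on which
  \<open>L\<close> is \<open>\<mu> m\<close>; injectivity of \<open>\<mu>\<close> identifies
  \<open>m\<close> with \<open>m0\<close>.\<close>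

lemma K_eq_kernel_L: "K = kernel_L"
proof
  show "kernel_L \<subseteq> K"
  proof
    fix f assume f: "f \<in> kernel_L"
    then have fF: "f \<in> carrier F" by (simp add: kernel_L_iff)
    obtain m where m: "m \<in> carrier M" "(\<lambda>i. f i - tensor_gen (m, n1) i) \<in> K"
      using K_normal_form[OF fF] by blast
    obtain m0 where m0: "m0 \<in> carrier M" "\<And>a. a \<in> carrier A \<Longrightarrow> \<mu> m0 a = 0" "tensor_gen (m0, n1) \<in> K"
      using K_zero by blast
    have "(\<lambda>i. f i + - 1 * tensor_gen (m, n1) i) \<in> kernel_L" using m(2) K_subset by auto
    then have "\<mu> m a = 0" if a: "a \<in> carrier A" for a
      using L_add[OF fF F_closed(2)[OF gen_F[OF m(1) n1(1)]] a, of "- 1"]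
        L_scale[OF gen_F[OF m(1) n1(1)] a, of "- 1"] L_gen[OF a, of m n1] f a n1(2)
      by (simp add: kernel_L_iff)
    then have "\<mu> m a = \<mu> m0 a" for a
      using m0(2) \<mu>_carrier[OF m(1)] \<mu>_carrier[OF m0(1)]
      by (cases "a \<in> carrier A") (simp_all add: hom_module_iff extensional_def)
    then have "\<mu> m = \<mu> m0" by (rule ext)
    then have "m = m0" using \<mu>(1) m(1) m0(1) by (simp add: bij_betw_def inj_on_def)
    with K_closed(1)[OF m(2) m0(3)] show "f \<in> K" by simp
  qed
qed (rule K_subset)

lemma tensor_isomorphic:
  "module_isomorphic rat_field (tensor_product rat_field M N) (hom_module A) \<and>
   module_closed rat_field (tensor_product rat_field M N)"
  unfolding tensor_product_def Let_def F_def[symmetric] K_def[symmetric]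
proof (rule quotient_module_isomorphic_closed)
  show "abelian_group F" by (simp add: F_def abelian_group_free_module)
  show "abelian_group (hom_module A)" by (rule abelian_group_hom_module[OF A])
  show "K = {x \<in> carrier F. L x = \<zero>\<^bsub>hom_module A\<^esub>}"
    unfolding K_eq_kernel_L by (simp add: kernel_L_def)
  fix g assume g: "g \<in> carrier (hom_module A)"
  then obtain x where x: "x \<in> carrier M" "\<mu> x = g"
    using \<mu>(1) unfolding bij_betw_def by (metis imageE)
  have "L (tensor_gen (x, n1)) = g"
  proof
    fix a
    show "L (tensor_gen (x, n1)) a = g a"
      using g x n1(2) by (cases "a \<in> carrier A") (simp add: L_gen, simp add: L_def hom_module_iff extensional_def)
  qed
  then show "\<exists>f\<in>carrier F. L f = g" using gen_F[OF x(1) n1(1)] by blast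
next
  fix f g assume "f \<in> carrier F" "g \<in> carrier F"
  then have "L (\<lambda>i. f i + g i) a = (\<lambda>a\<in>carrier A. L f a + L g a) a" for a
    by (cases "a \<in> carrier A") (simp add: L_add, simp add: L_def)
  then show "L (f \<oplus>\<^bsub>F\<^esub> g) = L f \<oplus>\<^bsub>hom_module A\<^esub> L g"
    unfolding F_simps hom_module_simps by (rule ext)
next
  fix r f assume "f \<in> carrier F"
  then have "L (\<lambda>i. r * f i) a = (\<lambda>a\<in>carrier A. r * L f a) a" for a
    by (cases "a \<in> carrier A") (simp add: L_scale, simp add: L_def)
  then show "L (r \<odot>\<^bsub>F\<^esub> f) = r \<odot>\<^bsub>hom_module A\<^esub> L f"
    unfolding F_simps hom_module_simps by (rule ext)
qed (simp_all add: L_carrier F_simps F_closed)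

end

lemma abelian_group_singleton_hom: "abelian_group (hom_module (singleton_group ()))"
  by (rule abelian_group_hom_module) simp

lemma hom_module_trivial_group:
  assumes "trivial_group A"
  shows "carrier (hom_module A) = {\<zero>\<^bsub>hom_module A\<^esub>}"
proof
  have A: "Group.group A" "carrier A = {\<one>\<^bsub>A\<^esub>}" using assms by (simp_all add: trivial_group_def)
  show "carrier (hom_module A) \<subseteq> {\<zero>\<^bsub>hom_module A\<^esub>}"
  proof
    fix \<phi> assume \<phi>: "\<phi> \<in> carrier (hom_module A)"
    have "\<phi> a = \<zero>\<^bsub>hom_module A\<^esub> a" for a
      using hom_module_one[OF A(1) \<phi>] \<phi> A(2)
      by (cases "a \<in> carrier A") (auto simp: hom_module_iff hom_module_simps extensional_def)
    then show "\<phi> \<in> {\<zero>\<^bsub>hom_module A\<^esub>}" by (simp add: fun_eq_iff)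
  qed
  show "{\<zero>\<^bsub>hom_module A\<^esub>} \<subseteq> carrier (hom_module A)"
    using abelian_monoid.zero_closed[OF abelian_group.axioms(1)[OF abelian_group_hom_module[OF A(1)]]]
    by simp
qed

text \<open>Since \<open>0 \<odot> n0 = n0\<close>, the relation for the scalar 0 is the generator
  \<open>(x, n0)\<close> itself, so the relations generate the whole free module. The dual of the
  one-element group serves as the zero module.\<close>

lemma tensor_trivial:
  fixes M :: "(rat, 'a) module" and N :: "(rat, 'b) module"
  assumes M: "module_closed rat_field M" and N: "carrier N = {n0}" "module_closed rat_field N"
  shows "module_isomorphic rat_field (tensor_product rat_field M N) (hom_module (singleton_group ())) \<and>
    module_closed rat_field (tensor_product rat_field M N)"
proof -
  define F where "F = free_module rat_field (carrier M \<times> carrier N)"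
  define K where "K = generated_submodule rat_field F (bilinear_relations rat_field M N)"
  let ?T = "hom_module (singleton_group ())"
  have T: "carrier ?T = {\<zero>\<^bsub>?T\<^esub>}"
    by (rule hom_module_trivial_group, unfold trivial_group_def, intro conjI singleton_group)
       (simp add: singleton_group_def)
  have n0: "0 \<odot>\<^bsub>N\<^esub> n0 = n0" using N by (simp add: module_closed_def)
  have "carrier F \<subseteq> H" if H: "submodule H rat_field F" "bilinear_relations rat_field M N \<subseteq> H" for H
  proof
    note D = submodule_free_moduleD[OF H(1)[unfolded F_def]]
    have gen: "tensor_gen (x, n0) \<in> H" if x: "x \<in> carrier M" for x
    proof -
      have g: "tensor_gen (x, n0) \<in> carrier F" using x N by (simp add: F_def tensor_gen_carrier)
      have "0 \<in> carrier rat_field" "n0 \<in> carrier N" using N by simp_all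
      then have "tensor_gen (x, 0 \<odot>\<^bsub>N\<^esub> n0) \<ominus>\<^bsub>F\<^esub> 0 \<odot>\<^bsub>F\<^esub> tensor_gen (x, n0) \<in> H"
        by (intro subsetD[OF H(2)])
           (use x in \<open>unfold bilinear_relations_def Let_def F_def[symmetric], blast\<close>)
      then show ?thesis
        using g free_module_closed(2)[OF g[unfolded F_def], of 0] unfolding n0 F_def
        by (simp add: free_module_simps free_module_minus)
    qed
    have *: "f \<in> H" if "finite S" "f \<in> carrier F" "{i. f i \<noteq> 0} \<subseteq> S" for S f
      using that
    proof (induction S arbitrary: f rule: finite_induct)
      case empty
      then have "f = (\<lambda>i. 0)" by auto
      then show ?case using D(2) by simp
    next
      case (insert i S)
      define g where "g = f(i := 0)"
      have "{j. g j \<noteq> 0} \<subseteq> {j. f j \<noteq> 0}" by (auto simp: g_def)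
      then have "g \<in> carrier F"
        using insert.prems(1) unfolding F_def free_module_iff by (meson finite_subset order_trans)
      moreover have "{j. g j \<noteq> 0} \<subseteq> S" using insert.prems(2) by (auto simp: g_def)
      ultimately have g: "g \<in> H" by (rule insert.IH)
      show ?case
      proof (cases "f i = 0")
        case True
        then have "g = f" by (simp add: g_def fun_upd_idem)
        then show ?thesis using g by simp
      next
        case False
        then have "i \<in> carrier M \<times> {n0}" using insert.prems(1) N by (auto simp: F_def free_module_iff)
        then have "tensor_gen i \<in> H" using gen by auto
        from D(3)[OF g D(4)[OF this, of "f i"]]
        have "(\<lambda>j. g j + f i * tensor_gen i j) \<in> H" .
        moreover have "(\<lambda>j. g j + f i * tensor_gen i j) = f"
          by (auto simp: g_def tensor_gen_apply)
        ultimately show ?thesis by simp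
      qed
    qed
    fix f assume "f \<in> carrier F"
    then show "f \<in> H" using *[of "{i. f i \<noteq> 0}" f] by (simp add: F_def free_module_iff)
  qed
  moreover have "submodule (carrier F) rat_field F"
    unfolding F_def by (rule submodule_free_module) (auto simp: free_module_closed, simp add: free_module_iff)
  moreover have "bilinear_relations rat_field M N \<subseteq> carrier F"
    unfolding bilinear_relations_def Let_def F_def[symmetric]
    using M N abelian_group.minus_closed[OF abelian_group_free_module[of "carrier M \<times> carrier N"], folded F_def]
    by (auto intro!: abelian_group.minus_closed[OF abelian_group_free_module[of "carrier M \<times> carrier N"], folded F_def]
        simp: module_closed_def free_module_simps F_def tensor_gen_carrier free_module_closed)
  ultimately have K: "K = carrier F"
    unfolding K_def generated_submodule_def by blast
  have closed: "(\<lambda>i. r * f i) \<in> carrier F" if "f \<in> carrier F" for r f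
    using that by (simp add: F_def free_module_closed)
  show ?thesis
    unfolding tensor_product_def Let_def F_def[symmetric] K_def[symmetric]
  proof (rule quotient_module_isomorphic_closed[where L = "\<lambda>_. \<zero>\<^bsub>?T\<^esub>"])
    have F0: "(\<lambda>_. 0) \<in> carrier F" by (simp add: F_def free_module_iff)
    fix y assume "y \<in> carrier ?T"
    then have "\<zero>\<^bsub>?T\<^esub> = y" using T by simp
    with F0 show "\<exists>x\<in>carrier F. \<zero>\<^bsub>?T\<^esub> = y" by blast
  next
    show "\<zero>\<^bsub>?T\<^esub> \<in> carrier ?T" using T by simp
    show "r \<odot>\<^bsub>F\<^esub> x \<in> carrier F" if "x \<in> carrier F" for r x
      using closed[OF that] by (simp add: F_def free_module_simps)
  qed (simp_all add: K F_def abelian_group_free_module abelian_group_singleton_hom,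
      simp_all add: hom_module_simps fun_eq_iff)
qed

section \<open>Cohomology of a product with the punctured plane\<close>

lemma DirProd_trivial_iso:
  assumes "Group.group A" "trivial_group B"
  shows "A \<times>\<times> B \<cong> A" "B \<times>\<times> A \<cong> A"
proof -
  have B: "carrier B = {\<one>\<^bsub>B\<^esub>}" using assms(2) by (simp add: trivial_group_def)
  have "fst \<in> iso (A \<times>\<times> B) A"
    by (auto simp: iso_def hom_def bij_betw_def inj_on_def B image_iff)
  then show "A \<times>\<times> B \<cong> A" by (rule is_isoI)
  have "snd \<in> iso (B \<times>\<times> A) A"
    by (auto simp: iso_def hom_def bij_betw_def inj_on_def B image_iff)
  then show "B \<times>\<times> A \<cong> A" by (rule is_isoI)
qed

lemma homology_point:
  "homology_group 0 (discrete_topology {()}) \<cong> integer_group"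
  "p \<noteq> 0 \<Longrightarrow> trivial_group (homology_group p (discrete_topology {()}))"
proof -
  show "homology_group 0 (discrete_topology {()}) \<cong> integer_group"
    by (rule isomorphic_integer_zeroth_homology_group)
       (auto simp: path_connected_space_def intro!: exI[of _ "\<lambda>_. ()"] simp: pathin_def)
  show "trivial_group (homology_group p (discrete_topology {()}))" if "p \<noteq> 0"
    by (rule homology_dimension_axiom[where a = "()"]) (use that in auto)
qed

lemma homology_Cstar:
  "homology_group p Cstar_space \<cong>
    homology_group p (discrete_topology {()}) \<times>\<times> homology_group (p - 1) (discrete_topology {()})"
proof -
  have "Cstar_space homeomorphic_space prod_topology (discrete_topology {()}) Cstar_space"
    by (subst homeomorphic_space_sym) (rule prod_topology_homeomorphic_space_right, rule refl)
  then have "homology_group p Cstar_space \<cong> homology_group p (prod_topology (discrete_topology {()}) Cstar_space)"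
    by (rule homeomorphic_space_imp_isomorphic_homology_groups)
  also have "\<dots> \<cong> homology_group p (discrete_topology {()}) \<times>\<times> homology_group (p - 1) (discrete_topology {()})"
    by (rule homology_prod_Cstar)
  finally show ?thesis .
qed

text \<open>Degree 0 sees the first factor of the splitting, degree 1 the second.\<close>

lemma homology_Cstar_low:
  assumes "p = 0 \<or> p = 1"
  shows "homology_group p Cstar_space \<cong> integer_group"
proof -
  let ?P = "discrete_topology {()}"
  have "homology_group p ?P \<times>\<times> homology_group (p - 1) ?P \<cong> homology_group 0 ?P"
    using assms
  proof
    assume p: "p = 0"
    show ?thesis unfolding p by (rule DirProd_trivial_iso(1)) simp_all
  next
    assume p: "p = 1"
    show ?thesis unfolding p diff_self
      by (rule DirProd_trivial_iso(2)) (simp_all add: homology_point(2))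
  qed
  from iso_trans[OF homology_Cstar iso_trans[OF this homology_point(1)]] show ?thesis .
qed

lemma trivial_homology_Cstar_high:
  assumes "p \<ge> 2"
  shows "trivial_group (homology_group p Cstar_space)"
proof -
  let ?P = "discrete_topology {()}"
  have "homology_group p ?P \<times>\<times> homology_group (p - 1) ?P \<cong> homology_group p ?P"
    using assms by (intro DirProd_trivial_iso(1) homology_point(2)) auto
  from iso_trans[OF homology_Cstar this]
  have "homology_group p Cstar_space \<cong> homology_group p ?P" .
  moreover have "trivial_group (homology_group p ?P)"
    using assms by (intro homology_point(2)) simp
  ultimately show ?thesis
    using isomorphic_group_triviality[OF _ group_relative_homology_group group_relative_homology_group] by blast
qed

lemma hom_module_integer_group:
  "bij_betw (\<lambda>\<phi>. \<phi> 1) (carrier (hom_module integer_group)) UNIV"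
proof (rule bij_betw_byWitness[where f' = "\<lambda>q n. of_int n * q"])
  show "\<forall>\<phi>\<in>carrier (hom_module integer_group). (\<lambda>n. of_int n * \<phi> 1) = \<phi>"
  proof (intro ballI ext)
    fix \<phi> n assume \<phi>: "\<phi> \<in> carrier (hom_module integer_group)"
    then have add: "\<phi> (x + y) = \<phi> x + \<phi> y" for x y
      by (simp add: hom_module_iff)
    have 0: "\<phi> 0 = 0" using add[of 0 0] by simp
    have nat: "\<phi> (int k) = of_nat k * \<phi> 1" for k
      by (induction k) (simp_all add: 0 add algebra_simps)
    show "of_int n * \<phi> 1 = \<phi> n"
    proof (cases n)
      case (nonneg k)
      then show ?thesis by (simp add: nat)
    next
      case (neg k)
      have "\<phi> n + \<phi> (int (Suc k)) = 0" using add[of n "int (Suc k)"] neg 0 by simp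
      then have "\<phi> n = - (of_nat (Suc k) * \<phi> 1)" unfolding nat by simp
      then show ?thesis unfolding neg by (simp add: algebra_simps)
    qed
  qed
qed (auto simp: hom_module_iff algebra_simps)

text \<open>The linear coordinate that \<open>tensor_with_line\<close> asks for: the value at the
  generator 1 of the integers.\<close>

lemma cohomology_Cstar_coordinate:
  assumes "q = 0 \<or> q = 1"
  obtains c :: "_ \<Rightarrow> rat" where "bij_betw c (carrier (cohomology q Cstar_space)) UNIV"
    "\<And>x y. x \<in> carrier (cohomology q Cstar_space) \<Longrightarrow> y \<in> carrier (cohomology q Cstar_space) \<Longrightarrow>
      c (x \<oplus>\<^bsub>cohomology q Cstar_space\<^esub> y) = c x + c y"
    "\<And>r x. x \<in> carrier (cohomology q Cstar_space) \<Longrightarrow> c (r \<odot>\<^bsub>cohomology q Cstar_space\<^esub> x) = r * c x"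
proof -
  have "homology_group (int q) Cstar_space \<cong> integer_group"
    using assms by (intro homology_Cstar_low) auto
  then have "module_isomorphic rat_field (cohomology q Cstar_space) (hom_module integer_group)"
    by (intro module_isomorphic_trans[OF conjunct1[OF universal_coefficients]] hom_module_iso
        group_relative_homology_group)
  then obtain f where f: "bij_betw f (carrier (cohomology q Cstar_space)) (carrier (hom_module integer_group))"
    "\<forall>x\<in>carrier (cohomology q Cstar_space). \<forall>y\<in>carrier (cohomology q Cstar_space).
      f (x \<oplus>\<^bsub>cohomology q Cstar_space\<^esub> y) = f x \<oplus>\<^bsub>hom_module integer_group\<^esub> f y"
    "\<forall>r\<in>carrier rat_field. \<forall>x\<in>carrier (cohomology q Cstar_space).
      f (r \<odot>\<^bsub>cohomology q Cstar_space\<^esub> x) = r \<odot>\<^bsub>hom_module integer_group\<^esub> f x"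
    unfolding module_isomorphic_def by blast
  show thesis
    by (rule that[of "(\<lambda>\<phi>. \<phi> 1) \<circ> f"])
       (use f in \<open>auto simp: hom_module_simps intro: bij_betw_trans[OF f(1) hom_module_integer_group]\<close>)
qed

lemma tensor_cohomology_Cstar_low:
  assumes "q = 0 \<or> q = 1"
  shows "module_isomorphic rat_field (hom_module (homology_group (int p) F))
    (tensor_product rat_field (cohomology p F) (cohomology q Cstar_space))"
proof -
  let ?N = "cohomology q Cstar_space"
  obtain c where c: "bij_betw c (carrier ?N) UNIV"
    "\<And>x y. x \<in> carrier ?N \<Longrightarrow> y \<in> carrier ?N \<Longrightarrow> c (x \<oplus>\<^bsub>?N\<^esub> y) = c x + c y"
    "\<And>r x. x \<in> carrier ?N \<Longrightarrow> c (r \<odot>\<^bsub>?N\<^esub> x) = r * c x"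
    using cohomology_Cstar_coordinate[OF assms] by blast
  obtain n1 where n1: "n1 \<in> carrier ?N" "c n1 = 1"
    using c(1) unfolding bij_betw_def by (metis UNIV_I imageE)
  obtain \<mu> where \<mu>: "bij_betw \<mu> (carrier (cohomology p F)) (carrier (hom_module (homology_group (int p) F)))"
    "\<forall>x\<in>carrier (cohomology p F). \<forall>y\<in>carrier (cohomology p F).
      \<mu> (x \<oplus>\<^bsub>cohomology p F\<^esub> y) = \<mu> x \<oplus>\<^bsub>hom_module (homology_group (int p) F)\<^esub> \<mu> y"
    "\<forall>r\<in>carrier rat_field. \<forall>x\<in>carrier (cohomology p F).
      \<mu> (r \<odot>\<^bsub>cohomology p F\<^esub> x) = r \<odot>\<^bsub>hom_module (homology_group (int p) F)\<^esub> \<mu> x"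
    using universal_coefficients[of p F] unfolding module_isomorphic_def by blast
  have "tensor_with_line (cohomology p F) ?N (homology_group (int p) F) \<mu> c n1"
    by (rule tensor_with_line.intro[OF group_relative_homology_group \<mu>(1)])
       (use \<mu>(2,3) c n1 universal_coefficients[of p F] universal_coefficients[of q Cstar_space]
        in \<open>auto simp: bij_betw_def\<close>)
  from tensor_with_line.tensor_isomorphic[OF this] show ?thesis
    by (blast intro: module_isomorphic_sym)
qed

lemma tensor_cohomology_Cstar_high:
  assumes "q \<ge> 2"
  shows "module_isomorphic rat_field (hom_module (singleton_group ()))
    (tensor_product rat_field (cohomology p F) (cohomology q Cstar_space))"
proof -
  let ?N = "cohomology q Cstar_space"
  have "trivial_group (homology_group (int q) Cstar_space)"
    using assms by (intro trivial_homology_Cstar_high) simp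
  then have "carrier (hom_module (homology_group (int q) Cstar_space))
      = {\<zero>\<^bsub>hom_module (homology_group (int q) Cstar_space)\<^esub>}"
    by (rule hom_module_trivial_group)
  moreover obtain f where "bij_betw f (carrier ?N) (carrier (hom_module (homology_group (int q) Cstar_space)))"
    using universal_coefficients[of q Cstar_space] unfolding module_isomorphic_def by blast
  ultimately have "card (carrier ?N) = 1"
    using bij_betw_same_card by fastforce
  then obtain n0 where "carrier ?N = {n0}" by (auto simp: card_1_singleton_iff)
  from tensor_trivial[OF conjunct2[OF universal_coefficients] this conjunct2[OF universal_coefficients]]
  show ?thesis by (blast intro: module_isomorphic_sym)
qed

text \<open>Dualising turns the product of two groups into a sum, and all summands other than
  \<open>i\<close> and \<open>j\<close> are zero. The index \<open>j\<close> may fall outside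
  \<open>I\<close> provided \<open>B\<close> is trivial; degree 0 needs this case.\<close>

lemma hom_module_DirProd:
  assumes A: "Group.group A" and B: "Group.group B"
    and T: "\<And>p. p \<in> I \<Longrightarrow> p \<noteq> i \<Longrightarrow> p \<noteq> j \<Longrightarrow> module_isomorphic rat_field (hom_module (singleton_group ())) (T p)"
    and Ti: "module_isomorphic rat_field (hom_module A) (T i)" and i: "i \<in> I"
    and Tj: "j \<in> I \<Longrightarrow> module_isomorphic rat_field (hom_module B) (T j)" "j \<notin> I \<Longrightarrow> trivial_group B"
    and ij: "i \<noteq> j"
  shows "module_isomorphic rat_field (hom_module (A \<times>\<times> B)) (finite_direct_sum I T)"
proof -
  have triv: "trivial_group (singleton_group ())" unfolding trivial_group_def
    by (intro conjI singleton_group) (simp add: singleton_group_def)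
  have one: "\<one>\<^bsub>A\<^esub> \<in> carrier A" "\<one>\<^bsub>B\<^esub> \<in> carrier B" using A B group.is_monoid monoid.one_closed by blast+
  have Am: "x \<otimes>\<^bsub>A\<^esub> y \<in> carrier A" if "x \<in> carrier A" "y \<in> carrier A" for x y
    using that monoid.m_closed[OF group.is_monoid[OF A]] by blast
  have Bm: "x \<otimes>\<^bsub>B\<^esub> y \<in> carrier B" if "x \<in> carrier B" "y \<in> carrier B" for x y
    using that monoid.m_closed[OF group.is_monoid[OF B]] by blast
  obtain \<alpha> where \<alpha>: "bij_betw \<alpha> (carrier (hom_module A)) (carrier (T i))"
    "\<And>x y. x \<in> carrier (hom_module A) \<Longrightarrow> y \<in> carrier (hom_module A) \<Longrightarrow> \<alpha> (x \<oplus>\<^bsub>hom_module A\<^esub> y) = \<alpha> x \<oplus>\<^bsub>T i\<^esub> \<alpha> y"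
    "\<And>r x. x \<in> carrier (hom_module A) \<Longrightarrow> \<alpha> (r \<odot>\<^bsub>hom_module A\<^esub> x) = r \<odot>\<^bsub>T i\<^esub> \<alpha> x"
    using Ti unfolding module_isomorphic_def by auto
  have "\<exists>\<beta>. j \<in> I \<longrightarrow> (bij_betw \<beta> (carrier (hom_module B)) (carrier (T j)) \<and>
    (\<forall>x\<in>carrier (hom_module B). \<forall>y\<in>carrier (hom_module B). \<beta> (x \<oplus>\<^bsub>hom_module B\<^esub> y) = \<beta> x \<oplus>\<^bsub>T j\<^esub> \<beta> y) \<and>
    (\<forall>r. \<forall>x\<in>carrier (hom_module B). \<beta> (r \<odot>\<^bsub>hom_module B\<^esub> x) = r \<odot>\<^bsub>T j\<^esub> \<beta> x))"
    using Tj(1) unfolding module_isomorphic_def by auto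
  then obtain \<beta> where \<beta>: "j \<in> I \<Longrightarrow> bij_betw \<beta> (carrier (hom_module B)) (carrier (T j))"
    "\<And>x y. j \<in> I \<Longrightarrow> x \<in> carrier (hom_module B) \<Longrightarrow> y \<in> carrier (hom_module B) \<Longrightarrow>
      \<beta> (x \<oplus>\<^bsub>hom_module B\<^esub> y) = \<beta> x \<oplus>\<^bsub>T j\<^esub> \<beta> y"
    "\<And>r x. j \<in> I \<Longrightarrow> x \<in> carrier (hom_module B) \<Longrightarrow> \<beta> (r \<odot>\<^bsub>hom_module B\<^esub> x) = r \<odot>\<^bsub>T j\<^esub> \<beta> x"
    by blast
  have "\<exists>t. carrier (T p) = {t} \<and> t \<oplus>\<^bsub>T p\<^esub> t = t \<and> (\<forall>r. r \<odot>\<^bsub>T p\<^esub> t = t)"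
    if p: "p \<in> I" "p \<noteq> i" "p \<noteq> j" for p
  proof -
    let ?S = "hom_module (singleton_group ())"
    have S: "carrier ?S = {\<zero>\<^bsub>?S\<^esub>}" by (rule hom_module_trivial_group[OF triv])
    obtain h where h: "bij_betw h (carrier ?S) (carrier (T p))"
      "\<forall>x\<in>carrier ?S. \<forall>y\<in>carrier ?S. h (x \<oplus>\<^bsub>?S\<^esub> y) = h x \<oplus>\<^bsub>T p\<^esub> h y"
      "\<forall>r\<in>carrier rat_field. \<forall>x\<in>carrier ?S. h (r \<odot>\<^bsub>?S\<^esub> x) = r \<odot>\<^bsub>T p\<^esub> h x"
      using T[OF p] unfolding module_isomorphic_def by blast
    have "\<zero>\<^bsub>?S\<^esub> \<oplus>\<^bsub>?S\<^esub> \<zero>\<^bsub>?S\<^esub> = \<zero>\<^bsub>?S\<^esub>" "r \<odot>\<^bsub>?S\<^esub> \<zero>\<^bsub>?S\<^esub> = \<zero>\<^bsub>?S\<^esub>" for r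
      by (auto simp: hom_module_simps)
    then have "h \<zero>\<^bsub>?S\<^esub> \<oplus>\<^bsub>T p\<^esub> h \<zero>\<^bsub>?S\<^esub> = h \<zero>\<^bsub>?S\<^esub>" "\<forall>r. r \<odot>\<^bsub>T p\<^esub> h \<zero>\<^bsub>?S\<^esub> = h \<zero>\<^bsub>?S\<^esub>"
      using h(2,3) S by (metis insertI1, metis insertI1 UNIV_I rat_field_simps(1))
    moreover have "carrier (T p) = {h \<zero>\<^bsub>?S\<^esub>}" using h(1) S by (auto simp: bij_betw_def)
    ultimately show ?thesis by blast
  qed
  then obtain \<tau> where \<tau>: "\<And>p. p \<in> I \<Longrightarrow> p \<noteq> i \<Longrightarrow> p \<noteq> j \<Longrightarrow>
      carrier (T p) = {\<tau> p} \<and> \<tau> p \<oplus>\<^bsub>T p\<^esub> \<tau> p = \<tau> p \<and> (\<forall>r. r \<odot>\<^bsub>T p\<^esub> \<tau> p = \<tau> p)" by metis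
  \<comment> \<open>The restrictions to the two factors. They determine the homomorphism, as a pair
    is the product of its two components paired with identities.\<close>
  define fA where "fA \<phi> = (\<lambda>a\<in>carrier A. \<phi> (a, \<one>\<^bsub>B\<^esub>))" for \<phi> :: "_ \<Rightarrow> rat"
  define fB where "fB \<phi> = (\<lambda>b\<in>carrier B. \<phi> (\<one>\<^bsub>A\<^esub>, b))" for \<phi> :: "_ \<Rightarrow> rat"
  define \<Psi> where "\<Psi> \<phi> = (\<lambda>p\<in>I. if p = i then \<alpha> (fA \<phi>) else if p = j then \<beta> (fB \<phi>) else \<tau> p)" for \<phi>
  let ?H = "hom_module (A \<times>\<times> B)"
  have oneA: "x \<otimes>\<^bsub>A\<^esub> \<one>\<^bsub>A\<^esub> = x" "\<one>\<^bsub>A\<^esub> \<otimes>\<^bsub>A\<^esub> x = x" if "x \<in> carrier A" for x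
    using that monoid.r_one[OF group.is_monoid[OF A]] monoid.l_one[OF group.is_monoid[OF A]] by blast+
  have oneB: "x \<otimes>\<^bsub>B\<^esub> \<one>\<^bsub>B\<^esub> = x" "\<one>\<^bsub>B\<^esub> \<otimes>\<^bsub>B\<^esub> x = x" if "x \<in> carrier B" for x
    using that monoid.r_one[OF group.is_monoid[OF B]] monoid.l_one[OF group.is_monoid[OF B]] by blast+
  have mult: "\<phi> (a \<otimes>\<^bsub>A\<^esub> a', b \<otimes>\<^bsub>B\<^esub> b') = \<phi> (a, b) + \<phi> (a', b')"
    if "\<phi> \<in> carrier ?H" "a \<in> carrier A" "a' \<in> carrier A" "b \<in> carrier B" "b' \<in> carrier B" for \<phi> a a' b b'
  proof -
    have "\<phi> ((a, b) \<otimes>\<^bsub>A \<times>\<times> B\<^esub> (a', b')) = \<phi> (a, b) + \<phi> (a', b')"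
      using that unfolding hom_module_iff by (metis mem_Sigma_iff DirProd_def partial_object.select_convs(1))
    then show ?thesis by simp
  qed
  have fA: "fA \<phi> \<in> carrier (hom_module A)" if "\<phi> \<in> carrier ?H" for \<phi>
    using mult[OF that _ _ one(2) one(2)] by (simp add: hom_module_iff fA_def Am oneB one)
  have fB: "fB \<phi> \<in> carrier (hom_module B)" if "\<phi> \<in> carrier ?H" for \<phi>
    using mult[OF that one(1) one(1)] by (simp add: hom_module_iff fB_def Bm oneA one)
  have split: "\<phi> (a, b) = fA \<phi> a + fB \<phi> b" if "\<phi> \<in> carrier ?H" "a \<in> carrier A" "b \<in> carrier B" for \<phi> a b
    using mult[OF that(1,2) one(1) one(2) that(3)] that by (simp add: fA_def fB_def oneA oneB)
  have ext: "\<phi> = \<psi>" if "\<phi> \<in> carrier ?H" "\<psi> \<in> carrier ?H" "fA \<phi> = fA \<psi>" "fB \<phi> = fB \<psi>" for \<phi> \<psi>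
  proof
    fix x
    show "\<phi> x = \<psi> x"
    proof (cases "x \<in> carrier (A \<times>\<times> B)")
      case True
      then have x: "x = (fst x, snd x)" "fst x \<in> carrier A" "snd x \<in> carrier B" by auto
      show ?thesis
        using split[OF that(1) x(2,3)] split[OF that(2) x(2,3)] that(3,4) by simp
    next
      case False
      have "\<phi> \<in> extensional (carrier (A \<times>\<times> B))" "\<psi> \<in> extensional (carrier (A \<times>\<times> B))"
        using that(1,2) unfolding hom_module_iff by blast+
      then show ?thesis using False by (metis extensional_arb)
    qed
  qed
  have fA_op: "fA (\<phi> \<oplus>\<^bsub>?H\<^esub> \<psi>) = fA \<phi> \<oplus>\<^bsub>hom_module A\<^esub> fA \<psi>" "fA (r \<odot>\<^bsub>?H\<^esub> \<phi>) = r \<odot>\<^bsub>hom_module A\<^esub> fA \<phi>" for \<phi> \<psi> r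
    using one by (auto simp: fA_def hom_module_simps fun_eq_iff restrict_def)
  have fB_op: "fB (\<phi> \<oplus>\<^bsub>?H\<^esub> \<psi>) = fB \<phi> \<oplus>\<^bsub>hom_module B\<^esub> fB \<psi>" "fB (r \<odot>\<^bsub>?H\<^esub> \<phi>) = r \<odot>\<^bsub>hom_module B\<^esub> fB \<phi>" for \<phi> \<psi> r
    using one by (auto simp: fB_def hom_module_simps fun_eq_iff restrict_def)
  let ?D = "finite_direct_sum I T"
  have carD: "carrier ?D = (\<Pi>\<^sub>E p\<in>I. carrier (T p))" by (simp add: finite_direct_sum_def)
  have \<Psi>D: "\<Psi> \<phi> \<in> carrier ?D" if "\<phi> \<in> carrier ?H" for \<phi>
    unfolding carD \<Psi>_def
    using bij_betwE[OF \<alpha>(1)] bij_betwE[OF \<beta>(1)] fA[OF that] fB[OF that] \<tau> by auto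
  show ?thesis
    unfolding module_isomorphic_def
  proof (intro exI[of _ \<Psi>] conjI ballI)
    show "bij_betw \<Psi> (carrier ?H) (carrier ?D)"
      unfolding bij_betw_def
    proof
      show "inj_on \<Psi> (carrier ?H)"
      proof (rule inj_onI)
        fix \<phi> \<psi> assume *: "\<phi> \<in> carrier ?H" "\<psi> \<in> carrier ?H" "\<Psi> \<phi> = \<Psi> \<psi>"
        have "\<alpha> (fA \<phi>) = \<alpha> (fA \<psi>)" using fun_cong[OF *(3), of i] i by (simp add: \<Psi>_def)
        then have 1: "fA \<phi> = fA \<psi>"
          by (rule inj_onD[OF bij_betw_imp_inj_on[OF \<alpha>(1)] _ fA[OF *(1)] fA[OF *(2)]])
        have 2: "fB \<phi> = fB \<psi>"
        proof (cases "j \<in> I")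
          case True
          then have "\<beta> (fB \<phi>) = \<beta> (fB \<psi>)" using fun_cong[OF *(3), of j] ij by (simp add: \<Psi>_def)
          then show ?thesis
            by (rule inj_onD[OF bij_betw_imp_inj_on[OF \<beta>(1)[OF True]] _ fB[OF *(1)] fB[OF *(2)]])
        next
          case False
          show ?thesis
            using fB[OF *(1)] fB[OF *(2)] unfolding hom_module_trivial_group[OF Tj(2)[OF False]] by simp
        qed
        show "\<phi> = \<psi>" by (rule ext[OF *(1,2) 1 2])
      qed
      show "\<Psi> ` carrier ?H = carrier ?D"
      proof
        show "carrier ?D \<subseteq> \<Psi> ` carrier ?H"
        proof
          fix d assume d: "d \<in> carrier ?D"
          then have dp: "d p \<in> carrier (T p)" if "p \<in> I" for p using that by (auto simp: carD)
          obtain u where u: "u \<in> carrier (hom_module A)" "\<alpha> u = d i"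
            using \<alpha>(1) dp[OF i] unfolding bij_betw_def by (metis imageE)
          have "\<exists>v\<in>carrier (hom_module B). j \<in> I \<longrightarrow> \<beta> v = d j"
          proof (cases "j \<in> I")
            case True
            then show ?thesis using \<beta>(1)[OF True] dp[OF True] unfolding bij_betw_def by (metis imageE)
          next
            case False
            then show ?thesis unfolding hom_module_trivial_group[OF Tj(2)[OF False]] by simp
          qed
          then obtain v where v: "v \<in> carrier (hom_module B)" "j \<in> I \<Longrightarrow> \<beta> v = d j" by blast
          define \<phi> where "\<phi> = (\<lambda>x\<in>carrier (A \<times>\<times> B). u (fst x) + v (snd x))"
          have \<phi>: "\<phi> \<in> carrier ?H"
            using u(1) v(1) by (auto simp: hom_module_iff \<phi>_def Am Bm)
          have "fA \<phi> = u"
            using u(1) hom_module_one[OF B v(1)] one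
            by (auto simp: fA_def \<phi>_def hom_module_iff extensional_def fun_eq_iff)
          moreover have "fB \<phi> = v"
            using v(1) hom_module_one[OF A u(1)] one
            by (auto simp: fB_def \<phi>_def hom_module_iff extensional_def fun_eq_iff)
          ultimately have "\<Psi> \<phi> p = d p" for p
            using d u v \<tau>[of p] dp[of p] by (auto simp: \<Psi>_def carD PiE_def extensional_def)
          then have "\<Psi> \<phi> = d" by (rule HOL.ext)
          with \<phi> show "d \<in> \<Psi> ` carrier ?H" by blast
        qed
      qed (use \<Psi>D in blast)
    qed
  next
    fix \<phi> \<psi> assume H: "\<phi> \<in> carrier ?H" "\<psi> \<in> carrier ?H"
    have "\<Psi> (\<phi> \<oplus>\<^bsub>?H\<^esub> \<psi>) p = (\<lambda>p\<in>I. \<Psi> \<phi> p \<oplus>\<^bsub>T p\<^esub> \<Psi> \<psi> p) p" for p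
      using \<tau>[of p] \<alpha>(2)[OF fA fA, OF H] \<beta>(2)[OF _ fB fB, OF _ H] by (auto simp: \<Psi>_def fA_op fB_op)
    then show "\<Psi> (\<phi> \<oplus>\<^bsub>?H\<^esub> \<psi>) = \<Psi> \<phi> \<oplus>\<^bsub>?D\<^esub> \<Psi> \<psi>"
      by (simp add: finite_direct_sum_def fun_eq_iff)
  next
    fix r \<phi> assume H: "r \<in> carrier rat_field" "\<phi> \<in> carrier ?H"
    have "\<Psi> (r \<odot>\<^bsub>?H\<^esub> \<phi>) p = (\<lambda>p\<in>I. r \<odot>\<^bsub>T p\<^esub> \<Psi> \<phi> p) p" for p
      using \<tau>[of p] \<alpha>(3)[OF fA, OF H(2)] \<beta>(3)[OF _ fB, OF _ H(2)] by (auto simp: \<Psi>_def fA_op fB_op)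
    then show "\<Psi> (r \<odot>\<^bsub>?H\<^esub> \<phi>) = r \<odot>\<^bsub>?D\<^esub> \<Psi> \<phi>"
      by (simp add: finite_direct_sum_def fun_eq_iff)
  qed
qed

text \<open>Of the summands indexed by \<open>p\<close> only \<open>p = k\<close> and
  \<open>p = k - 1\<close> survive: they pair with the lines in degrees 0 and 1 of the punctured
  plane, and match the two factors of the homology of the product.\<close>

proposition cohomologically_trivial_product:
  assumes "E homeomorphic_space prod_topology F Cstar_space"
  shows "cohomologically_trivial F E Cstar_space"
  unfolding cohomologically_trivial_def
proof
  fix k
  let ?T = "\<lambda>p. tensor_product rat_field (cohomology p F) (cohomology (k - p) Cstar_space)"
  have iso: "homology_group (int k) E \<cong> homology_group (int k) F \<times>\<times> homology_group (int k - 1) F"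
    by (rule iso_trans[OF homeomorphic_space_imp_isomorphic_homology_groups[OF assms] homology_prod_Cstar])
  have "module_isomorphic rat_field (hom_module (homology_group (int k) F \<times>\<times> homology_group (int k - 1) F))
      (finite_direct_sum {..k} ?T)"
  proof (cases k)
    case 0
    \<comment> \<open>No second summand exists in degree 0: \<open>Suc k\<close> lies outside
      \<open>{..k}\<close>, and homology in degree \<open>-1\<close> is trivial.\<close>
    show ?thesis
      by (rule hom_module_DirProd[where i = k and j = "Suc k"])
         (use 0 tensor_cohomology_Cstar_low[of 0 k F] in \<open>auto simp del: int_eq_iff_numeral\<close>)
  next
    case (Suc l)
    have l: "int k - 1 = int l" using Suc by simp
    show ?thesis unfolding l
    proof (rule hom_module_DirProd[where i = k and j = l])
      fix p assume "p \<in> {..k}" "p \<noteq> k" "p \<noteq> l"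
      then have "k - p \<ge> 2" using Suc by auto
      then show "module_isomorphic rat_field (hom_module (singleton_group ())) (?T p)"
        by (rule tensor_cohomology_Cstar_high)
    next
      show "module_isomorphic rat_field (hom_module (homology_group (int k) F)) (?T k)"
        using tensor_cohomology_Cstar_low[of 0 k F] by simp
      have "k - l = 1" using Suc by simp
      then show "module_isomorphic rat_field (hom_module (homology_group (int l) F)) (?T l)"
        using tensor_cohomology_Cstar_low[of 1 l F] by simp
    qed (use Suc in auto)
  qed
  then show "module_isomorphic rat_field (cohomology k E) (finite_direct_sum {..k} ?T)"
    by (rule module_isomorphic_trans[OF module_isomorphic_trans[OF conjunct1[OF universal_coefficients]
            hom_module_iso[OF iso group_relative_homology_group]]])
qed

theorem theorem3p6:
  fixes G H S :: "(complex^'n^'n) set"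
    and \<X> :: "(complex^'n^'n) set \<Rightarrow> complex"
  assumes "linear_algebraic_group G" and "connected G" and "reductive G"
    and "closed_subgroup H G"
    and "morphism (homogeneous_variety G H) Cstar_variety \<X>"
    and "\<not> \<X> constant_on (lcosets\<^bsub>matrix_group G\<^esub> H)"
    and "\<X> (coset_proj H (mat 1)) = 1"
    and "S = kernel (matrix_group G) Cstar_group (\<X> \<circ> coset_proj H)"
    and "connected S"
  shows "cohomologically_trivial (homogeneous_space S H) (homogeneous_space G H) Cstar_space"
proof (rule cohomologically_trivial_product)
  let ?f = "\<X> \<circ> coset_proj H"
  note G = assms(1) and con = assms(2) and mor = assms(5)
  have S: "S = {g \<in> G. ?f g = 1}"
    by (simp add: assms(8) kernel_def Cstar_group_def)
  have cosets: "lcosets\<^bsub>matrix_group G\<^esub> H = coset_proj H ` G"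
    by (metis topspace_homogeneous_space topspace_homogeneous_space')
  have top: "topspace (zariski (homogeneous_variety G H)) = coset_proj H ` G"
    by (simp add: homogeneous_variety_def quotient_variety_def quasi_affine_def)
  have Cst: "topspace (zariski Cstar_variety) = UNIV - {0}"
    by (simp add: Cstar_variety_def quasi_affine_def)
  have nz: "?f g \<noteq> 0" if "g \<in> G" for g
  proof -
    have "\<X> (coset_proj H g) \<in> topspace (zariski Cstar_variety)"
      using mor that top unfolding morphism_def continuous_map_def by blast
    then show ?thesis by (simp add: Cst)
  qed
  \<comment> \<open>The coordinate function of the punctured line. Its pullback along
    \<open>\<X>\<close> and the coset projection is the associated character, which is how
    regularity reaches \<open>G\<close>.\<close>
  have id: "(\<lambda>z. z) \<in> regular Cstar_variety (UNIV - {0})"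
  proof -
    have op: "openin (zariski_topology {\<lambda>z. z} (UNIV - {0 :: complex})) (UNIV - {0})"
      using openin_topspace[of "zariski_topology {\<lambda>z. z} (UNIV - {0 :: complex})"] by simp
    have p: "(\<lambda>z. z) \<in> poly_funs {\<lambda>z :: complex. z}" and q: "(\<lambda>_. 1) \<in> poly_funs {\<lambda>z :: complex. z}"
      by (auto intro: poly_funs.intros)
    have "\<exists>p\<in>poly_funs {\<lambda>z :: complex. z}. \<exists>q\<in>poly_funs {\<lambda>z :: complex. z}.
        \<forall>y\<in>UNIV - {0}. q y \<noteq> 0 \<and> y = p y / q y"
      by (rule bexI[OF _ p], rule bexI[OF _ q]) simp
    with op show ?thesis
      unfolding Cstar_variety_def quasi_affine_def variety.simps mem_Collect_eq
      by (intro ballI exI[of _ "UNIV - {0}"] conjI) simp_all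
  qed
  have reg: "?f \<in> regular (quasi_affine entries G) G"
  proof -
    have pull: "(\<lambda>z. z) \<circ> \<X> \<in> regular (homogeneous_variety G H)
        {D \<in> topspace (zariski (homogeneous_variety G H)). \<X> D \<in> UNIV - {0}}"
      using mor id openin_topspace[of "zariski Cstar_variety"] unfolding morphism_def Cst by blast
    have "{g \<in> topspace (zariski (quasi_affine entries G)).
        coset_proj H g \<in> {D \<in> coset_proj H ` G. \<X> D \<in> UNIV - {0}}} = G"
      using nz by (auto simp: quasi_affine_def)
    with pull[unfolded top] show ?thesis
      unfolding homogeneous_variety_def quotient_variety_def variety.simps mem_Collect_eq
      by (simp only: o_def)
  qed
  have f1: "?f (mat 1) = 1" using assms(7) by simp
  have nonconst: "\<exists>g\<in>G. ?f g \<noteq> 1"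
    using assms(6) unfolding cosets constant_on_def by (auto simp: o_def)
  have conS: "connected {g \<in> G. ?f g = 1}" using assms(9) S by simp
  obtain \<sigma> \<tau> where \<sigma>: "continuous_on (UNIV - {0}) \<sigma>" "continuous_on (UNIV - {0}) \<tau>"
    "\<And>z. z \<noteq> 0 \<Longrightarrow> \<sigma> z \<in> G \<and> \<tau> z \<in> G \<and> ?f (\<sigma> z) = z \<and> \<sigma> z ** \<tau> z = mat 1 \<and> \<tau> z ** \<sigma> z = mat 1"
    using character_section[OF G con reg nz f1 nonconst conS] by blast
  have G_group: "mat 1 \<in> G" "\<And>g h. g \<in> G \<Longrightarrow> h \<in> G \<Longrightarrow> g ** h \<in> G"
    using linear_algebraic_group_closed[OF G] by (auto simp: closed_linear_group_def)
  show "homogeneous_space G H homeomorphic_space prod_topology (homogeneous_space S H) Cstar_space"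
    by (rule homogeneous_space_splits[OF _ G_group(2) _ nz _ S _ \<sigma>])
       (use G_group f1 invertible_regular_function_hom[OF G con reg nz f1]
          continuous_on_regular_function[OF G reg] in \<open>auto simp: S\<close>)
qed

end
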